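(* Let $B$ be a standard Brownian motion, $\mu\in\mathbb{R}$, and $A^{(\mu)}_t=\int_0^te^{2(B_u+\mu u)}\,du$. Fix $\beta>0$ and $t>0$. For $x\ge0$ define $$G_t(x)=e^{-t\mu^2/2}\,\mathbb{E}\exp\Big(\mu B_t+\frac{1}{2t}\big(B_t^2-\varphi_x^2(B_t)\big)\Big),\quad \varphi_x(y)=\ln\Big(xe^{-y}+\cosh(y)+\sqrt{x^2e^{-2y}+\sinh^2(y)+2xe^{-y}\cosh(y)}\Big).$$ Then $$\mathbb{E}\ln\big(1+\beta A^{(\mu)}_t\big)=\int_0^\infty\frac{G_t(y)}{y}\big(1-e^{-y\beta}\big)\,dy,\qquad \mathbb{E}\Big(\frac{1}{1+\beta A^{(\mu)}_t}\Big)=1-\beta\int_0^\infty G_t(y)e^{-y\beta}\,dy.$$ *)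

theory Defs
  imports "HOL-Probability.Probability"
begin

definition std_brownian_motion :: "'a measure \<Rightarrow> (real \<Rightarrow> 'a \<Rightarrow> real) \<Rightarrow> bool" where
  "std_brownian_motion M B \<longleftrightarrow>
     prob_space M \<and>
     (\<forall>t\<ge>0. B t \<in> borel_measurable M) \<and>
     (\<forall>\<omega>\<in>space M. B 0 \<omega> = 0) \<and>
     (\<forall>\<omega>\<in>space M. continuous_on {0..} (\<lambda>t. B t \<omega>)) \<and>
     (\<forall>s t. 0 \<le> s \<and> s < t \<longrightarrow>
        distributed M lborel (\<lambda>\<omega>. B t \<omega> - B s \<omega>)
          (\<lambda>x. ennreal (normal_density 0 (sqrt (t - s)) x))) \<and>
     (\<forall>ts :: real list. sorted_wrt (<) ts \<and> ts \<noteq> [] \<and> 0 \<le> hd ts \<longrightarrow>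
        prob_space.indep_vars M (\<lambda>_. borel)
          (\<lambda>i \<omega>. B (ts ! Suc i) \<omega> - B (ts ! i) \<omega>) {..<length ts - 1})"

definition exp_functional :: "(real \<Rightarrow> 'a \<Rightarrow> real) \<Rightarrow> real \<Rightarrow> real \<Rightarrow> 'a \<Rightarrow> real" where
  "exp_functional B \<mu> t \<omega> = integral {0..t} (\<lambda>u. exp (2 * (B u \<omega> + \<mu> * u)))"

definition phi_fun :: "real \<Rightarrow> real \<Rightarrow> real" where
  "phi_fun x y = ln (x * exp (- y) + cosh y +
      sqrt (x\<^sup>2 * exp (- 2 * y) + (sinh y)\<^sup>2 + 2 * x * exp (- y) * cosh y))"

definition G_fun :: "'a measure \<Rightarrow> (real \<Rightarrow> 'a \<Rightarrow> real) \<Rightarrow> real \<Rightarrow> real \<Rightarrow> real \<Rightarrow> real" where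
  "G_fun M B \<mu> t x = exp (- t * \<mu>\<^sup>2 / 2) *
     (\<integral>\<omega>. exp (\<mu> * B t \<omega> + ((B t \<omega>)\<^sup>2 - (phi_fun x (B t \<omega>))\<^sup>2) / (2 * t)) \<partial>M)"

end

theory Submission
  imports Defs
begin

text \<open>
  Write \<open>A = A\<^sub>t\<close>. The key identity is \<open>G\<^sub>t(x) = E exp(-x/A)\<close>. Given it, Tonelli together with
  \<open>ln(1 + \<beta>A) = \<integral>\<^sub>0\<^sup>\<infinity> exp(-y/A) (1 - exp(-\<beta>y))/y dy\<close> (Frullani) and
  \<open>1/(1 + \<beta>A) = 1 - \<beta> \<integral>\<^sub>0\<^sup>\<infinity> exp(-y/A) exp(-\<beta>y) dy\<close> yields both formulas.

  The identity is proved without stochastic calculus, by uniqueness for the degenerate parabolic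
  equation \<open>F\<^sub>t = (2x\<^sup>2 + x) F\<^sub>x\<^sub>x + 2(1 - \<mu>) x F\<^sub>x\<close> on \<open>x > 0\<close>. For \<open>F(t,x) = E exp(-x/A\<^sub>t)\<close> one expands
  \<open>A\<^sub>t = A\<^sub>h + exp(2(B\<^sub>h + \<mu>h)) A'\<^sub>t\<^sub>-\<^sub>h\<close>, where \<open>A'\<close> is the functional of the shifted path and hence
  independent of \<open>B\<^sub>h\<close>, to order \<open>h\<close>; the Taylor remainders are bounded uniformly in \<open>A'\<close>, and one obtains
  a left time derivative. For \<open>G\<close> one uses that \<open>t\<^sup>-\<^sup>1\<^sup>/\<^sup>2 exp(-\<phi>\<^sup>2/2t)\<close> solves the heat equation in \<open>\<phi>\<close>, where
  \<open>cosh \<phi> = x exp(-y) + cosh y\<close>. Both functions equal 1 at \<open>x = 0\<close> and tend to 0 as \<open>t \<rightarrow> 0\<close>. To avoid the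
  discontinuity at the corner \<open>(0,0)\<close>, the maximum principle is applied to \<open>G(t + \<epsilon>) - F(t)\<close> and to
  \<open>F(t + \<epsilon>) - G(t)\<close>.
\<close>

section \<open>Calculus and the maximum principle\<close>

text \<open>The operator combines two effects on \<open>exp(-x/A)\<close>. Over a short initial time
  \<open>h\<close> the path multiplies the later functional by \<open>exp(2b)\<close>, where
  \<open>b\<close> has mean \<open>\<mu> h\<close> and variance \<open>h\<close>; in the variable
  \<open>x\<close> this gives \<open>2x^2 F_xx + 2(1 - \<mu>) x F_x\<close>. The added
  \<open>A_h\<close>, about \<open>h\<close>, gives \<open>x F_xx\<close>. Because the increment is
  split off at the start of the path, time \<open>t\<close> is compared with time
  \<open>t - h\<close>: this is why a left derivative appears, and the maximum principle is built
  for it. The hypotheses on \<open>B\<close> speak of continuous paths and of finitely many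
  increments only. Hence equality in law of the shifted functional, its independence of
  \<open>B_h\<close> and its moment bounds are all proved for Riemann sums, which are functions of
  finitely many increments, and then carried to the limit. In the comparison each function
  contributes one edge: the time-shifted upper one is uniformly near 1 close to
  \<open>x = 0\<close>, the lower one is uniformly small at early times away from
  \<open>x = 0\<close>. At infinity nothing is known beyond the bounds 0 and 1; a barrier growing
  linearly in \<open>x\<close> makes up for this.\<close>

lemma has_real_derivative_lebesgue_integral:
  fixes f f' :: "real \<Rightarrow> 'b \<Rightarrow> real"
  assumes "a < x0" "x0 < b"
    and int: "\<And>x. a < x \<Longrightarrow> x < b \<Longrightarrow> integrable M (f x)"
    and der: "\<And>x y. a < x \<Longrightarrow> x < b \<Longrightarrow> y \<in> space M \<Longrightarrow>
                ((\<lambda>x. f x y) has_real_derivative f' x y) (at x)"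
    and bound: "\<And>x y. a < x \<Longrightarrow> x < b \<Longrightarrow> y \<in> space M \<Longrightarrow> \<bar>f' x y\<bar> \<le> w y"
    and w: "integrable M w"
    and meas: "f' x0 \<in> borel_measurable M"
  shows "((\<lambda>x. \<integral>y. f x y \<partial>M) has_real_derivative (\<integral>y. f' x0 y \<partial>M)) (at x0)"
  unfolding has_field_derivative_iff tendsto_at_iff_sequentially comp_def
proof (intro allI impI)
  fix X :: "nat \<Rightarrow> real"
  assume X: "\<forall>i. X i \<in> UNIV - {x0}" "X \<longlonglongrightarrow> x0"
  \<comment> \<open>The sequence lies in the interval only eventually. Stray terms are moved to a
    fixed point other than \<open>x0\<close>, so that the domination holds for every index.\<close>
  define X' where "X' i = (if a < X i \<and> X i < b then X i else (x0 + b) / 2)" for i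
  have ev: "eventually (\<lambda>i. a < X i \<and> X i < b) sequentially"
    using order_tendstoD(1)[OF X(2) assms(1)] order_tendstoD(2)[OF X(2) assms(2)] by (rule eventually_conj)
  have ev': "eventually (\<lambda>i. X' i = X i) sequentially"
    using ev by eventually_elim (simp add: X'_def)
  have X'1: "a < X' i" "X' i < b" "X' i \<noteq> x0" for i
    using X(1) assms(1,2) by (auto simp: X'_def)
  have X'2: "X' \<longlonglongrightarrow> x0"
    using X(2) tendsto_cong[OF ev'] by blast
  have q: "(\<lambda>i. \<integral>y. (f (X' i) y - f x0 y) / (X' i - x0) \<partial>M) \<longlonglongrightarrow> (\<integral>y. f' x0 y \<partial>M)"
  proof (rule integral_dominated_convergence[where w = w])
    show "(\<lambda>y. (f (X' i) y - f x0 y) / (X' i - x0)) \<in> borel_measurable M" for i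
      using int[OF X'1(1,2)] int[OF assms(1,2)] by (auto dest!: borel_measurable_integrable)
    show "AE y in M. (\<lambda>i. (f (X' i) y - f x0 y) / (X' i - x0)) \<longlonglongrightarrow> f' x0 y"
    proof (rule AE_I2)
      fix y assume "y \<in> space M"
      from der[OF assms(1,2) this] X'1 X'2
      show "(\<lambda>i. (f (X' i) y - f x0 y) / (X' i - x0)) \<longlonglongrightarrow> f' x0 y"
        unfolding has_field_derivative_iff tendsto_at_iff_sequentially comp_def by auto
    qed
    show "AE y in M. norm ((f (X' i) y - f x0 y) / (X' i - x0)) \<le> w y" for i
    proof (rule AE_I2)
      fix y assume y: "y \<in> space M"
      have "norm (f (X' i) y - f x0 y) \<le> w y * norm (X' i - x0)"
      proof (rule field_differentiable_bound[where S = "{a<..<b}" and f' = "\<lambda>x. f' x y"])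
        fix z assume "z \<in> {a<..<b}"
        then show "((\<lambda>x. f x y) has_field_derivative f' z y) (at z within {a<..<b})"
          using der[of z y] y by (auto intro: DERIV_subset)
      qed (use X'1 assms(1,2) bound y in auto)
      then show "norm ((f (X' i) y - f x0 y) / (X' i - x0)) \<le> w y"
        using X'1(3)[of i] by (simp add: divide_le_eq)
    qed
  qed (use w meas in auto)
  have "eventually (\<lambda>i. (\<integral>y. (f (X' i) y - f x0 y) / (X' i - x0) \<partial>M) =
      ((\<integral>y. f (X i) y \<partial>M) - (\<integral>y. f x0 y \<partial>M)) / (X i - x0)) sequentially"
    using ev'
  proof eventually_elim
    case (elim i)
    then show ?case
      using int[OF X'1(1,2)[of i]] int[OF assms(1,2)] by simp
  qed
  from tendsto_cong[OF this] q
  show "(\<lambda>i. ((\<integral>y. f (X i) y \<partial>M) - (\<integral>y. f x0 y \<partial>M)) / (X i - x0)) \<longlonglongrightarrow> (\<integral>y. f' x0 y \<partial>M)"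
    by blast
qed

text \<open>A single term of the exponential series is at most its sum. The numerical constants in
  the expansion of \<open>exp(-x/A)\<close> are built from the values 1, 2, 6, 24 that this
  gives.\<close>

lemma power_mult_exp_minus_le_fact:
  fixes v :: real
  assumes "v \<ge> 0"
  shows "v ^ n * exp (- v) \<le> fact n"
proof -
  have "(\<Sum>i\<in>{n}. v ^ i /\<^sub>R fact i) \<le> (\<Sum>i. v ^ i /\<^sub>R fact i)"
    by (rule sum_le_suminf[OF summable_exp_generic]) (use assms in auto)
  then have "v ^ n / fact n \<le> exp v"
    by (simp add: exp_def field_simps)
  then show ?thesis
    by (simp add: exp_minus field_simps)
qed

lemma Taylor_remainder_order3:
  fixes f :: "real \<Rightarrow> real"
  assumes "\<And>b. (f has_real_derivative f1 b) (at b)"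
    and "\<And>b. (f1 has_real_derivative f2 b) (at b)"
    and "\<And>b. (f2 has_real_derivative f3 b) (at b)"
    and "\<And>b. \<bar>f3 b\<bar> \<le> K"
  shows "\<bar>f b - (f 0 + b * f1 0 + b\<^sup>2 / 2 * f2 0)\<bar> \<le> K * \<bar>b\<bar> ^ 3 / 6"
proof -
  define diff where "diff = (\<lambda>m::nat. if m = 0 then f else if m = 1 then f1 else if m = 2 then f2 else f3)"
  have "\<forall>m t. m < 3 \<and> \<bar>t\<bar> \<le> \<bar>b\<bar> \<longrightarrow> DERIV (diff m) t :> diff (Suc m) t"
    using assms(1-3) by (auto simp: diff_def less_Suc_eq numeral_3_eq_3)
  moreover have "diff 0 = f" by (simp add: diff_def)
  ultimately obtain t where "f b = (\<Sum>m<3. diff m 0 / fact m * b ^ m) + diff 3 t / fact 3 * b ^ 3"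
    using Maclaurin_bi_le[of diff f 3 b] by blast
  then have "f b - (f 0 + b * f1 0 + b\<^sup>2 / 2 * f2 0) = f3 t * b ^ 3 / 6"
    by (simp add: diff_def numeral_3_eq_3 fact_numeral power2_eq_square field_simps)
  then have "\<bar>f b - (f 0 + b * f1 0 + b\<^sup>2 / 2 * f2 0)\<bar> = \<bar>f3 t\<bar> * \<bar>b\<bar> ^ 3 / 6"
    by (simp only: abs_mult abs_divide power_abs abs_numeral)
  then show ?thesis
    using assms(4)[of t] by (simp add: mult_right_mono)
qed

lemma Taylor_remainder_order2_nonneg:
  fixes f :: "real \<Rightarrow> real"
  assumes "\<And>s. s \<ge> 0 \<Longrightarrow> (f has_real_derivative f1 s) (at s)"
    and "\<And>s. s \<ge> 0 \<Longrightarrow> (f1 has_real_derivative f2 s) (at s)"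
    and "\<And>s. s \<ge> 0 \<Longrightarrow> \<bar>f2 s\<bar> \<le> K" and "h \<ge> 0"
  shows "\<bar>f h - (f 0 + h * f1 0)\<bar> \<le> K * h\<^sup>2 / 2"
proof (cases "h = 0")
  case False
  define diff where "diff = (\<lambda>m::nat. if m = 0 then f else if m = 1 then f1 else f2)"
  have "\<forall>m t. m < 2 \<and> 0 \<le> t \<and> t \<le> h \<longrightarrow> DERIV (diff m) t :> diff (Suc m) t"
    using assms(1,2) by (auto simp: diff_def less_Suc_eq numeral_2_eq_2)
  moreover have "diff 0 = f" by (simp add: diff_def)
  ultimately obtain t where t: "0 < t" "f h = (\<Sum>m<2. diff m 0 / fact m * h ^ m) + diff 2 t / fact 2 * h ^ 2"
    using Maclaurin[of h 2 diff f] False assms(4) by auto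
  then have "f h - (f 0 + h * f1 0) = f2 t * h\<^sup>2 / 2"
    by (simp add: diff_def numeral_2_eq_2 field_simps)
  then have "\<bar>f h - (f 0 + h * f1 0)\<bar> = \<bar>f2 t\<bar> * h\<^sup>2 / 2"
    by (simp only: abs_mult abs_divide abs_power2 abs_numeral)
  then show ?thesis
    using assms(3)[of t] t(1) by (simp add: mult_right_mono)
qed (use assms in auto)

text \<open>The deterministic core of the short-time expansion, with \<open>\<alpha>\<close> for
  \<open>A_h\<close>, \<open>b\<close> for \<open>B_h + \<mu> h\<close> and \<open>a\<close> for the
  later functional. There are four replacements: \<open>\<alpha>\<close> by \<open>h\<close>,
  linearisation in \<open>h\<close>, moving the slope in \<open>h\<close> from \<open>b\<close> to
  0, and expansion in \<open>b\<close>. Typically \<open>b\<close> has size \<open>sqrt h\<close>,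
  so \<open>b^2\<close> is kept while \<open>h * b\<close> and \<open>b^3\<close> are errors of
  order \<open>h^(3/2)\<close>. Every derivative is a polynomial in a positive ratio times its
  negative exponential, hence bounded uniformly in \<open>a\<close>.\<close>

lemma exp_neg_div_Taylor_bound:
  fixes x a b \<alpha> h :: real
  assumes "x > 0" "a > 0" "\<alpha> \<ge> 0" "h \<ge> 0"
  defines "v \<equiv> x / a"
  shows "\<bar>exp (- x / (\<alpha> + exp (2 * b) * a)) -
      (exp (- v) + b * (2 * v * exp (- v)) + b\<^sup>2 / 2 * (4 * (v\<^sup>2 - v) * exp (- v)) + h * (v\<^sup>2 * exp (- v) / x))\<bar>
    \<le> 2 / x * \<bar>\<alpha> - h\<bar> + 18 / x\<^sup>2 * h\<^sup>2 + 20 / x * (h * \<bar>b\<bar>) + 18 * \<bar>b\<bar> ^ 3"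
proof -
  have v: "v > 0" using assms by simp
  have pw: "z ^ n * exp (- z) \<le> fact n" if "z \<ge> 0" for z :: real and n
    by (rule power_mult_exp_minus_le_fact[OF that])
  have pw1: "z * exp (- z) \<le> 1" "z\<^sup>2 * exp (- z) \<le> 2" "z ^ 3 * exp (- z) \<le> 6" "z ^ 4 * exp (- z) \<le> 24"
    "0 \<le> z * exp (- z)" "0 \<le> z\<^sup>2 * exp (- z)" "0 \<le> z ^ 3 * exp (- z)" "0 \<le> z ^ 4 * exp (- z)"
    if "z \<ge> 0" for z :: real
    using pw[OF that, of 1] pw[OF that, of 2] pw[OF that, of 3] pw[OF that, of 4] that
    by (simp_all add: fact_numeral)
  define E where "E = exp (2 * b) * a"
  have E: "E > 0" using assms by (simp add: E_def)
  define u where "u s = x / (s + E)" for s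
  have u: "u s > 0" if "s \<ge> 0" for s using that E assms by (simp add: u_def)
  define k where "k s = exp (- u s)" for s
  define k1 where "k1 s = (u s)\<^sup>2 * exp (- u s) / x" for s
  define k2 where "k2 s = ((u s) ^ 4 - 2 * (u s) ^ 3) * exp (- u s) / x\<^sup>2" for s
  \<comment> \<open>The derivative of \<open>u\<close> is again a polynomial in \<open>u\<close>, so
    all \<open>s\<close>-derivatives of \<open>exp(-u)\<close> stay polynomials in \<open>u\<close>
    times \<open>exp(-u)\<close>.\<close>
  have du: "(u has_real_derivative - (u s)\<^sup>2 / x) (at s)" if "s \<ge> 0" for s
  proof -
    have "s + E \<noteq> 0" using that E by simp
    then have "(u has_real_derivative - x / (s + E)\<^sup>2) (at s)"
      unfolding u_def by (auto intro!: derivative_eq_intros simp: power2_eq_square)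
    then show ?thesis
      using assms(1) by (simp add: u_def power2_eq_square)
  qed
  have dk: "(k has_real_derivative k1 s) (at s)" if "s \<ge> 0" for s
    unfolding k_def k1_def
    by (auto intro!: derivative_eq_intros du[OF that])
  have dk1: "(k1 has_real_derivative k2 s) (at s)" if "s \<ge> 0" for s
    unfolding k1_def k2_def
    using assms(1)
    by (auto intro!: derivative_eq_intros du[OF that]
        simp: field_simps power2_eq_square power3_eq_cube power4_eq_xxxx)
  have bk1: "\<bar>k1 s\<bar> \<le> 2 / x" if "s \<ge> 0" for s
    using pw1[of "u s"] u[OF that] assms by (simp add: k1_def divide_right_mono)
  have bk2: "\<bar>k2 s\<bar> \<le> 36 / x\<^sup>2" if "s \<ge> 0" for s
  proof -
    \<comment> \<open>36 = 24 + 2 * 6.\<close>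
    have "\<bar>(u s) ^ 4 * exp (- u s) - 2 * ((u s) ^ 3 * exp (- u s))\<bar> \<le> 36"
      using pw1[of "u s"] u[OF that] by linarith
    then show ?thesis
      using assms by (simp add: k2_def abs_mult left_diff_distrib mult.assoc divide_right_mono)
  qed
  have 1: "\<bar>k \<alpha> - k h\<bar> \<le> 2 / x * \<bar>\<alpha> - h\<bar>"
  proof -
    have "norm (k \<alpha> - k h) \<le> 2 / x * norm (\<alpha> - h)"
      by (rule field_differentiable_bound[where S = "{0..}" and f' = k1])
         (use dk bk1 assms in \<open>auto intro: DERIV_subset\<close>)
    then show ?thesis by simp
  qed
  have 2: "\<bar>k h - (k 0 + h * k1 0)\<bar> \<le> 36 / x\<^sup>2 * h\<^sup>2 / 2"
    by (rule Taylor_remainder_order2_nonneg[OF dk dk1 bk2]) (use assms in auto)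
  \<comment> \<open>The dependence on \<open>b\<close> alone: \<open>z' = -2z\<close> gives the same
    closure under differentiation, and \<open>z b = u 0\<close> links the two expansions.\<close>
  define z where "z c = v * exp (- 2 * c)" for c
  have z: "z c > 0" for c using v by (simp add: z_def)
  have dz: "(z has_real_derivative - 2 * z c) (at c)" for c
    unfolding z_def by (auto intro!: derivative_eq_intros)
  have zu: "z b = u 0"
    using assms by (simp add: z_def u_def E_def v_def exp_minus field_simps)
  have z0: "z 0 = v" by (simp add: z_def)
  define m where "m c = (z c)\<^sup>2 * exp (- z c) / x" for c
  have dm: "(m has_real_derivative (2 * (z c) ^ 3 - 4 * (z c)\<^sup>2) * exp (- z c) / x) (at c)" for c
    unfolding m_def
    using assms(1)
    by (auto intro!: derivative_eq_intros dz
        simp: field_simps power2_eq_square power3_eq_cube)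
  have bm: "\<bar>(2 * (z c) ^ 3 - 4 * (z c)\<^sup>2) * exp (- z c) / x\<bar> \<le> 20 / x" for c
  proof -
    \<comment> \<open>20 = 2 * 6 + 4 * 2.\<close>
    have "\<bar>2 * ((z c) ^ 3 * exp (- z c)) - 4 * ((z c)\<^sup>2 * exp (- z c))\<bar> \<le> 20"
      using pw1[of "z c"] z[of c] by linarith
    then show ?thesis
      using assms by (simp add: abs_mult left_diff_distrib mult.assoc divide_right_mono)
  qed
  have 3: "\<bar>m b - m 0\<bar> \<le> 20 / x * \<bar>b\<bar>"
  proof -
    have "norm (m b - m 0) \<le> 20 / x * norm (b - 0)"
      by (rule field_differentiable_bound[where S = UNIV]) (use dm bm in auto)
    then show ?thesis by simp
  qed
  define p where "p c = exp (- z c)" for c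
  define p1 where "p1 c = 2 * z c * exp (- z c)" for c
  define p2 where "p2 c = 4 * ((z c)\<^sup>2 - z c) * exp (- z c)" for c
  define p3 where "p3 c = 8 * ((z c) ^ 3 - 3 * (z c)\<^sup>2 + z c) * exp (- z c)" for c
  have dp: "(p has_real_derivative p1 c) (at c)" for c
    unfolding p_def p1_def by (auto intro!: derivative_eq_intros dz)
  have dp1: "(p1 has_real_derivative p2 c) (at c)" for c
    unfolding p1_def p2_def
    by (auto intro!: derivative_eq_intros dz simp: algebra_simps power2_eq_square)
  have dp2: "(p2 has_real_derivative p3 c) (at c)" for c
    unfolding p2_def p3_def
    by (auto intro!: derivative_eq_intros dz simp: algebra_simps power2_eq_square power3_eq_cube)
  have bp3: "\<bar>p3 c\<bar> \<le> 104" for c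
  proof -
    \<comment> \<open>104 = 8 * 6 + 24 * 2 + 8 * 1; dividing by 6 and rounding up gives the 18 of
      the statement.\<close>
    have "\<bar>8 * ((z c) ^ 3 * exp (- z c)) - 24 * ((z c)\<^sup>2 * exp (- z c)) + 8 * (z c * exp (- z c))\<bar> \<le> 104"
      using pw1[of "z c"] z[of c] by linarith
    then show ?thesis
      by (simp add: p3_def algebra_simps)
  qed
  have 4: "\<bar>p b - (p 0 + b * p1 0 + b\<^sup>2 / 2 * p2 0)\<bar> \<le> 104 * \<bar>b\<bar> ^ 3 / 6"
    by (rule Taylor_remainder_order3[OF dp dp1 dp2 bp3])
  have eq: "k \<alpha> = exp (- x / (\<alpha> + exp (2 * b) * a))" "k 0 = p b" "k1 0 = m b"
    by (simp_all add: k_def k1_def m_def p_def zu) (simp add: u_def E_def)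
  have 5: "\<bar>h * k1 0 - h * m 0\<bar> \<le> 20 / x * (h * \<bar>b\<bar>)"
    using mult_left_mono[OF 3 assms(4)] assms(4) unfolding eq
    by (simp add: right_diff_distrib[symmetric] abs_mult mult_ac)
  have 6: "0 \<le> \<bar>b\<bar> ^ 3" by simp
  have tri: "\<bar>A - (Q + N)\<bar> \<le> e1 + e2 + e3 + e4"
    if "\<bar>A - B\<bar> \<le> e1" "\<bar>B - (P + K)\<bar> \<le> e2" "\<bar>K - N\<bar> \<le> e3" "\<bar>P - Q\<bar> \<le> e4"
    for A B P Q K N e1 e2 e3 e4 :: real
    using that by linarith
  have 7: "\<bar>p b - (p 0 + b * p1 0 + b\<^sup>2 / 2 * p2 0)\<bar> \<le> 18 * \<bar>b\<bar> ^ 3"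
    by (rule order_trans[OF 4]) (use 6 in simp)
  have "36 / x\<^sup>2 * h\<^sup>2 / 2 = 18 / x\<^sup>2 * h\<^sup>2" by simp
  from tri[OF 1 2[unfolded eq(2) this] 5 7]
  have "\<bar>k \<alpha> - (p 0 + b * p1 0 + b\<^sup>2 / 2 * p2 0 + h * m 0)\<bar> \<le>
      2 / x * \<bar>\<alpha> - h\<bar> + 18 / x\<^sup>2 * h\<^sup>2 + 20 / x * (h * \<bar>b\<bar>) + 18 * \<bar>b\<bar> ^ 3" .
  then show ?thesis
    unfolding eq(1) by (simp add: p_def p1_def p2_def m_def z0)
qed

text \<open>The barrier \<open>\<delta> exp(C(t - t1)) (1 + x)\<close> is a strict supersolution: it
  is linear in \<open>x\<close>, and \<open>C (1 + x)\<close> exceeds the drift contribution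
  \<open>2 (1 - \<mu>) x\<close>. A negative minimum of \<open>w\<close> plus the barrier would
  contradict the equation. Its growth in \<open>x\<close> permits the weak bound at
  \<open>X\<close>, where later only \<open>w \<ge> -1\<close> is known. At a minimum only earlier
  times are compared, so a left derivative suffices and the final time \<open>T\<close> is
  included.\<close>

lemma parabolic_maximum_principle:
  fixes w :: "real \<Rightarrow> real \<Rightarrow> real" and \<mu> t1 T x1 X \<delta> t x :: real
  assumes "t1 < T" "0 < x1" "x1 < X" "\<delta> > 0"
    and cont: "continuous_on ({t1..T} \<times> {x1..X}) (\<lambda>(t, x). w t x)"
    and dx: "\<And>t x. t1 < t \<Longrightarrow> t \<le> T \<Longrightarrow> x1 < x \<Longrightarrow> x < X \<Longrightarrow> ((\<lambda>x. w t x) has_real_derivative wx t x) (at x)"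
    and dxx: "\<And>t x. t1 < t \<Longrightarrow> t \<le> T \<Longrightarrow> x1 < x \<Longrightarrow> x < X \<Longrightarrow> ((\<lambda>x. wx t x) has_real_derivative wxx t x) (at x)"
    and dt: "\<And>t x. t1 < t \<Longrightarrow> t \<le> T \<Longrightarrow> x1 < x \<Longrightarrow> x < X \<Longrightarrow>
       ((\<lambda>t. w t x) has_real_derivative ((2 * x\<^sup>2 + x) * wxx t x + 2 * (1 - \<mu>) * x * wx t x)) (at_left t)"
    and bd0: "\<And>x. x1 \<le> x \<Longrightarrow> x \<le> X \<Longrightarrow> w t1 x \<ge> - \<delta>"
    and bd1: "\<And>t. t1 \<le> t \<Longrightarrow> t \<le> T \<Longrightarrow> w t x1 \<ge> - \<delta>"
    and bd2: "\<And>t. t1 \<le> t \<Longrightarrow> t \<le> T \<Longrightarrow> w t X \<ge> - \<delta> * (1 + X)"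
    and "t1 \<le> t" "t \<le> T" "x1 \<le> x" "x \<le> X"
  shows "w t x \<ge> - \<delta> * exp ((2 * \<bar>1 - \<mu>\<bar> + 1) * (t - t1)) * (1 + x)"
proof -
  define C where "C = 2 * \<bar>1 - \<mu>\<bar> + 1"
  define W where "W t x = w t x + \<delta> * exp (C * (t - t1)) * (1 + x)" for t x
  have C: "C > 0" unfolding C_def by (rule add_nonneg_pos) auto
  have contW: "continuous_on ({t1..T} \<times> {x1..X}) (\<lambda>p. W (fst p) (snd p))"
    unfolding W_def using cont by (auto intro!: continuous_intros simp: case_prod_beta)
  obtain p where p: "p \<in> {t1..T} \<times> {x1..X}"
     and pmin: "\<And>q. q \<in> {t1..T} \<times> {x1..X} \<Longrightarrow> W (fst p) (snd p) \<le> W (fst q) (snd q)"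
    using continuous_attains_inf[OF _ _ contW] assms(1,3) by (auto simp: compact_Times)
  obtain t0 x0 where tx: "p = (t0, x0)" by (cases p)
  have r: "t1 \<le> t0" "t0 \<le> T" "x1 \<le> x0" "x0 \<le> X" using p tx by auto
  have min: "W t0 x0 \<le> W s y" if "t1 \<le> s" "s \<le> T" "x1 \<le> y" "y \<le> X" for s y
    using pmin[of "(s, y)"] that tx by auto
  have ge1: "\<delta> * exp (C * (s - t1)) * (1 + y) \<ge> \<delta> * (1 + y)" if "s \<ge> t1" "y \<ge> x1" for s y
    using that assms(2,4) C by (simp add: mult_right_mono)
  have ge2: "\<delta> * (1 + y) \<ge> \<delta>" if "y \<ge> x1" for y
    using that assms(2,4) by simp
  have "W t0 x0 \<ge> 0"
  proof (rule ccontr)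
    assume "\<not> W t0 x0 \<ge> 0"
    then have neg: "w t0 x0 + \<delta> * exp (C * (t0 - t1)) * (1 + x0) < 0" by (simp add: W_def)
    have "t0 \<noteq> t1" using neg bd0[of x0] ge1[of t0 x0] ge2[of x0] r by auto
    moreover have "x0 \<noteq> x1" using neg bd1[of t0] ge1[of t0 x0] ge2[of x0] r by auto
    moreover have "x0 \<noteq> X" using neg bd2[of t0] ge1[of t0 x0] r by auto
    ultimately have r': "t1 < t0" "t0 \<le> T" "x1 < x0" "x0 < X" using r by auto
    define e where "e = \<delta> * exp (C * (t0 - t1))"
    have e: "e > 0" using assms by (simp add: e_def)
    have Wx: "((\<lambda>x. W t0 x) has_real_derivative wx t0 x + e) (at x)" if "x1 < x" "x < X" for x
      unfolding W_def e_def by (auto intro!: derivative_eq_intros dx r' that)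
    have Wxx: "((\<lambda>x. wx t0 x + e) has_real_derivative wxx t0 x0) (at x0)"
      by (auto intro!: derivative_eq_intros dxx r')
    have Wx0: "wx t0 x0 + e = 0"
    proof (rule DERIV_local_min[OF Wx])
      show "0 < min (x0 - x1) (X - x0)" using r' by simp
      show "\<forall>y. \<bar>x0 - y\<bar> < min (x0 - x1) (X - x0) \<longrightarrow> W t0 x0 \<le> W t0 y"
        using r' by (auto intro!: min)
    qed (use r' in auto)
    \<comment> \<open>Otherwise the slope of \<open>W\<close>, zero at \<open>x0\<close>, would be
      negative just to the right, and \<open>W\<close> would fall below its minimum.\<close>
    have Wxx0: "wxx t0 x0 \<ge> 0"
    proof (rule ccontr)
      assume "\<not> wxx t0 x0 \<ge> 0"
      then obtain d where d: "d > 0" "\<And>h. h > 0 \<Longrightarrow> h < d \<Longrightarrow> wx t0 x0 + e > wx t0 (x0 + h) + e"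
        using DERIV_neg_dec_right[OF Wxx] by auto
      define y where "y = x0 + min (d / 2) ((X - x0) / 2)"
      have y: "x0 < y" "y < X" "y - x0 < d" using r' d(1) by (auto simp: y_def min_def field_simps)
      obtain \<xi> where \<xi>: "x0 < \<xi>" "\<xi> < y" "W t0 y - W t0 x0 = (y - x0) * (wx t0 \<xi> + e)"
        using MVT2[of x0 y "W t0" "\<lambda>x. wx t0 x + e"] y r' Wx by (metis less_trans order_less_le_trans order_le_less_trans)
      have "wx t0 \<xi> + e < 0" using d(2)[of "\<xi> - x0"] \<xi> y Wx0 by auto
      then have "W t0 y < W t0 x0" using \<xi> y by (smt (verit) mult_pos_neg)
      then show False using min[of t0 y] r' y by auto
    qed
    have Wt: "((\<lambda>t. W t x0) has_real_derivative
        ((2 * x0\<^sup>2 + x0) * wxx t0 x0 + 2 * (1 - \<mu>) * x0 * wx t0 x0 + C * e * (1 + x0))) (at_left t0)"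
      unfolding W_def e_def by (auto intro!: derivative_eq_intros dt r')
    have "((2 * x0\<^sup>2 + x0) * wxx t0 x0 + 2 * (1 - \<mu>) * x0 * wx t0 x0 + C * e * (1 + x0)) \<le> 0"
    proof (rule tendsto_upperbound[OF Wt[unfolded has_field_derivative_iff]])
      show "\<forall>\<^sub>F y in at_left t0. (W y x0 - W t0 x0) / (y - t0) \<le> 0"
        using eventually_at_left_real[OF r'(1)]
      proof eventually_elim
        case (elim s)
        then have "W t0 x0 \<le> W s x0" using min[of s x0] r' by auto
        then show ?case using elim by (simp add: divide_le_0_iff)
      qed
    qed simp
    \<comment> \<open>The vanishing slope of \<open>W\<close> turns the drift term of
      \<open>w\<close> into \<open>-2 (1 - \<mu>) x0 e\<close>. Together with
      \<open>w_xx \<ge> 0\<close> this makes the time derivative of \<open>W\<close> positive, by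
      the choice of \<open>C\<close>.\<close>
    moreover have "wx t0 x0 = - e" using Wx0 by simp
    moreover have "(2 * x0\<^sup>2 + x0) * wxx t0 x0 \<ge> 0"
      using Wxx0 r' assms(2) by simp
    moreover have "C * (1 + x0) - 2 * (1 - \<mu>) * x0 > 0"
    proof -
      have "2 * (1 - \<mu>) * x0 \<le> 2 * \<bar>1 - \<mu>\<bar> * x0"
        using r' assms(2) by (intro mult_right_mono mult_left_mono abs_ge_self) auto
      moreover have "C * (1 + x0) = 2 * \<bar>1 - \<mu>\<bar> * x0 + x0 + C"
        by (simp add: C_def algebra_simps)
      ultimately show ?thesis using C r' assms(2) by linarith
    qed
    then have "e * (C * (1 + x0) - 2 * (1 - \<mu>) * x0) > 0" using e by simp
    ultimately show False by (simp add: algebra_simps)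
  qed
  then have "W t x \<ge> 0" using min[of t x] assms by auto
  then show ?thesis by (simp add: W_def C_def)
qed

section \<open>Riemann sums and Brownian motion\<close>

lemma riemann_sums_tendsto_integral:
  fixes g :: "real \<Rightarrow> real"
  assumes g: "continuous_on {0..t} g" and t: "t > 0"
  shows "(\<lambda>N. t / real N * (\<Sum>i<N. g (real i * t / real N))) \<longlonglongrightarrow> integral {0..t} g"
proof (rule LIMSEQ_I)
  fix r :: real assume r: "r > 0"
  define e where "e = r / (2 * t)"
  have e: "e > 0" using r t by (simp add: e_def)
  have "uniformly_continuous_on {0..t} g"
    using g by (intro compact_uniformly_continuous) auto
  then obtain d where d: "d > 0" "\<And>u v. u \<in> {0..t} \<Longrightarrow> v \<in> {0..t} \<Longrightarrow> dist v u < d \<Longrightarrow> dist (g v) (g u) < e"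
    using e unfolding uniformly_continuous_on_def by blast
  obtain N0 where N0: "t / d < real N0" using reals_Archimedean2 by blast
  show "\<exists>no. \<forall>N\<ge>no. norm (t / real N * (\<Sum>i<N. g (real i * t / real N)) - integral {0..t} g) < r"
  proof (intro exI allI impI)
    fix N assume N: "N \<ge> Suc N0"
    define \<delta> where "\<delta> = t / real N"
    have N': "real N > 0" "t / d < real N" using N N0 by auto
    have \<delta>: "\<delta> > 0" "\<delta> < d" "real N * \<delta> = t"
      using N' t d(1) by (auto simp: \<delta>_def field_simps)
    have int: "g integrable_on {a..b}" if "0 \<le> a" "b \<le> t" for a b
      using that by (intro integrable_continuous_real continuous_on_subset[OF g]) auto
    \<comment> \<open>Induction over the cells: on each of them, of length \<open>\<delta>\<close>,
      the integrand varies by at most \<open>e\<close>, so the errors add up to at most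
      \<open>t * e = r / 2\<close>.\<close>
    have "k \<le> N \<Longrightarrow> \<bar>integral {0..real k * \<delta>} g - \<delta> * (\<Sum>i<k. g (real i * \<delta>))\<bar> \<le> real k * \<delta> * e" for k
    proof (induction k)
      case (Suc k)
      let ?a = "real k * \<delta>" and ?b = "real (Suc k) * \<delta>"
      have ab: "0 \<le> ?a" "?a \<le> ?b" "?b - ?a = \<delta>"
        using \<delta>(1) by (auto simp: algebra_simps)
      have "?b \<le> real N * \<delta>" using Suc.prems \<delta>(1) by (intro mult_right_mono) auto
      then have bt: "?b \<le> t" using \<delta>(3) by simp
      have split: "integral {0..?a} g + integral {?a..?b} g = integral {0..?b} g"
        using ab bt by (intro Henstock_Kurzweil_Integration.integral_combine int) auto
      have "(g has_integral integral {?a..?b} g) {?a..?b}"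
        using int[of ?a ?b] ab bt by (simp add: has_integral_integral)
      moreover have "((\<lambda>_. g ?a) has_integral \<delta> * g ?a) {?a..?b}"
        using has_integral_const_real[of "g ?a" ?a ?b] ab by simp
      ultimately have "((\<lambda>u. g u - g ?a) has_integral (integral {?a..?b} g - \<delta> * g ?a)) (cbox ?a ?b)"
        unfolding interval_cbox by (rule has_integral_diff)
      then have "norm (integral {?a..?b} g - \<delta> * g ?a) \<le> e * measure lborel (cbox ?a ?b)"
      proof (rule has_integral_bound[rotated])
        fix u assume u: "u \<in> cbox ?a ?b"
        then have u': "?a \<le> u" "u \<le> ?b" by auto
        have "0 \<le> u" "u \<le> t" "?a \<le> t" "u - ?a < d"
          using ab bt \<delta>(2) u' by linarith+
        then have "u \<in> {0..t}" "?a \<in> {0..t}" "dist u ?a < d"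
          using ab(1) u' by (simp_all add: dist_real_def)
        then show "norm (g u - g ?a) \<le> e"
          using d(2)[of ?a u] by (simp add: dist_real_def)
      qed (use e in simp)
      then have st: "\<bar>integral {?a..?b} g - \<delta> * g ?a\<bar> \<le> e * \<delta>"
        using ab by simp
      have IH: "\<bar>integral {0..?a} g - \<delta> * (\<Sum>i<k. g (real i * \<delta>))\<bar> \<le> real k * \<delta> * e"
        using Suc by simp
      have eq: "integral {0..?b} g - \<delta> * (\<Sum>i<Suc k. g (real i * \<delta>)) =
         (integral {0..?a} g - \<delta> * (\<Sum>i<k. g (real i * \<delta>))) + (integral {?a..?b} g - \<delta> * g ?a)"
        unfolding split[symmetric] by (simp add: distrib_left)
      have "\<bar>integral {0..?b} g - \<delta> * (\<Sum>i<Suc k. g (real i * \<delta>))\<bar> \<le> real k * \<delta> * e + e * \<delta>"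
        unfolding eq by (rule order_trans[OF abs_triangle_ineq add_mono[OF IH st]])
      then show ?case by (simp add: algebra_simps)
    qed simp
    from this[of N] have "\<bar>integral {0..t} g - \<delta> * (\<Sum>i<N. g (real i * \<delta>))\<bar> \<le> t * e"
      using \<delta>(3) by simp
    also have "t * e < r" using t r by (simp add: e_def)
    finally show "norm (t / real N * (\<Sum>i<N. g (real i * t / real N)) - integral {0..t} g) < r"
      by (simp add: \<delta>_def abs_minus_commute)
  qed
qed

section \<open>Gaussian integrals\<close>

lemma integrable_exp_abs_gaussian:
  fixes m s :: real
  assumes "s > 0"
  shows "integrable lborel (\<lambda>y. exp (m * \<bar>y\<bar>) * exp (- y\<^sup>2 / (2 * s)))"
proof -
  \<comment> \<open>Completing the square turns the exponential tilt into a shift of the mean by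
    \<open>c * s\<close>.\<close>
  have eq: "exp (c * y) * exp (- y\<^sup>2 / (2 * s)) =
      normal_density (c * s) (sqrt s) y * (sqrt (2 * pi * s) * exp (c\<^sup>2 * s / 2))" for c y
  proof -
    have "c * y + - y\<^sup>2 / (2 * s) = - (y - c * s)\<^sup>2 / (2 * s) + c\<^sup>2 * s / 2"
      using assms by (simp add: field_simps power2_eq_square)
    then show ?thesis
      using assms by (simp add: normal_density_def exp_add[symmetric] field_simps)
  qed
  have "integrable lborel (\<lambda>y. exp (c * y) * exp (- y\<^sup>2 / (2 * s)))" for c
    unfolding eq using assms by (intro integrable_mult_left integrable_normal_density) auto
  then have "integrable lborel (\<lambda>y. exp (m * y) * exp (- y\<^sup>2 / (2 * s)) + exp (- m * y) * exp (- y\<^sup>2 / (2 * s)))"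
    by (intro Bochner_Integration.integrable_add)
  then show ?thesis
  proof (rule Bochner_Integration.integrable_bound)
    show "AE y in lborel. norm (exp (m * \<bar>y\<bar>) * exp (- y\<^sup>2 / (2 * s)))
        \<le> norm (exp (m * y) * exp (- y\<^sup>2 / (2 * s)) + exp (- m * y) * exp (- y\<^sup>2 / (2 * s)))"
    proof (rule AE_I2)
      fix y :: real
      have "exp (m * \<bar>y\<bar>) \<le> exp (m * y) + exp (- m * y)"
        by (cases "y \<ge> 0") auto
      then have "exp (m * \<bar>y\<bar>) * exp (- y\<^sup>2 / (2 * s)) \<le> (exp (m * y) + exp (- m * y)) * exp (- y\<^sup>2 / (2 * s))"
        by (rule mult_right_mono) simp
      then show "norm (exp (m * \<bar>y\<bar>) * exp (- y\<^sup>2 / (2 * s)))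
        \<le> norm (exp (m * y) * exp (- y\<^sup>2 / (2 * s)) + exp (- m * y) * exp (- y\<^sup>2 / (2 * s)))"
        unfolding distrib_right real_norm_def by (subst (1 2) abs_of_nonneg) auto
    qed
  qed simp
qed

lemma integral_normal_density_affine:
  fixes g :: "real \<Rightarrow> real"
  assumes "\<sigma> > 0"
  shows "(\<integral>y. normal_density m \<sigma> y * g y \<partial>lborel) = (\<integral>z. std_normal_density z * g (m + \<sigma> * z) \<partial>lborel)"
    and "integrable lborel (\<lambda>y. normal_density m \<sigma> y * g y) \<longleftrightarrow>
         integrable lborel (\<lambda>z. std_normal_density z * g (m + \<sigma> * z))"
proof -
  have eq: "normal_density m \<sigma> (m + \<sigma> * z) = std_normal_density z / \<sigma>" for z
    using assms by (simp add: normal_density_def power_mult_distrib real_sqrt_mult)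
  show "(\<integral>y. normal_density m \<sigma> y * g y \<partial>lborel) = (\<integral>z. std_normal_density z * g (m + \<sigma> * z) \<partial>lborel)"
    using assms by (subst lborel_integral_real_affine[of \<sigma> _ m]) (simp_all add: eq)
  show "integrable lborel (\<lambda>y. normal_density m \<sigma> y * g y) \<longleftrightarrow>
         integrable lborel (\<lambda>z. std_normal_density z * g (m + \<sigma> * z))"
  proof -
    have "integrable lborel (\<lambda>z. std_normal_density z / \<sigma> * g (m + \<sigma> * z)) \<longleftrightarrow>
        integrable lborel (\<lambda>z. std_normal_density z * g (m + \<sigma> * z))"
    proof
      assume "integrable lborel (\<lambda>z. std_normal_density z / \<sigma> * g (m + \<sigma> * z))"
      then have "integrable lborel (\<lambda>z. \<sigma> * (std_normal_density z / \<sigma> * g (m + \<sigma> * z)))"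
        by (rule integrable_mult_right)
      then show "integrable lborel (\<lambda>z. std_normal_density z * g (m + \<sigma> * z))"
        using assms by simp
    next
      assume "integrable lborel (\<lambda>z. std_normal_density z * g (m + \<sigma> * z))"
      then have "integrable lborel (\<lambda>z. (std_normal_density z * g (m + \<sigma> * z)) / \<sigma>)"
        by (rule integrable_divide)
      then show "integrable lborel (\<lambda>z. std_normal_density z / \<sigma> * g (m + \<sigma> * z))"
        by simp
    qed
    then show ?thesis
      using assms by (subst lborel_integrable_real_affine_iff[of \<sigma> _ m, symmetric]) (simp_all only: eq)
  qed
qed

text \<open>The left-endpoint sum as a function of the increments, with \<open>B\<close> at node
  \<open>i\<close> rebuilt as the sum of the first \<open>i\<close> of them. Left endpoints stop at
  node \<open>N - 1\<close>, so only increments with index below \<open>N - 1\<close> enter; hence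
  the index sets \<open>{..<N - 1}\<close> below.\<close>

definition riemann_of_increments :: "real \<Rightarrow> real \<Rightarrow> nat \<Rightarrow> (nat \<Rightarrow> real) \<Rightarrow> real" where
  "riemann_of_increments \<mu> t N D =
     t / real N * (\<Sum>i<N. exp (2 * ((\<Sum>j<i. D j) + \<mu> * (real i * t / real N))))"

lemma riemann_of_increments_cong:
  assumes "\<And>j. j < N - 1 \<Longrightarrow> D j = D' j"
  shows "riemann_of_increments \<mu> t N D = riemann_of_increments \<mu> t N D'"
proof -
  have "(\<Sum>j<i. D j) = (\<Sum>j<i. D' j)" if "i < N" for i
    using that by (intro sum.cong refl assms) auto
  then show ?thesis
    by (simp add: riemann_of_increments_def)
qed

lemma riemann_of_increments_pos:
  "t > 0 \<Longrightarrow> N > 0 \<Longrightarrow> riemann_of_increments \<mu> t N D > 0"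
  unfolding riemann_of_increments_def by (intro mult_pos_pos divide_pos_pos sum_pos) auto

lemma measurable_riemann_of_increments:
  assumes "{..<N - 1} \<subseteq> I"
  shows "riemann_of_increments \<mu> t N \<in> borel_measurable (PiM I (\<lambda>_. borel))"
  unfolding riemann_of_increments_def
proof (intro borel_measurable_times borel_measurable_sum borel_measurable_const
    measurable_compose[OF _ borel_measurable_exp] borel_measurable_add)
  fix i j assume "i \<in> {..<N}" "j \<in> {..<i}"
  then show "(\<lambda>D. D j) \<in> borel_measurable (PiM I (\<lambda>_. borel))"
    using assms by (intro measurable_component_singleton) auto
qed

locale brownian =
  fixes M :: "'a measure" and B :: "real \<Rightarrow> 'a \<Rightarrow> real"
  assumes BM: "std_brownian_motion M B"
begin

abbreviation A :: "real \<Rightarrow> real \<Rightarrow> 'a \<Rightarrow> real" where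
  "A \<equiv> exp_functional B"

sublocale prob_space M
  using BM by (simp add: std_brownian_motion_def)

lemma measurable_B: "u \<ge> 0 \<Longrightarrow> B u \<in> borel_measurable M"
  using BM by (simp add: std_brownian_motion_def)

lemma B_0: "\<omega> \<in> space M \<Longrightarrow> B 0 \<omega> = 0"
  using BM by (simp add: std_brownian_motion_def)

lemma continuous_B: "\<omega> \<in> space M \<Longrightarrow> continuous_on {0..} (\<lambda>u. B u \<omega>)"
  using BM by (simp add: std_brownian_motion_def)

lemma increment_distributed:
  "0 \<le> s \<Longrightarrow> s < u \<Longrightarrow>
   distributed M lborel (\<lambda>\<omega>. B u \<omega> - B s \<omega>) (\<lambda>x. ennreal (normal_density 0 (sqrt (u - s)) x))"
  using BM by (simp add: std_brownian_motion_def)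

lemma increments_indep:
  "sorted_wrt (<) ts \<Longrightarrow> ts \<noteq> [] \<Longrightarrow> 0 \<le> hd ts \<Longrightarrow>
   indep_vars (\<lambda>_. borel) (\<lambda>i \<omega>. B (ts ! Suc i) \<omega> - B (ts ! i) \<omega>) {..<length ts - 1}"
  using BM unfolding std_brownian_motion_def by blast

lemma
  fixes g :: "real \<Rightarrow> real"
  assumes u: "u > 0" and g: "g \<in> borel_measurable borel"
  shows expectation_B: "(\<integral>\<omega>. g (B u \<omega>) \<partial>M) = (\<integral>z. std_normal_density z * g (sqrt u * z) \<partial>lborel)"
    and integrable_B: "integrable M (\<lambda>\<omega>. g (B u \<omega>)) \<longleftrightarrow>
      integrable lborel (\<lambda>z. std_normal_density z * g (sqrt u * z))"
    and expectation_B_density: "(\<integral>\<omega>. g (B u \<omega>) \<partial>M) = (\<integral>y. normal_density 0 (sqrt u) y * g y \<partial>lborel)"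
proof -
  have d: "distributed M lborel (\<lambda>\<omega>. B u \<omega> - B 0 \<omega>) (\<lambda>x. ennreal (normal_density 0 (sqrt u) x))"
    using increment_distributed[of 0 u] u by simp
  have "(\<integral>\<omega>. g (B u \<omega>) \<partial>M) = (\<integral>\<omega>. g (B u \<omega> - B 0 \<omega>) \<partial>M)"
    by (intro Bochner_Integration.integral_cong) (auto simp: B_0)
  also have "\<dots> = (\<integral>y. normal_density 0 (sqrt u) y * g y \<partial>lborel)"
    using g by (intro distributed_integral[OF d, symmetric]) auto
  finally show 1: "(\<integral>\<omega>. g (B u \<omega>) \<partial>M) = (\<integral>y. normal_density 0 (sqrt u) y * g y \<partial>lborel)" .
  then show "(\<integral>\<omega>. g (B u \<omega>) \<partial>M) = (\<integral>z. std_normal_density z * g (sqrt u * z) \<partial>lborel)"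
    using u integral_normal_density_affine(1)[of "sqrt u" 0 g] by simp
  have "integrable M (\<lambda>\<omega>. g (B u \<omega>)) \<longleftrightarrow> integrable M (\<lambda>\<omega>. g (B u \<omega> - B 0 \<omega>))"
    by (intro Bochner_Integration.integrable_cong) (auto simp: B_0)
  also have "\<dots> \<longleftrightarrow> integrable lborel (\<lambda>y. normal_density 0 (sqrt u) y * g y)"
    using g by (intro distributed_integrable[OF d, symmetric]) auto
  finally show "integrable M (\<lambda>\<omega>. g (B u \<omega>)) \<longleftrightarrow>
      integrable lborel (\<lambda>z. std_normal_density z * g (sqrt u * z))"
    using u integral_normal_density_affine(2)[of "sqrt u" 0 g] by simp
qed

text \<open>With this the locale can be interpreted a second time, and every fact about
  \<open>A\<close> transfers to the functional of the path after time \<open>h\<close>.\<close>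

lemma shift_brownian:
  assumes h: "h \<ge> 0"
  shows "brownian M (\<lambda>u \<omega>. B (h + u) \<omega> - B h \<omega>)"
  unfolding brownian_def std_brownian_motion_def
proof (intro conjI allI impI ballI)
  show "prob_space M" by unfold_locales
  show "(\<lambda>\<omega>. B (h + u) \<omega> - B h \<omega>) \<in> borel_measurable M" if "0 \<le> u" for u
    using that h by (intro borel_measurable_diff measurable_B) auto
  show "B (h + 0) \<omega> - B h \<omega> = 0" for \<omega> by simp
  show "continuous_on {0..} (\<lambda>t. B (h + t) \<omega> - B h \<omega>)" if "\<omega> \<in> space M" for \<omega>
    by (intro continuous_intros continuous_on_compose2[OF continuous_B[OF that]]) (use h in auto)
  fix s t :: real assume "0 \<le> s \<and> s < t"
  then show "distributed M lborel (\<lambda>\<omega>. B (h + t) \<omega> - B h \<omega> - (B (h + s) \<omega> - B h \<omega>))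
      (\<lambda>x. ennreal (normal_density 0 (sqrt (t - s)) x))"
    using increment_distributed[of "h + s" "h + t"] h by simp
next
  fix ts :: "real list" assume ts: "sorted_wrt (<) ts \<and> ts \<noteq> [] \<and> 0 \<le> hd ts"
  have "indep_vars (\<lambda>_. borel)
      (\<lambda>i \<omega>. B (map ((+) h) ts ! Suc i) \<omega> - B (map ((+) h) ts ! i) \<omega>) {..<length (map ((+) h) ts) - 1}"
    by (rule increments_indep) (use ts h in \<open>auto simp: sorted_wrt_map hd_map\<close>)
  then show "indep_vars (\<lambda>_. borel)
      (\<lambda>i \<omega>. B (h + ts ! Suc i) \<omega> - B h \<omega> - (B (h + ts ! i) \<omega> - B h \<omega>)) {..<length ts - 1}"
    by (rule indep_vars_cong[THEN iffD1, rotated 3]) auto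
qed

definition grid_increment :: "real \<Rightarrow> nat \<Rightarrow> nat \<Rightarrow> 'a \<Rightarrow> real" where
  "grid_increment t N j \<omega> = B (real (Suc j) * t / real N) \<omega> - B (real j * t / real N) \<omega>"

abbreviation riemann_grid :: "real \<Rightarrow> real \<Rightarrow> nat \<Rightarrow> 'a \<Rightarrow> real" where
  "riemann_grid \<mu> t N \<omega> \<equiv> riemann_of_increments \<mu> t N (\<lambda>j. grid_increment t N j \<omega>)"

lemma riemann_of_grid_increments:
  assumes "\<omega> \<in> space M"
  shows "riemann_grid \<mu> t N \<omega> =
     t / real N * (\<Sum>i<N. exp (2 * (B (real i * t / real N) \<omega> + \<mu> * (real i * t / real N))))"
proof -
  have "(\<Sum>j<i. grid_increment t N j \<omega>) = B (real i * t / real N) \<omega>" for i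
    using sum_lessThan_telescope[of "\<lambda>j. B (real j * t / real N) \<omega>" i] B_0[OF assms]
    by (simp add: grid_increment_def)
  then show ?thesis by (simp add: riemann_of_increments_def)
qed

lemma continuous_integrand:
  assumes "\<omega> \<in> space M" "S \<subseteq> {0..}"
  shows "continuous_on S (\<lambda>u. exp (2 * (B u \<omega> + \<mu> * u)))"
  by (intro continuous_intros continuous_on_subset[OF continuous_B[OF assms(1)] assms(2)])

lemma riemann_tendsto_exp_functional:
  assumes "\<omega> \<in> space M" "t > 0"
  shows "(\<lambda>N. riemann_grid \<mu> t N \<omega>) \<longlonglongrightarrow> A \<mu> t \<omega>"
  unfolding riemann_of_grid_increments[OF assms(1)] exp_functional_def
  using assms by (intro riemann_sums_tendsto_integral continuous_integrand) auto

lemma measurable_grid_increment: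
  "t \<ge> 0 \<Longrightarrow> grid_increment t N j \<in> borel_measurable M"
  unfolding grid_increment_def by (intro borel_measurable_diff measurable_B) auto

lemma measurable_riemann_grid:
  assumes "t \<ge> 0"
  shows "(\<lambda>\<omega>. riemann_grid \<mu> t N \<omega>) \<in> borel_measurable M"
  unfolding riemann_of_increments_def using measurable_grid_increment[OF assms]
  by measurable

lemma measurable_exp_functional:
  assumes "t > 0"
  shows "A \<mu> t \<in> borel_measurable M"
  by (rule borel_measurable_LIMSEQ_real[OF riemann_tendsto_exp_functional measurable_riemann_grid])
     (use assms in auto)

text \<open>Independence and the prescribed Gaussian laws leave no freedom in the joint law: the
  right-hand side does not mention \<open>B\<close>. The bound \<open>N \<ge> 2\<close> keeps the
  index set non-empty.\<close>

lemma distr_grid_increments: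
  assumes t: "t > 0" and N: "N \<ge> 2"
  shows "distr M (PiM {..<N - 1} (\<lambda>_. borel)) (\<lambda>\<omega>. \<lambda>j\<in>{..<N - 1}. grid_increment t N j \<omega>) =
    PiM {..<N - 1} (\<lambda>_. density lborel (\<lambda>x. ennreal (normal_density 0 (sqrt (t / real N)) x)))"
proof -
  define ts where "ts = map (\<lambda>i. real i * t / real N) [0..<N]"
  have "indep_vars (\<lambda>_. borel) (\<lambda>i \<omega>. B (ts ! Suc i) \<omega> - B (ts ! i) \<omega>) {..<length ts - 1}"
    by (rule increments_indep)
       (use t N in \<open>auto simp: ts_def sorted_wrt_iff_nth_less divide_strict_right_mono hd_map hd_upt\<close>)
  then have ind: "indep_vars (\<lambda>_. borel) (grid_increment t N) {..<N - 1}"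
    by (rule indep_vars_cong[THEN iffD1, rotated 3])
       (auto simp: ts_def grid_increment_def fun_eq_iff)
  have "distr M (PiM {..<N - 1} (\<lambda>_. borel)) (\<lambda>\<omega>. \<lambda>j\<in>{..<N - 1}. grid_increment t N j \<omega>) =
      PiM {..<N - 1} (\<lambda>j. distr M borel (grid_increment t N j))"
    by (rule indep_vars_iff_distr_eq_PiM'[THEN iffD1, OF _ _ ind])
       (use N t measurable_grid_increment in \<open>auto simp: lessThan_empty_iff\<close>)
  moreover have "distr M borel (grid_increment t N j) =
      density lborel (\<lambda>x. ennreal (normal_density 0 (sqrt (t / real N)) x))" for j
  proof -
    have "real (Suc j) * t / real N - real j * t / real N = t / real N"
      by (simp add: diff_divide_distrib[symmetric] left_diff_distrib[symmetric])
    then have "distributed M lborel (grid_increment t N j)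
        (\<lambda>x. ennreal (normal_density 0 (sqrt (t / real N)) x))"
      using increment_distributed[of "real j * t / real N" "real (Suc j) * t / real N"] t N
      by (simp add: grid_increment_def[abs_def] divide_strict_right_mono)
    moreover have "distr M borel (grid_increment t N j) = distr M lborel (grid_increment t N j)"
      by (intro distr_cong) auto
    ultimately show ?thesis
      by (simp add: distributed_distr_eq_density)
  qed
  ultimately show ?thesis by simp
qed

lemma expectation_riemann_grid:
  fixes f :: "real \<Rightarrow> real"
  assumes t: "t > 0" and N: "N \<ge> 2" and f: "f \<in> borel_measurable borel"
  shows "(\<integral>\<omega>. f (riemann_grid \<mu> t N \<omega>) \<partial>M) =
    (\<integral>D. f (riemann_of_increments \<mu> t N D)
       \<partial>PiM {..<N - 1} (\<lambda>_. density lborel (\<lambda>x. ennreal (normal_density 0 (sqrt (t / real N)) x))))"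
proof -
  let ?P = "PiM {..<N - 1} (\<lambda>_. borel :: real measure)"
  let ?X = "\<lambda>\<omega>. \<lambda>j\<in>{..<N - 1}. grid_increment t N j \<omega>"
  have "(\<integral>\<omega>. f (riemann_grid \<mu> t N \<omega>) \<partial>M) =
      (\<integral>\<omega>. f (riemann_of_increments \<mu> t N (?X \<omega>)) \<partial>M)"
    by (intro Bochner_Integration.integral_cong refl arg_cong[where f = f] riemann_of_increments_cong) auto
  also have "\<dots> = (\<integral>D. f (riemann_of_increments \<mu> t N D) \<partial>distr M ?P ?X)"
    by (rule integral_distr[symmetric])
       (use t f measurable_grid_increment in
        \<open>auto simp del: restrict_apply intro!: measurable_restrict measurable_compose[OF measurable_riemann_of_increments]\<close>)
  finally show ?thesis
    unfolding distr_grid_increments[OF t N] .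
qed

lemma exp_functional_pos:
  assumes "\<omega> \<in> space M" "t > 0"
  shows "A \<mu> t \<omega> > 0"
proof -
  have "A \<mu> t \<omega> \<ge> 0"
    unfolding exp_functional_def by (intro integral_nonneg integrable_continuous_real continuous_integrand) (use assms in auto)
  moreover have "A \<mu> t \<omega> \<noteq> 0"
    unfolding exp_functional_def
    using integral_eq_0_iff[of 0 t "\<lambda>u. exp (2 * (B u \<omega> + \<mu> * u))"] continuous_integrand[of \<omega> "{0..t}" \<mu>] assms by force
  ultimately show ?thesis by simp
qed

text \<open>Dominated convergence along Riemann sums. Continuity and bounds are asked on positive
  arguments only, since functions such as \<open>exp(-x/a)\<close> misbehave at 0 while the sums and
  \<open>A\<close> are positive. The weight \<open>g\<close> is there for factors depending on
  \<open>B_h\<close>; the offset 2 matches \<open>expectation_riemann_grid\<close>.\<close>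

lemma tendsto_expectation_riemann:
  fixes f :: "real \<Rightarrow> real"
  assumes t: "t > 0" and f: "f \<in> borel_measurable borel" and cont: "\<And>a. a > 0 \<Longrightarrow> isCont f a"
    and bound: "\<And>a. a > 0 \<Longrightarrow> \<bar>f a\<bar> \<le> K"
    and g: "integrable M g"
  shows "(\<lambda>N. \<integral>\<omega>. g \<omega> * f (riemann_grid \<mu> t (N + 2) \<omega>) \<partial>M)
     \<longlonglongrightarrow> (\<integral>\<omega>. g \<omega> * f (A \<mu> t \<omega>) \<partial>M)"
proof (rule integral_dominated_convergence[where w = "\<lambda>\<omega>. \<bar>g \<omega>\<bar> * K"])
  show "integrable M (\<lambda>\<omega>. \<bar>g \<omega>\<bar> * K)" using g by auto
  show "(\<lambda>\<omega>. g \<omega> * f (A \<mu> t \<omega>)) \<in> borel_measurable M"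
    using measurable_compose[OF measurable_exp_functional[OF t] f] g by auto
  show "(\<lambda>\<omega>. g \<omega> * f (riemann_grid \<mu> t (N + 2) \<omega>)) \<in> borel_measurable M" for N
    using measurable_compose[OF measurable_riemann_grid f] g t by auto
  show "AE \<omega> in M. (\<lambda>N. g \<omega> * f (riemann_grid \<mu> t (N + 2) \<omega>))
      \<longlonglongrightarrow> g \<omega> * f (A \<mu> t \<omega>)"
    by (intro AE_I2 tendsto_intros isCont_tendsto_compose[OF cont[OF exp_functional_pos]]
        LIMSEQ_ignore_initial_segment riemann_tendsto_exp_functional t)
  show "AE \<omega> in M. norm (g \<omega> * f (riemann_grid \<mu> t (N + 2) \<omega>)) \<le> \<bar>g \<omega>\<bar> * K" for N
    using bound[OF riemann_of_increments_pos[OF t]] by (auto simp: abs_mult intro!: mult_left_mono)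
qed

end

text \<open>Both expectations are limits of the same integrals against a product of Gaussian laws.
  This is applied to the original and the shifted path.\<close>

lemma expectation_exp_functional_unique:
  fixes f :: "real \<Rightarrow> real"
  assumes "brownian M B" "brownian M' B'"
    and "t > 0" "f \<in> borel_measurable borel" "\<And>a. a > 0 \<Longrightarrow> isCont f a" "\<And>a. a > 0 \<Longrightarrow> \<bar>f a\<bar> \<le> K"
  shows "(\<integral>\<omega>. f (exp_functional B \<mu> t \<omega>) \<partial>M) = (\<integral>\<omega>. f (exp_functional B' \<mu> t \<omega>) \<partial>M')"
proof -
  interpret X: brownian M B by fact
  interpret Y: brownian M' B' by fact
  show ?thesis
    using LIMSEQ_unique[OF X.tendsto_expectation_riemann[OF assms(3-6), of "\<lambda>_. 1"]]
      Y.tendsto_expectation_riemann[OF assms(3-6), of "\<lambda>_. 1" \<mu>] assms(3,4)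
    by (simp add: X.expectation_riemann_grid Y.expectation_riemann_grid)
qed

section \<open>Independence of the first increment from the later functional\<close>

context brownian
begin

text \<open>For Riemann sums this is independence of one increment from those that follow. The
  factorisation survives the limit, and the functional of the shifted path is then replaced by
  \<open>A\<close>, which has the same law.\<close>

lemma expectation_B_mult_shift:
  fixes f g :: "real \<Rightarrow> real"
  assumes h: "h > 0" and t: "t > 0"
    and f: "f \<in> borel_measurable borel" "\<And>a. a > 0 \<Longrightarrow> isCont f a" "\<And>a. a > 0 \<Longrightarrow> \<bar>f a\<bar> \<le> K"
    and g: "g \<in> borel_measurable borel" "integrable M (\<lambda>\<omega>. g (B h \<omega>))"
  shows "(\<integral>\<omega>. g (B h \<omega>) * f (exp_functional (\<lambda>u \<omega>. B (h + u) \<omega> - B h \<omega>) \<mu> t \<omega>) \<partial>M) =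
     (\<integral>\<omega>. g (B h \<omega>) \<partial>M) * (\<integral>\<omega>. f (A \<mu> t \<omega>) \<partial>M)"
proof -
  define B' where "B' = (\<lambda>u \<omega>. B (h + u) \<omega> - B h \<omega>)"
  interpret S: brownian M B'
    unfolding B'_def using shift_brownian h by simp
  let ?R = "\<lambda>N \<omega>. S.riemann_grid \<mu> t N \<omega>"
  have fac: "(\<integral>\<omega>. g (B h \<omega>) * f (?R N \<omega>) \<partial>M) = (\<integral>\<omega>. g (B h \<omega>) \<partial>M) * (\<integral>\<omega>. f (?R N \<omega>) \<partial>M)"
    if N: "N \<ge> 2" for N
  proof -
    \<comment> \<open>Node 0 is put in front of the grid of \<open>[h, h + t]\<close> without its
      right end. So there are \<open>N + 1\<close> nodes, increment 0 is \<open>B_h\<close>, and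
      increment \<open>j + 1\<close> is the \<open>j\<close>-th grid increment of the shifted
      path.\<close>
    define ts where "ts = 0 # map (\<lambda>i. h + real i * t / real N) [0..<N]"
    define X where "X = (\<lambda>i \<omega>. B (ts ! Suc i) \<omega> - B (ts ! i) \<omega>)"
    have srt: "sorted_wrt (<) (map (\<lambda>i. h + real i * t / real N) [0..<N])"
      using t N by (auto simp: sorted_wrt_iff_nth_less divide_strict_right_mono)
    have "indep_vars (\<lambda>_. borel) X {..<length ts - 1}"
      unfolding X_def
      by (rule increments_indep)
         (use t N h srt in \<open>auto simp: ts_def add_pos_nonneg\<close>)
    then have ind: "indep_vars (\<lambda>_. borel) X {..<N}" by (simp add: ts_def)
    have iv: "indep_var (PiM {0} (\<lambda>_. borel)) (\<lambda>\<omega>. restrict (\<lambda>i. X i \<omega>) {0})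
         (PiM {1..<N} (\<lambda>_. borel)) (\<lambda>\<omega>. restrict (\<lambda>i. X i \<omega>) {1..<N})"
      by (rule indep_var_restrict[OF ind]) (use N in auto)
    define F where "F D = f (riemann_of_increments \<mu> t N (\<lambda>j. D (Suc j)))" for D :: "nat \<Rightarrow> real"
    have rm: "(\<lambda>D. riemann_of_increments \<mu> t N (\<lambda>j. D (Suc j))) \<in> borel_measurable (PiM {1..<N} (\<lambda>_. borel))"
      unfolding riemann_of_increments_def
    proof (intro borel_measurable_times borel_measurable_sum borel_measurable_const
        measurable_compose[OF _ borel_measurable_exp] borel_measurable_add)
      fix i j assume "i \<in> {..<N}" "j \<in> {..<i}"
      then show "(\<lambda>D. D (Suc j)) \<in> borel_measurable (PiM {1..<N} (\<lambda>_. borel))"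
        by (intro measurable_component_singleton) auto
    qed
    have Fm: "F \<in> borel_measurable (PiM {1..<N} (\<lambda>_. borel))"
      unfolding F_def by (rule measurable_compose[OF rm f(1)])
    have gm: "(\<lambda>D. g (D 0)) \<in> borel_measurable (PiM {0::nat} (\<lambda>_. borel))"
      by (rule measurable_compose[OF _ g(1)]) (rule measurable_component_singleton, simp)
    have iv2: "indep_var borel ((\<lambda>D. g (D 0)) \<circ> (\<lambda>\<omega>. restrict (\<lambda>i. X i \<omega>) {0}))
         borel (F \<circ> (\<lambda>\<omega>. restrict (\<lambda>i. X i \<omega>) {1..<N}))"
      by (rule indep_var_compose[OF iv gm Fm])
    have e1: "((\<lambda>D. g (D 0)) \<circ> (\<lambda>\<omega>. restrict (\<lambda>i. X i \<omega>) {0})) \<omega> = g (B h \<omega>)" if "\<omega> \<in> space M" for \<omega>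
      using B_0[OF that] N by (simp add: X_def ts_def)
    have e2: "(F \<circ> (\<lambda>\<omega>. restrict (\<lambda>i. X i \<omega>) {1..<N})) \<omega> = f (?R N \<omega>)" for \<omega>
    proof -
      have "S.grid_increment t N j \<omega> = X (Suc j) \<omega>" if "j < N - 1" for j
        using that unfolding S.grid_increment_def by (simp add: X_def ts_def B'_def)
      then show ?thesis
        by (auto simp: F_def intro!: arg_cong[where f = f] riemann_of_increments_cong)
    qed
    have b: "\<bar>f (?R N \<omega>)\<bar> \<le> K" for \<omega>
      using f(3)[OF riemann_of_increments_pos[OF t]] N by simp
    have i1: "integrable M ((\<lambda>D. g (D 0)) \<circ> (\<lambda>\<omega>. restrict (\<lambda>i. X i \<omega>) {0}))"
      using g(2) by (rule Bochner_Integration.integrable_cong[THEN iffD1, rotated 2]) (simp_all add: e1[symmetric])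
    have i2: "integrable M (\<lambda>\<omega>. f (?R N \<omega>))"
      by (rule integrable_const_bound[of _ K])
         (use b measurable_compose[OF S.measurable_riemann_grid f(1)] t in auto)
    have i2': "integrable M (F \<circ> (\<lambda>\<omega>. restrict (\<lambda>i. X i \<omega>) {1..<N}))"
      using i2 unfolding e2[symmetric] comp_def .
    from indep_var_lebesgue_integral[OF iv2 i1 i2']
    have "(\<integral>\<omega>. ((\<lambda>D. g (D 0)) \<circ> (\<lambda>\<omega>. restrict (\<lambda>i. X i \<omega>) {0})) \<omega> * f (?R N \<omega>) \<partial>M) =
        (\<integral>\<omega>. ((\<lambda>D. g (D 0)) \<circ> (\<lambda>\<omega>. restrict (\<lambda>i. X i \<omega>) {0})) \<omega> \<partial>M) * (\<integral>\<omega>. f (?R N \<omega>) \<partial>M)"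
      unfolding e2 .
    moreover have "(\<integral>\<omega>. ((\<lambda>D. g (D 0)) \<circ> (\<lambda>\<omega>. restrict (\<lambda>i. X i \<omega>) {0})) \<omega> * f (?R N \<omega>) \<partial>M) =
        (\<integral>\<omega>. g (B h \<omega>) * f (?R N \<omega>) \<partial>M)"
      by (intro Bochner_Integration.integral_cong refl) (simp only: e1)
    moreover have "(\<integral>\<omega>. ((\<lambda>D. g (D 0)) \<circ> (\<lambda>\<omega>. restrict (\<lambda>i. X i \<omega>) {0})) \<omega> \<partial>M) = (\<integral>\<omega>. g (B h \<omega>) \<partial>M)"
      by (intro Bochner_Integration.integral_cong refl) (simp only: e1)
    ultimately show ?thesis by (simp only:)
  qed
  have "(\<lambda>N. \<integral>\<omega>. g (B h \<omega>) * f (?R (N + 2) \<omega>) \<partial>M)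
     \<longlonglongrightarrow> (\<integral>\<omega>. g (B h \<omega>) * f (exp_functional B' \<mu> t \<omega>) \<partial>M)"
    by (rule S.tendsto_expectation_riemann[OF t f g(2)])
  moreover have "(\<lambda>N. \<integral>\<omega>. 1 * f (?R (N + 2) \<omega>) \<partial>M)
     \<longlonglongrightarrow> (\<integral>\<omega>. 1 * f (exp_functional B' \<mu> t \<omega>) \<partial>M)"
    by (rule S.tendsto_expectation_riemann[OF t f integrable_const])
  then have "(\<lambda>N. (\<integral>\<omega>. g (B h \<omega>) \<partial>M) * (\<integral>\<omega>. f (?R (N + 2) \<omega>) \<partial>M))
     \<longlonglongrightarrow> (\<integral>\<omega>. g (B h \<omega>) \<partial>M) * (\<integral>\<omega>. f (exp_functional B' \<mu> t \<omega>) \<partial>M)"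
    by (intro tendsto_intros) simp
  ultimately have "(\<integral>\<omega>. g (B h \<omega>) * f (exp_functional B' \<mu> t \<omega>) \<partial>M) =
      (\<integral>\<omega>. g (B h \<omega>) \<partial>M) * (\<integral>\<omega>. f (exp_functional B' \<mu> t \<omega>) \<partial>M)"
    using LIMSEQ_unique by (simp add: fac)
  also have "(\<integral>\<omega>. f (exp_functional B' \<mu> t \<omega>) \<partial>M) = (\<integral>\<omega>. f (A \<mu> t \<omega>) \<partial>M)"
    by (rule expectation_exp_functional_unique[OF S.brownian_axioms brownian_axioms t f])
  finally show ?thesis
    unfolding B'_def .
qed

section \<open>Path properties of the functional and its mean deviation\<close>

lemma exp_functional_0: "A \<mu> 0 \<omega> = 0"
  by (simp add: exp_functional_def)

lemma exp_functional_split: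
  assumes "\<omega> \<in> space M" "0 \<le> h" "h \<le> t"
  shows "A \<mu> t \<omega> = A \<mu> h \<omega> +
    exp (2 * (B h \<omega> + \<mu> * h)) * exp_functional (\<lambda>u \<omega>. B (h + u) \<omega> - B h \<omega>) \<mu> (t - h) \<omega>"
proof -
  let ?f = "\<lambda>u. exp (2 * (B u \<omega> + \<mu> * u))"
  have "integral {0..h} ?f + integral {h..t} ?f = integral {0..t} ?f"
    using assms by (intro Henstock_Kurzweil_Integration.integral_combine integrable_continuous_real continuous_integrand) auto
  moreover have "integral {h..t} ?f = integral {0..t - h} (?f \<circ> (+) h)"
    using integral_shift_Icc_real[of 0 "t - h" ?f h] by simp
  moreover have "?f \<circ> (+) h = (\<lambda>u. exp (2 * (B h \<omega> + \<mu> * h)) * exp (2 * (B (h + u) \<omega> - B h \<omega> + \<mu> * u)))"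
    by (simp add: fun_eq_iff exp_add[symmetric] algebra_simps)
  ultimately show ?thesis
    by (simp add: exp_functional_def)
qed

lemma exp_functional_nonneg: "\<omega> \<in> space M \<Longrightarrow> t \<ge> 0 \<Longrightarrow> A \<mu> t \<omega> \<ge> 0"
  using exp_functional_pos[of \<omega> t \<mu>] exp_functional_0[of \<mu> \<omega>] by (cases "t = 0") (auto simp: less_imp_le)

lemma exp_functional_mono:
  assumes "\<omega> \<in> space M" "0 \<le> s" "s \<le> t"
  shows "A \<mu> s \<omega> \<le> A \<mu> t \<omega>"
  using exp_functional_split[OF assms, of \<mu>] brownian.exp_functional_nonneg[OF shift_brownian[OF assms(2)] assms(1), of "t - s" \<mu>]
    assms(3) by simp

lemma continuous_exp_functional:
  assumes "\<omega> \<in> space M"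
  shows "continuous_on {0..T} (\<lambda>t. A \<mu> t \<omega>)"
  unfolding exp_functional_def
  by (intro indefinite_integral_continuous_1 integrable_continuous_real continuous_integrand) (use assms in auto)

lemma tendsto_exp_functional:
  assumes "\<omega> \<in> space M" "X \<longlonglongrightarrow> t" "t \<ge> 0" "\<And>n. X n \<ge> (0::real)"
  shows "(\<lambda>n. A \<mu> (X n) \<omega>) \<longlonglongrightarrow> A \<mu> t \<omega>"
proof -
  obtain T where T: "\<And>n. norm (X n) \<le> T"
    using convergent_imp_Bseq[of X] assms(2) unfolding Bseq_def convergent_def by blast
  have tT: "t \<le> T"
    using T assms(2) by (intro LIMSEQ_le_const2[OF assms(2)]) (auto intro!: exI[of _ 0] simp: abs_le_iff)
  have "continuous_on {0..T} (\<lambda>t. A \<mu> t \<omega>)"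
    by (rule continuous_exp_functional[OF assms(1)])
  then show ?thesis
    unfolding continuous_on_sequentially
    using assms T tT by (auto simp: comp_def abs_le_iff)
qed

text \<open>Fatou along Riemann sums replaces Fubini, so no joint measurability of the path is needed.\<close>

lemma nn_integral_exp_functional_deviation:
  fixes c K t :: real
  assumes t: "t > 0" and K: "K \<ge> 0"
    and bound: "\<And>u. 0 \<le> u \<Longrightarrow> u < t \<Longrightarrow> (\<integral>\<^sup>+\<omega>. ennreal \<bar>exp (2 * (B u \<omega> + \<mu> * u)) - c\<bar> \<partial>M) \<le> ennreal K"
  shows "(\<integral>\<^sup>+\<omega>. ennreal \<bar>A \<mu> t \<omega> - c * t\<bar> \<partial>M) \<le> ennreal (t * K)"
proof -
  let ?R = "\<lambda>N \<omega>. riemann_grid \<mu> t N \<omega>"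
  have "(\<integral>\<^sup>+\<omega>. ennreal \<bar>A \<mu> t \<omega> - c * t\<bar> \<partial>M) =
      (\<integral>\<^sup>+\<omega>. liminf (\<lambda>N. ennreal \<bar>?R N \<omega> - c * t\<bar>) \<partial>M)"
  proof (intro nn_integral_cong)
    fix \<omega> assume \<omega>: "\<omega> \<in> space M"
    have "(\<lambda>N. ennreal \<bar>?R N \<omega> - c * t\<bar>) \<longlonglongrightarrow> ennreal \<bar>A \<mu> t \<omega> - c * t\<bar>"
      by (intro tendsto_ennrealI tendsto_intros riemann_tendsto_exp_functional \<omega> t)
    then show "ennreal \<bar>A \<mu> t \<omega> - c * t\<bar> = liminf (\<lambda>N. ennreal \<bar>?R N \<omega> - c * t\<bar>)"
      by (intro lim_imp_Liminf[symmetric]) simp_all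
  qed
  also have "\<dots> \<le> liminf (\<lambda>N. \<integral>\<^sup>+\<omega>. ennreal \<bar>?R N \<omega> - c * t\<bar> \<partial>M)"
    using measurable_riemann_grid[of t] t by (intro nn_integral_liminf) auto
  also have "\<dots> \<le> ennreal (t * K)"
  proof (rule Liminf_le)
    have "(\<integral>\<^sup>+\<omega>. ennreal \<bar>?R N \<omega> - c * t\<bar> \<partial>M) \<le> ennreal (t * K)" if N: "N > 0" for N
    proof -
      let ?u = "\<lambda>i. real i * t / real N"
      let ?d = "\<lambda>i \<omega>. exp (2 * (B (?u i) \<omega> + \<mu> * ?u i)) - c"
      have dm: "(\<lambda>\<omega>. \<bar>?d i \<omega>\<bar>) \<in> borel_measurable M" for i
        using measurable_B[of "?u i"] t by auto
      have "(\<integral>\<^sup>+\<omega>. ennreal \<bar>?R N \<omega> - c * t\<bar> \<partial>M) \<le> (\<integral>\<^sup>+\<omega>. ennreal (t / real N) * (\<Sum>i<N. ennreal \<bar>?d i \<omega>\<bar>) \<partial>M)"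
      proof (intro nn_integral_mono)
        fix \<omega> assume \<omega>: "\<omega> \<in> space M"
        have "?R N \<omega> - c * t = t / real N * (\<Sum>i<N. ?d i \<omega>)"
          unfolding riemann_of_grid_increments[OF \<omega>] using N
          by (simp add: sum_subtractf right_diff_distrib)
        then have "\<bar>?R N \<omega> - c * t\<bar> = t / real N * \<bar>\<Sum>i<N. ?d i \<omega>\<bar>"
          using t by (simp add: abs_mult)
        also have "\<dots> \<le> t / real N * (\<Sum>i<N. \<bar>?d i \<omega>\<bar>)"
          using t by (intro mult_left_mono sum_abs) auto
        finally have "ennreal \<bar>?R N \<omega> - c * t\<bar> \<le> ennreal (t / real N * (\<Sum>i<N. \<bar>?d i \<omega>\<bar>))"
          by (rule ennreal_leI)
        also have "\<dots> = ennreal (t / real N) * (\<Sum>i<N. ennreal \<bar>?d i \<omega>\<bar>)"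
          using t by (subst ennreal_mult) (simp_all only: sum_nonneg sum_ennreal abs_ge_zero divide_nonneg_nonneg of_nat_0_le_iff less_imp_le)
        finally show "ennreal \<bar>?R N \<omega> - c * t\<bar> \<le> ennreal (t / real N) * (\<Sum>i<N. ennreal \<bar>?d i \<omega>\<bar>)" .
      qed
      also have "\<dots> = ennreal (t / real N) * (\<Sum>i<N. \<integral>\<^sup>+\<omega>. ennreal \<bar>?d i \<omega>\<bar> \<partial>M)"
        using dm by (subst nn_integral_cmult, simp, subst nn_integral_sum) (simp_all del: sum_ennreal)
      also have "\<dots> \<le> ennreal (t / real N) * (\<Sum>i<N. ennreal K)"
        using t N by (intro mult_left_mono sum_mono bound) (auto simp: field_simps)
      also have "\<dots> = ennreal (t / real N) * ennreal (real N * K)"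
        using K by (simp add: ennreal_of_nat_eq_real_of_nat ennreal_mult)
      also have "\<dots> = ennreal (t / real N * (real N * K))"
        using t K by (subst ennreal_mult[symmetric]) auto
      also have "t / real N * (real N * K) = t * K"
        using N by simp
      finally show ?thesis .
    qed
    then show "\<forall>\<^sub>F N in sequentially. (\<integral>\<^sup>+\<omega>. ennreal \<bar>?R N \<omega> - c * t\<bar> \<partial>M) \<le> ennreal (t * K)"
      by (auto intro!: eventually_sequentiallyI[of 1])
  qed simp
  finally show ?thesis .
qed

end

section \<open>Negative exponential moments of the exponential functional\<close>

definition gauss_exp_moment :: "real \<Rightarrow> real" where
  "gauss_exp_moment k = (\<integral>z. std_normal_density z * exp (k * \<bar>z\<bar>) \<partial>lborel)"

lemma integrable_std_normal_exp_abs: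
  "integrable lborel (\<lambda>z. std_normal_density z * exp (k * \<bar>z\<bar>))"
proof -
  have "integrable lborel (\<lambda>z. 1 / sqrt (2 * pi) * (exp (k * \<bar>z\<bar>) * exp (- z\<^sup>2 / (2 * 1))))"
    by (intro integrable_mult_right integrable_exp_abs_gaussian) simp
  then show ?thesis
    by (simp add: normal_density_def mult_ac)
qed

lemma gauss_exp_moment_nonneg: "gauss_exp_moment k \<ge> 0"
  unfolding gauss_exp_moment_def by (intro Bochner_Integration.integral_nonneg) simp

lemma exp_ge_self: "(y::real) \<le> exp y"
  using exp_ge_add_one_self[of y] by linarith

lemma abs_exp_minus_one_le: "\<bar>exp y - 1\<bar> \<le> \<bar>y\<bar> * exp \<bar>y\<bar>" for y :: real
proof (cases "y \<ge> 0")
  case True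
  have "1 + - y \<le> exp (- y)" by (rule exp_ge_add_one_self)
  then have "exp y * (1 + - y) \<le> exp y * exp (- y)" by (intro mult_left_mono) auto
  then have "exp y - 1 \<le> y * exp y" by (simp add: exp_minus algebra_simps)
  then show ?thesis using True by simp
next
  case False
  then have "exp y \<le> 1" "1 - exp y \<le> - y"
    using exp_ge_add_one_self[of y] by (simp, linarith)
  with False have "\<bar>exp y - 1\<bar> \<le> \<bar>y\<bar> * 1" by simp
  also have "\<dots> \<le> \<bar>y\<bar> * exp \<bar>y\<bar>" by (intro mult_left_mono) auto
  finally show ?thesis .
qed

text \<open>Uniform in \<open>a\<close>, and in \<open>x\<close> away from 0: this is the majorant
  for all \<open>x\<close>-derivatives of \<open>exp(-x/a)\<close>.\<close>

lemma inverse_power_mult_exp_bound: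
  fixes a x x0 :: real
  assumes "a > 0" "x0 > 0" "x0 \<le> x"
  shows "(1 / a) ^ k * exp (- x / a) \<le> fact k / x0 ^ k"
proof -
  have "(x0 / a) ^ k * exp (- (x0 / a)) \<le> fact k"
    using assms by (intro power_mult_exp_minus_le_fact) simp
  moreover have "exp (- x / a) \<le> exp (- (x0 / a))"
    using assms by (simp add: divide_right_mono)
  then have "(x0 / a) ^ k * exp (- x / a) \<le> (x0 / a) ^ k * exp (- (x0 / a))"
    using assms by (intro mult_left_mono) auto
  ultimately have "(x0 / a) ^ k * exp (- x / a) \<le> fact k" by linarith
  then show ?thesis
    using assms by (simp add: power_divide field_simps)
qed

text \<open>Two forms for two uses: the first displays the order \<open>sqrt u\<close>, the second
  is free of \<open>u\<close> and goes into exponents.\<close>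

lemma drifted_gaussian_bound:
  assumes "0 < u" "u \<le> 1"
  shows "\<bar>sqrt u * z + \<mu> * u\<bar> \<le> sqrt u * ((1 + \<bar>\<mu>\<bar>) * exp \<bar>z\<bar>)"
    and "\<bar>sqrt u * z + \<mu> * u\<bar> \<le> \<bar>z\<bar> + \<bar>\<mu>\<bar>"
proof -
  have u: "u \<le> sqrt u" "sqrt u \<le> 1" "0 < sqrt u"
    using assms real_le_rsqrt[of u u] by (auto simp: power2_eq_square mult_left_le)
  have "\<bar>sqrt u * z + \<mu> * u\<bar> \<le> \<bar>sqrt u * z\<bar> + \<bar>\<mu> * u\<bar>"
    by (rule abs_triangle_ineq)
  also have "\<dots> = sqrt u * \<bar>z\<bar> + \<bar>\<mu>\<bar> * u"
    using assms by (simp add: abs_mult)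
  also have "\<dots> \<le> sqrt u * \<bar>z\<bar> + \<bar>\<mu>\<bar> * sqrt u"
    using u by (intro add_left_mono mult_left_mono) auto
  finally have 1: "\<bar>sqrt u * z + \<mu> * u\<bar> \<le> sqrt u * (\<bar>z\<bar> + \<bar>\<mu>\<bar>)"
    by (simp add: algebra_simps)
  have e: "1 \<le> exp \<bar>z\<bar>" "\<bar>z\<bar> \<le> exp \<bar>z\<bar>"
    by (auto simp: exp_ge_self)
  have "\<bar>\<mu>\<bar> * 1 \<le> \<bar>\<mu>\<bar> * exp \<bar>z\<bar>"
    using e by (intro mult_left_mono) auto
  then have "\<bar>z\<bar> + \<bar>\<mu>\<bar> \<le> (1 + \<bar>\<mu>\<bar>) * exp \<bar>z\<bar>"
    using e by (simp add: distrib_right)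
  then have "sqrt u * (\<bar>z\<bar> + \<bar>\<mu>\<bar>) \<le> sqrt u * ((1 + \<bar>\<mu>\<bar>) * exp \<bar>z\<bar>)"
    using u by (intro mult_left_mono) auto
  with 1 show "\<bar>sqrt u * z + \<mu> * u\<bar> \<le> sqrt u * ((1 + \<bar>\<mu>\<bar>) * exp \<bar>z\<bar>)" by simp
  have "sqrt u * (\<bar>z\<bar> + \<bar>\<mu>\<bar>) \<le> 1 * (\<bar>z\<bar> + \<bar>\<mu>\<bar>)"
    using u by (intro mult_right_mono) auto
  with 1 show "\<bar>sqrt u * z + \<mu> * u\<bar> \<le> \<bar>z\<bar> + \<bar>\<mu>\<bar>" by simp
qed

context brownian
begin

lemma
  fixes g :: "real \<Rightarrow> real"
  assumes u: "u > 0" and g: "g \<in> borel_measurable borel"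
    and b: "\<And>z. \<bar>g (sqrt u * z)\<bar> \<le> c * exp (k * \<bar>z\<bar>)"
  shows integrable_B_exp_bound: "integrable M (\<lambda>\<omega>. g (B u \<omega>))"
    and expectation_B_exp_bound: "(\<integral>\<omega>. \<bar>g (B u \<omega>)\<bar> \<partial>M) \<le> c * gauss_exp_moment k"
proof -
  have w: "integrable lborel (\<lambda>z. c * (std_normal_density z * exp (k * \<bar>z\<bar>)))"
    by (intro integrable_mult_right integrable_std_normal_exp_abs)
  have le: "std_normal_density z * \<bar>g (sqrt u * z)\<bar> \<le> c * (std_normal_density z * exp (k * \<bar>z\<bar>))" for z
    using mult_left_mono[OF b, of "std_normal_density z" z] by (simp add: mult_ac)
  have i: "integrable lborel (\<lambda>z. std_normal_density z * g (sqrt u * z))"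
  proof (rule Bochner_Integration.integrable_bound[OF w])
    show "AE z in lborel. norm (std_normal_density z * g (sqrt u * z)) \<le> norm (c * (std_normal_density z * exp (k * \<bar>z\<bar>)))"
    proof (rule AE_I2)
      fix z :: real
      have "norm (std_normal_density z * g (sqrt u * z)) = std_normal_density z * \<bar>g (sqrt u * z)\<bar>"
        by (simp add: abs_mult)
      also note le
      also have "c * (std_normal_density z * exp (k * \<bar>z\<bar>)) \<le> norm (c * (std_normal_density z * exp (k * \<bar>z\<bar>)))"
        unfolding real_norm_def by (rule abs_ge_self)
      finally show "norm (std_normal_density z * g (sqrt u * z)) \<le> norm (c * (std_normal_density z * exp (k * \<bar>z\<bar>)))" .
    qed
  qed (use g in measurable)
  show "integrable M (\<lambda>\<omega>. g (B u \<omega>))"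
    using integrable_B[OF u g] i by simp
  have gabs: "(\<lambda>y. \<bar>g y\<bar>) \<in> borel_measurable borel" using g by auto
  have i': "integrable lborel (\<lambda>z. std_normal_density z * \<bar>g (sqrt u * z)\<bar>)"
    using integrable_abs[OF i] by (simp add: abs_mult)
  have "(\<integral>\<omega>. \<bar>g (B u \<omega>)\<bar> \<partial>M) = (\<integral>z. std_normal_density z * \<bar>g (sqrt u * z)\<bar> \<partial>lborel)"
    by (rule expectation_B[OF u gabs])
  also have "\<dots> \<le> (\<integral>z. c * (std_normal_density z * exp (k * \<bar>z\<bar>)) \<partial>lborel)"
    by (rule integral_mono[OF i' w le])
  finally show "(\<integral>\<omega>. \<bar>g (B u \<omega>)\<bar> \<partial>M) \<le> c * gauss_exp_moment k"
    by (simp add: gauss_exp_moment_def)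
qed

text \<open>These are the orders of the errors in \<open>exp_neg_div_Taylor_bound\<close>. By
  Brownian scaling \<open>B_h + \<mu> h\<close> has size \<open>sqrt h\<close>. The deviation of
  \<open>A_h\<close> from \<open>h\<close> is the integral over \<open>[0, h]\<close> of
  \<open>exp(2 (B_u + \<mu> u)) - 1\<close>, whose absolute mean is of order \<open>sqrt u\<close>;
  this gives \<open>h * sqrt h\<close>.\<close>

lemma small_time_moment_bounds:
  obtains C where "C \<ge> 0"
    and "\<And>h. 0 < h \<Longrightarrow> h \<le> 1 \<Longrightarrow> integrable M (\<lambda>\<omega>. \<bar>B h \<omega> + \<mu> * h\<bar>) \<and>
        (\<integral>\<omega>. \<bar>B h \<omega> + \<mu> * h\<bar> \<partial>M) \<le> C * sqrt h"
    and "\<And>h. 0 < h \<Longrightarrow> h \<le> 1 \<Longrightarrow> integrable M (\<lambda>\<omega>. \<bar>B h \<omega> + \<mu> * h\<bar> ^ 3) \<and>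
        (\<integral>\<omega>. \<bar>B h \<omega> + \<mu> * h\<bar> ^ 3 \<partial>M) \<le> C * (h * sqrt h)"
    and "\<And>h. 0 < h \<Longrightarrow> h \<le> 1 \<Longrightarrow> integrable M (\<lambda>\<omega>. \<bar>A \<mu> h \<omega> - h\<bar>) \<and>
        (\<integral>\<omega>. \<bar>A \<mu> h \<omega> - h\<bar> \<partial>M) \<le> C * (h * sqrt h)"
proof -
  let ?c = "1 + \<bar>\<mu>\<bar>"
  \<comment> \<open>The argument of \<open>gauss_exp_moment\<close> counts factors
    \<open>exp |z|\<close>: one for the first moment, three for the cube, and one plus two for
    \<open>|y| exp |y|\<close> with \<open>y = 2 (B_u + \<mu> u)\<close>.\<close>
  define C1 where "C1 = ?c * gauss_exp_moment 1"
  define C2 where "C2 = ?c ^ 3 * gauss_exp_moment 3"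
  define C3 where "C3 = 2 * ?c * exp (2 * \<bar>\<mu>\<bar>) * gauss_exp_moment 3"
  have C: "C1 \<ge> 0" "C2 \<ge> 0" "C3 \<ge> 0"
    by (auto simp: C1_def C2_def C3_def intro!: mult_nonneg_nonneg gauss_exp_moment_nonneg)
  have 1: "integrable M (\<lambda>\<omega>. \<bar>B h \<omega> + \<mu> * h\<bar>) \<and> (\<integral>\<omega>. \<bar>B h \<omega> + \<mu> * h\<bar> \<partial>M) \<le> C1 * sqrt h"
    if h: "0 < h" "h \<le> 1" for h
  proof -
    have b: "\<bar>\<bar>sqrt h * z + \<mu> * h\<bar>\<bar> \<le> (sqrt h * ?c) * exp (1 * \<bar>z\<bar>)" for z
      using drifted_gaussian_bound(1)[OF h, of z \<mu>] by (simp add: mult_ac)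
    show ?thesis
      using integrable_B_exp_bound[OF h(1) _ b] expectation_B_exp_bound[OF h(1) _ b]
      by (simp add: C1_def mult_ac)
  qed
  have 2: "integrable M (\<lambda>\<omega>. \<bar>B h \<omega> + \<mu> * h\<bar> ^ 3) \<and> (\<integral>\<omega>. \<bar>B h \<omega> + \<mu> * h\<bar> ^ 3 \<partial>M) \<le> C2 * (h * sqrt h)"
    if h: "0 < h" "h \<le> 1" for h
  proof -
    have b: "\<bar>\<bar>sqrt h * z + \<mu> * h\<bar> ^ 3\<bar> \<le> (h * sqrt h * ?c ^ 3) * exp (3 * \<bar>z\<bar>)" for z
    proof -
      have "\<bar>sqrt h * z + \<mu> * h\<bar> ^ 3 \<le> (sqrt h * (?c * exp \<bar>z\<bar>)) ^ 3"
        by (intro power_mono drifted_gaussian_bound h) auto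
      also have "\<dots> = (sqrt h) ^ 3 * ?c ^ 3 * (exp \<bar>z\<bar>) ^ 3"
        by (simp add: power_mult_distrib)
      also have "(sqrt h) ^ 3 = h * sqrt h"
        using h by (simp add: power3_eq_cube)
      also have "(exp \<bar>z\<bar>) ^ 3 = exp (3 * \<bar>z\<bar>)"
        by (simp add: exp_of_nat_mult[symmetric])
      finally show ?thesis by simp
    qed
    show ?thesis
      using integrable_B_exp_bound[OF h(1) _ b] expectation_B_exp_bound[OF h(1) _ b]
      by (simp add: C2_def mult_ac)
  qed
  have 3: "integrable M (\<lambda>\<omega>. \<bar>A \<mu> h \<omega> - h\<bar>) \<and>
      (\<integral>\<omega>. \<bar>A \<mu> h \<omega> - h\<bar> \<partial>M) \<le> C3 * (h * sqrt h)"
    if h: "0 < h" "h \<le> 1" for h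
  proof -
    have "(\<integral>\<^sup>+\<omega>. ennreal \<bar>exp (2 * (B u \<omega> + \<mu> * u)) - 1\<bar> \<partial>M) \<le> ennreal (C3 * sqrt h)"
      if u: "0 \<le> u" "u < h" for u
    proof (cases "u = 0")
      \<comment> \<open>\<open>B_0\<close> is constant and has no normal density, so this time is
        treated apart.\<close>
      case True
      then have "(\<integral>\<^sup>+\<omega>. ennreal \<bar>exp (2 * (B u \<omega> + \<mu> * u)) - 1\<bar> \<partial>M) = (\<integral>\<^sup>+\<omega>. 0 \<partial>M)"
        by (intro nn_integral_cong) (simp add: B_0)
      then show ?thesis by simp
    next
      case False
      then have u': "0 < u" "u \<le> 1" using u h by auto
      have b: "\<bar>\<bar>exp (2 * (sqrt u * z + \<mu> * u)) - 1\<bar>\<bar> \<le> (sqrt u * (2 * ?c * exp (2 * \<bar>\<mu>\<bar>))) * exp (3 * \<bar>z\<bar>)" for z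
      proof -
        let ?y = "2 * (sqrt u * z + \<mu> * u)"
        have "\<bar>exp ?y - 1\<bar> \<le> \<bar>?y\<bar> * exp \<bar>?y\<bar>"
          by (rule abs_exp_minus_one_le)
        also have "\<bar>?y\<bar> = 2 * \<bar>sqrt u * z + \<mu> * u\<bar>" by (subst abs_mult) simp
        also have "2 * \<bar>sqrt u * z + \<mu> * u\<bar> * exp (2 * \<bar>sqrt u * z + \<mu> * u\<bar>) \<le>
            2 * (sqrt u * (?c * exp \<bar>z\<bar>)) * exp (2 * (\<bar>z\<bar> + \<bar>\<mu>\<bar>))"
          using drifted_gaussian_bound[OF u', of z \<mu>] u'
          by (intro mult_mono mult_left_mono iffD2[OF exp_le_cancel_iff]) (auto intro!: mult_nonneg_nonneg)
        also have "\<dots> = (sqrt u * (2 * ?c * exp (2 * \<bar>\<mu>\<bar>))) * (exp \<bar>z\<bar> * exp (2 * \<bar>z\<bar>))"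
          by (simp only: distrib_left exp_add mult_ac)
        also have "exp \<bar>z\<bar> * exp (2 * \<bar>z\<bar>) = exp (3 * \<bar>z\<bar>)"
          by (simp add: exp_add[symmetric])
        finally show ?thesis by simp
      qed
      have m: "(\<lambda>y::real. \<bar>exp (2 * (y + \<mu> * u)) - 1\<bar>) \<in> borel_measurable borel" by measurable
      have i: "integrable M (\<lambda>\<omega>. \<bar>exp (2 * (B u \<omega> + \<mu> * u)) - 1\<bar>)"
        and le: "(\<integral>\<omega>. \<bar>exp (2 * (B u \<omega> + \<mu> * u)) - 1\<bar> \<partial>M) \<le> sqrt u * (2 * ?c * exp (2 * \<bar>\<mu>\<bar>)) * gauss_exp_moment 3"
        using integrable_B_exp_bound[OF u'(1) m b] expectation_B_exp_bound[OF u'(1) m b] by simp_all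
      have "sqrt u * (2 * ?c * exp (2 * \<bar>\<mu>\<bar>)) * gauss_exp_moment 3 = C3 * sqrt u"
        by (simp add: C3_def mult_ac)
      also have "\<dots> \<le> C3 * sqrt h"
        using u C by (intro mult_left_mono) auto
      finally show ?thesis
        using i le by (subst nn_integral_eq_integral) (auto intro!: ennreal_leI)
    qed
    then have nn: "(\<integral>\<^sup>+\<omega>. ennreal \<bar>A \<mu> h \<omega> - 1 * h\<bar> \<partial>M) \<le> ennreal (h * (C3 * sqrt h))"
      using h C by (intro nn_integral_exp_functional_deviation) auto
    have m: "(\<lambda>\<omega>. \<bar>A \<mu> h \<omega> - h\<bar>) \<in> borel_measurable M"
      using measurable_exp_functional[OF h(1)] by measurable
    have "integrable M (\<lambda>\<omega>. \<bar>A \<mu> h \<omega> - h\<bar>)"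
      using nn m by (intro integrableI_nonneg) (auto intro: le_less_trans)
    moreover have "(\<integral>\<omega>. \<bar>A \<mu> h \<omega> - h\<bar> \<partial>M) \<le> h * (C3 * sqrt h)"
      using nn h C by (intro integral_real_bounded) auto
    ultimately show ?thesis by (simp add: mult_ac)
  qed
  show ?thesis
  proof (rule that[of "C1 + C2 + C3"])
    show "0 \<le> C1 + C2 + C3" using C by simp
    fix h :: real assume h: "0 < h" "h \<le> 1"
    have le: "C1 * sqrt h \<le> (C1 + C2 + C3) * sqrt h" "C2 * (h * sqrt h) \<le> (C1 + C2 + C3) * (h * sqrt h)"
      "C3 * (h * sqrt h) \<le> (C1 + C2 + C3) * (h * sqrt h)"
      using C h by (auto intro!: mult_right_mono)
    show "integrable M (\<lambda>\<omega>. \<bar>B h \<omega> + \<mu> * h\<bar>) \<and> (\<integral>\<omega>. \<bar>B h \<omega> + \<mu> * h\<bar> \<partial>M) \<le> (C1 + C2 + C3) * sqrt h"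
      using 1[OF h] le by linarith
    show "integrable M (\<lambda>\<omega>. \<bar>B h \<omega> + \<mu> * h\<bar> ^ 3) \<and> (\<integral>\<omega>. \<bar>B h \<omega> + \<mu> * h\<bar> ^ 3 \<partial>M) \<le> (C1 + C2 + C3) * (h * sqrt h)"
      using 2[OF h] le by linarith
    show "integrable M (\<lambda>\<omega>. \<bar>A \<mu> h \<omega> - h\<bar>) \<and>
        (\<integral>\<omega>. \<bar>A \<mu> h \<omega> - h\<bar> \<partial>M) \<le> (C1 + C2 + C3) * (h * sqrt h)"
      using 3[OF h] le by linarith
  qed
qed

text \<open>The case \<open>c = 0\<close> of the deviation bound. It will dominate the logarithm
  through \<open>ln (1 + v) \<le> v\<close>.\<close>

lemma integrable_exp_functional:
  assumes t: "t > 0"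
  shows "integrable M (A \<mu> t)"
proof -
  \<comment> \<open>The added 1 covers \<open>u = 0\<close>, where the exponential equals 1.\<close>
  define K where "K = exp (2 * \<bar>\<mu>\<bar> * t) * gauss_exp_moment (2 * sqrt t) + 1"
  have K: "K \<ge> 1" unfolding K_def by (simp add: gauss_exp_moment_nonneg)
  have "(\<integral>\<^sup>+\<omega>. ennreal \<bar>exp (2 * (B u \<omega> + \<mu> * u)) - 0\<bar> \<partial>M) \<le> ennreal K" if u: "0 \<le> u" "u < t" for u
  proof (cases "u = 0")
    case True
    then have "(\<integral>\<^sup>+\<omega>. ennreal \<bar>exp (2 * (B u \<omega> + \<mu> * u)) - 0\<bar> \<partial>M) = (\<integral>\<^sup>+\<omega>. 1 \<partial>M)"
      by (intro nn_integral_cong) (simp add: B_0)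
    then show ?thesis using K by (simp add: emeasure_space_1)
  next
    case False
    then have u': "0 < u" using u by simp
    have b: "\<bar>exp (2 * (sqrt u * z + \<mu> * u))\<bar> \<le> exp (2 * \<bar>\<mu>\<bar> * t) * exp (2 * sqrt t * \<bar>z\<bar>)" for z
    proof -
      have "sqrt u * z \<le> sqrt u * \<bar>z\<bar>" "sqrt u * \<bar>z\<bar> \<le> sqrt t * \<bar>z\<bar>"
        "\<mu> * u \<le> \<bar>\<mu>\<bar> * u" "\<bar>\<mu>\<bar> * u \<le> \<bar>\<mu>\<bar> * t"
        using u by (auto intro!: mult_left_mono mult_right_mono)
      then have "sqrt u * z + \<mu> * u \<le> \<bar>\<mu>\<bar> * t + sqrt t * \<bar>z\<bar>" by linarith
      then show ?thesis
        by (simp add: exp_add[symmetric])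
    qed
    have m: "(\<lambda>y::real. exp (2 * (y + \<mu> * u))) \<in> borel_measurable borel" by measurable
    have i: "integrable M (\<lambda>\<omega>. exp (2 * (B u \<omega> + \<mu> * u)))"
      and le: "(\<integral>\<omega>. \<bar>exp (2 * (B u \<omega> + \<mu> * u))\<bar> \<partial>M) \<le> K"
      using integrable_B_exp_bound[OF u' m b] expectation_B_exp_bound[OF u' m b] by (simp_all add: K_def)
    show ?thesis
      using i le by (simp add: nn_integral_eq_integral ennreal_leI)
  qed
  then have nn: "(\<integral>\<^sup>+\<omega>. ennreal \<bar>A \<mu> t \<omega> - 0 * t\<bar> \<partial>M) \<le> ennreal (t * K)"
    using t K by (intro nn_integral_exp_functional_deviation) auto
  show ?thesis
    using nn measurable_exp_functional[OF t]
    by (intro integrableI_bounded) (auto intro: le_less_trans)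
qed

text \<open>For \<open>x > 0\<close>, up to the sign \<open>(-1)^k\<close>, the \<open>k\<close>-th
  derivative in \<open>x\<close> of \<open>E exp(-x/A_t)\<close>; the case \<open>k = 0\<close> is
  the function to be identified with \<open>G\<close>.\<close>

definition inv_moment :: "real \<Rightarrow> nat \<Rightarrow> real \<Rightarrow> real \<Rightarrow> real" where
  "inv_moment \<mu> k t x = (\<integral>\<omega>. (1 / A \<mu> t \<omega>) ^ k * exp (- x / A \<mu> t \<omega>) \<partial>M)"

lemma measurable_inv_moment:
  "t > 0 \<Longrightarrow> (\<lambda>\<omega>. (1 / A \<mu> t \<omega>) ^ k * exp (- x / A \<mu> t \<omega>)) \<in> borel_measurable M"
  using measurable_exp_functional[of t \<mu>] by measurable

lemma integrable_inv_moment: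
  assumes "t > 0" "x > 0"
  shows "integrable M (\<lambda>\<omega>. (1 / A \<mu> t \<omega>) ^ k * exp (- x / A \<mu> t \<omega>))"
  by (rule integrable_const_bound[of _ "fact k / x ^ k"])
     (use assms inverse_power_mult_exp_bound exp_functional_pos measurable_inv_moment in
       \<open>auto intro!: AE_I2 simp: less_imp_le\<close>)

lemma inv_moment_derivative:
  assumes t: "t > 0" and x: "x > 0"
  shows "((\<lambda>x. inv_moment \<mu> k t x) has_real_derivative - inv_moment \<mu> (Suc k) t x) (at x)"
proof -
  let ?A = "A \<mu> t"
  have "((\<lambda>x. inv_moment \<mu> k t x) has_real_derivative
      (\<integral>\<omega>. - ((1 / ?A \<omega>) ^ Suc k * exp (- x / ?A \<omega>)) \<partial>M)) (at x)"
    unfolding inv_moment_def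
  proof (rule has_real_derivative_lebesgue_integral[where a = "x / 2" and b = "2 * x" and w = "\<lambda>_. fact (Suc k) / (x / 2) ^ Suc k"
        and f' = "\<lambda>x \<omega>. - ((1 / ?A \<omega>) ^ Suc k * exp (- x / ?A \<omega>))"])
    fix y \<omega> assume y: "x / 2 < y" and \<omega>: "\<omega> \<in> space M"
    have A: "?A \<omega> > 0" using exp_functional_pos[OF \<omega> t] .
    show "((\<lambda>y. (1 / ?A \<omega>) ^ k * exp (- y / ?A \<omega>)) has_real_derivative - ((1 / ?A \<omega>) ^ Suc k * exp (- y / ?A \<omega>))) (at y)"
      using A by (auto intro!: derivative_eq_intros simp: field_simps)
    show "\<bar>- ((1 / ?A \<omega>) ^ Suc k * exp (- y / ?A \<omega>))\<bar> \<le> fact (Suc k) / (x / 2) ^ Suc k"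
      using inverse_power_mult_exp_bound[OF A, of "x / 2" y "Suc k"] y x A
      by (simp only: abs_minus_cancel) (subst abs_of_nonneg, auto simp: less_imp_le)
  next
    show "(\<lambda>\<omega>. - ((1 / ?A \<omega>) ^ Suc k * exp (- x / ?A \<omega>))) \<in> borel_measurable M"
      by (intro borel_measurable_uminus measurable_inv_moment t)
  qed (use x t integrable_inv_moment in auto)
  then show ?thesis
    by (simp add: inv_moment_def)
qed

lemma tendsto_inv_moment:
  assumes "X \<longlonglongrightarrow> t" "t > 0" "\<And>n. X n > 0" "x > 0"
  shows "(\<lambda>n. inv_moment \<mu> k (X n) x) \<longlonglongrightarrow> inv_moment \<mu> k t x"
  unfolding inv_moment_def
proof (rule integral_dominated_convergence[where w = "\<lambda>_. fact k / x ^ k"])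
  show "AE \<omega> in M. (\<lambda>n. (1 / A \<mu> (X n) \<omega>) ^ k * exp (- x / A \<mu> (X n) \<omega>))
      \<longlonglongrightarrow> (1 / A \<mu> t \<omega>) ^ k * exp (- x / A \<mu> t \<omega>)"
    using assms exp_functional_pos[of _ t \<mu>]
    by (intro AE_I2 tendsto_intros tendsto_exp_functional) (auto simp: less_imp_le less_imp_neq[symmetric])
  show "AE \<omega> in M. norm ((1 / A \<mu> (X n) \<omega>) ^ k * exp (- x / A \<mu> (X n) \<omega>)) \<le> fact k / x ^ k" for n
    using assms inverse_power_mult_exp_bound[of _ x x k] exp_functional_pos[OF _ assms(3)]
    by (intro AE_I2) (auto simp: less_imp_le)
qed (use assms measurable_inv_moment in auto)

text \<open>For \<open>k = 0\<close> the integrand is bounded by 1, so \<open>x\<close> may move as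
  well and the edge \<open>x = 0\<close> is allowed; for \<open>k > 0\<close> the majorant used
  above blows up there.\<close>

lemma tendsto_inv_moment_0:
  assumes "X \<longlonglongrightarrow> t" "t > 0" "\<And>n. X n > 0" "Y \<longlonglongrightarrow> x" "\<And>n. Y n \<ge> 0"
  shows "(\<lambda>n. inv_moment \<mu> 0 (X n) (Y n)) \<longlonglongrightarrow> inv_moment \<mu> 0 t x"
  unfolding inv_moment_def
proof (rule integral_dominated_convergence[where w = "\<lambda>_. 1"])
  show "AE \<omega> in M. (\<lambda>n. (1 / A \<mu> (X n) \<omega>) ^ 0 * exp (- Y n / A \<mu> (X n) \<omega>))
      \<longlonglongrightarrow> (1 / A \<mu> t \<omega>) ^ 0 * exp (- x / A \<mu> t \<omega>)"
    using assms exp_functional_pos[of _ t \<mu>] unfolding power_0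
    by (intro AE_I2 tendsto_intros tendsto_exp_functional) (auto simp: less_imp_le less_imp_neq[symmetric])
  show "AE \<omega> in M. norm ((1 / A \<mu> (X n) \<omega>) ^ 0 * exp (- Y n / A \<mu> (X n) \<omega>)) \<le> 1" for n
    using assms exp_functional_pos[OF _ assms(3)]
    by (intro AE_I2) (auto simp: less_imp_le)
qed ((rule measurable_inv_moment, use assms in simp) | simp)+

text \<open>Expectation of the Taylor bound. The later functional is independent of
  \<open>B_h\<close> and has the law of \<open>A\<close> at time \<open>t - h\<close>, so the
  moments in the main term sit at \<open>t - h\<close> instead of \<open>t\<close>. With
  \<open>E b = \<mu> h\<close> and \<open>E b^2 = h + \<mu>^2 h^2\<close> the coefficient of
  \<open>h\<close> is \<open>\<mu> E f1 + E f2 / 2 + E f3\<close>, where \<open>f0\<close> to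
  \<open>f3\<close> are the Taylor coefficients as functions of the later functional.\<close>

lemma inv_moment_short_time_expansion:
  assumes t: "t > 0" and x: "x > 0"
  obtains C h0 where "h0 > 0" "h0 \<le> 1" "h0 < t"
    "\<And>h. 0 < h \<Longrightarrow> h < h0 \<Longrightarrow>
      \<bar>inv_moment \<mu> 0 t x - inv_moment \<mu> 0 (t - h) x -
        h * ((2 * x\<^sup>2 + x) * inv_moment \<mu> 2 (t - h) x - 2 * (1 - \<mu>) * x * inv_moment \<mu> 1 (t - h) x)\<bar>
      \<le> C * (h * sqrt h)"
proof -
  define f0 where "f0 a = exp (- (x / a))" for a :: real
  define f1 where "f1 a = 2 * (x / a) * exp (- (x / a))" for a :: real
  define f2 where "f2 a = 4 * ((x / a)\<^sup>2 - x / a) * exp (- (x / a))" for a :: real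
  define f3 where "f3 a = (x / a)\<^sup>2 * exp (- (x / a)) / x" for a :: real
  have pw: "(x / a) * exp (- (x / a)) \<le> 1" "(x / a)\<^sup>2 * exp (- (x / a)) \<le> 2"
    "0 \<le> (x / a) * exp (- (x / a))" "0 \<le> (x / a)\<^sup>2 * exp (- (x / a))" if "a > 0" for a
    using power_mult_exp_minus_le_fact[of "x / a" 1] power_mult_exp_minus_le_fact[of "x / a" 2] that x
    by (simp_all add: fact_numeral)
  have m: "f0 \<in> borel_measurable borel" "f1 \<in> borel_measurable borel"
    "f2 \<in> borel_measurable borel" "f3 \<in> borel_measurable borel"
    unfolding f0_def f1_def f2_def f3_def by measurable
  have c: "isCont f0 a" "isCont f1 a" "isCont f2 a" "isCont f3 a" if "a > 0" for a
    using that x unfolding f0_def f1_def f2_def f3_def by (auto intro!: continuous_intros)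
  have b0: "\<bar>f0 a\<bar> \<le> 1" if "a > 0" for a
    using that x by (simp add: f0_def)
  have b1: "\<bar>f1 a\<bar> \<le> 2" if "a > 0" for a
    using pw[OF that] by (simp add: f1_def mult.assoc)
  have b2: "\<bar>f2 a\<bar> \<le> 12" if "a > 0" for a
  proof -
    have "f2 a = 4 * ((x / a)\<^sup>2 * exp (- (x / a))) - 4 * ((x / a) * exp (- (x / a)))"
      by (simp add: f2_def algebra_simps)
    then show ?thesis using pw[OF that] by linarith
  qed
  have b3: "\<bar>f3 a\<bar> \<le> 2 / x" if "a > 0" for a
    using pw[OF that] x by (simp add: f3_def divide_right_mono)
  obtain C where C: "C \<ge> 0"
    and C1: "\<And>h. 0 < h \<Longrightarrow> h \<le> 1 \<Longrightarrow> integrable M (\<lambda>\<omega>. \<bar>B h \<omega> + \<mu> * h\<bar>) \<and>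
        (\<integral>\<omega>. \<bar>B h \<omega> + \<mu> * h\<bar> \<partial>M) \<le> C * sqrt h"
    and C2: "\<And>h. 0 < h \<Longrightarrow> h \<le> 1 \<Longrightarrow> integrable M (\<lambda>\<omega>. \<bar>B h \<omega> + \<mu> * h\<bar> ^ 3) \<and>
        (\<integral>\<omega>. \<bar>B h \<omega> + \<mu> * h\<bar> ^ 3 \<partial>M) \<le> C * (h * sqrt h)"
    and C3: "\<And>h. 0 < h \<Longrightarrow> h \<le> 1 \<Longrightarrow> integrable M (\<lambda>\<omega>. \<bar>A \<mu> h \<omega> - h\<bar>) \<and>
        (\<integral>\<omega>. \<bar>A \<mu> h \<omega> - h\<bar> \<partial>M) \<le> C * (h * sqrt h)"
    using small_time_moment_bounds[of \<mu>] by metis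
  \<comment> \<open>The error coefficients of the Taylor bound times the moment constants. The last
    summand pays for the part \<open>\<mu>^2 h^2\<close> of \<open>E b^2\<close>, halved and
    multiplied by the bound 12 on \<open>f2\<close>.\<close>
  define K where "K = 2 / x * C + 18 / x\<^sup>2 + 20 / x * C + 18 * C + 6 * \<mu>\<^sup>2"
  show ?thesis
  proof (rule that[of "min 1 (t / 2)" K])
    show "0 < min 1 (t / 2)" "min 1 (t / 2) \<le> 1" "min 1 (t / 2) < t" using t by (auto simp: min_def)
    fix h assume h: "0 < h" "h < min 1 (t / 2)"
    then have h1: "h \<le> 1" "h < t" "t - h > 0" using t by auto
    define B' where "B' = (\<lambda>u \<omega>. B (h + u) \<omega> - B h \<omega>)"
    interpret S: brownian M B' unfolding B'_def using shift_brownian h by simp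
    define a where "a \<omega> = exp_functional B' \<mu> (t - h) \<omega>" for \<omega>
    define b where "b \<omega> = B h \<omega> + \<mu> * h" for \<omega>
    have a: "a \<omega> > 0" if "\<omega> \<in> space M" for \<omega>
      unfolding a_def by (rule S.exp_functional_pos[OF that h1(3)])
    have am: "a \<in> borel_measurable M"
      using S.measurable_exp_functional[OF h1(3)] by (simp add: a_def[abs_def])
    have bm: "b \<in> borel_measurable M"
      unfolding b_def using measurable_B[of h] h by auto
    have fac: "(\<integral>\<omega>. g (B h \<omega>) * f (a \<omega>) \<partial>M) = (\<integral>\<omega>. g (B h \<omega>) \<partial>M) * (\<integral>\<omega>. f (A \<mu> (t - h) \<omega>) \<partial>M)"
      if "f \<in> borel_measurable borel" "\<And>a. a > 0 \<Longrightarrow> isCont f a" "\<And>a. a > 0 \<Longrightarrow> \<bar>f a\<bar> \<le> L"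
        "g \<in> borel_measurable borel" "integrable M (\<lambda>\<omega>. g (B h \<omega>))" for f g :: "real \<Rightarrow> real" and L
      unfolding a_def B'_def by (rule expectation_B_mult_shift[OF h(1) h1(3) that])
    let ?E = "\<lambda>f. \<integral>\<omega>. f (A \<mu> (t - h) \<omega>) \<partial>M"

    have ib: "integrable M b"
      by (rule integrable_abs_cancel) (use C1[OF h(1) h1(1)] bm in \<open>auto simp: b_def\<close>)
    have zi: "integrable lborel (\<lambda>z. std_normal_density z * z ^ k)" for k
      by (rule integrable_std_normal_moment)
    have z0: "(\<integral>z. std_normal_density z \<partial>lborel) = 1"
      using integral_std_normal_moment_even[of 0] by simp
    have z1: "(\<integral>z. std_normal_density z * z \<partial>lborel) = 0"
      using integral_std_normal_moment_odd[of 0] by simp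
    have z2: "(\<integral>z. std_normal_density z * z\<^sup>2 \<partial>lborel) = 1"
      using integral_std_normal_moment_even[of 1] by (simp add: fact_numeral)
    have g1: "(\<integral>\<omega>. B h \<omega> + \<mu> * h \<partial>M) = \<mu> * h"
    proof -
      have "(\<integral>\<omega>. B h \<omega> + \<mu> * h \<partial>M) = (\<integral>z. std_normal_density z * (sqrt h * z + \<mu> * h) \<partial>lborel)"
        using expectation_B[OF h(1), of "\<lambda>y. y + \<mu> * h"] by simp
      also have "\<dots> = (\<integral>z. sqrt h * (std_normal_density z * z) + \<mu> * h * std_normal_density z \<partial>lborel)"
        by (simp add: algebra_simps)
      also have "\<dots> = sqrt h * 0 + \<mu> * h * 1"
        using zi[of 0] zi[of 1] z0 z1 by (subst Bochner_Integration.integral_add) simp_all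
      finally show ?thesis by simp
    qed
    have eq2: "std_normal_density z * (sqrt h * z + \<mu> * h)\<^sup>2 = h * (std_normal_density z * z\<^sup>2) +
        (2 * sqrt h * \<mu> * h * (std_normal_density z * z) + \<mu>\<^sup>2 * h\<^sup>2 * std_normal_density z)" for z
    proof -
      have "(sqrt h * z + \<mu> * h)\<^sup>2 = (sqrt h)\<^sup>2 * z\<^sup>2 + 2 * sqrt h * \<mu> * h * z + \<mu>\<^sup>2 * h\<^sup>2"
        by (simp add: power2_sum power_mult_distrib)
      also have "(sqrt h)\<^sup>2 = h" using h by simp
      finally show ?thesis by (simp only: distrib_left) (simp add: mult_ac)
    qed
    have i2: "integrable M (\<lambda>\<omega>. (B h \<omega> + \<mu> * h)\<^sup>2)"
      using integrable_B[OF h(1), of "\<lambda>y. (y + \<mu> * h)\<^sup>2"] zi[of 0] zi[of 1] zi[of 2] by (simp add: eq2)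
    have g2: "(\<integral>\<omega>. (B h \<omega> + \<mu> * h)\<^sup>2 \<partial>M) = h + \<mu>\<^sup>2 * h\<^sup>2"
    proof -
      have "(\<integral>\<omega>. (B h \<omega> + \<mu> * h)\<^sup>2 \<partial>M) = (\<integral>z. std_normal_density z * (sqrt h * z + \<mu> * h)\<^sup>2 \<partial>lborel)"
        using expectation_B[OF h(1), of "\<lambda>y. (y + \<mu> * h)\<^sup>2"] by simp
      also have "\<dots> = h * 1 + (2 * sqrt h * \<mu> * h * 0 + \<mu>\<^sup>2 * h\<^sup>2 * 1)"
        unfolding eq2 using zi[of 0] zi[of 1] zi[of 2] z0 z1 z2
        by simp
      finally show ?thesis by simp
    qed

    have e0: "(\<integral>\<omega>. f0 (a \<omega>) \<partial>M) = ?E f0"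
    proof -
      have "(\<integral>\<omega>. 1 * f0 (a \<omega>) \<partial>M) = (\<integral>\<omega>. 1 \<partial>M) * ?E f0"
        by (rule fac[OF m(1) c(1) b0 borel_measurable_const integrable_const])
      then show ?thesis by (simp add: prob_space)
    qed
    have e1: "(\<integral>\<omega>. b \<omega> * f1 (a \<omega>) \<partial>M) = \<mu> * h * ?E f1"
    proof -
      have "(\<integral>\<omega>. (B h \<omega> + \<mu> * h) * f1 (a \<omega>) \<partial>M) = (\<integral>\<omega>. B h \<omega> + \<mu> * h \<partial>M) * ?E f1"
        by (rule fac[OF m(2) c(2) b1, of "\<lambda>y. y + \<mu> * h"]) (use ib in \<open>simp_all add: b_def[abs_def]\<close>)
      then show ?thesis unfolding g1 b_def .
    qed
    have e2: "(\<integral>\<omega>. (b \<omega>)\<^sup>2 * f2 (a \<omega>) \<partial>M) = (h + \<mu>\<^sup>2 * h\<^sup>2) * ?E f2"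
    proof -
      have "(\<integral>\<omega>. (B h \<omega> + \<mu> * h)\<^sup>2 * f2 (a \<omega>) \<partial>M) = (\<integral>\<omega>. (B h \<omega> + \<mu> * h)\<^sup>2 \<partial>M) * ?E f2"
        by (rule fac[OF m(3) c(3) b2, of "\<lambda>y. (y + \<mu> * h)\<^sup>2"]) (use i2 in simp_all)
      then show ?thesis unfolding g2 b_def .
    qed
    have e3: "(\<integral>\<omega>. f3 (a \<omega>) \<partial>M) = ?E f3"
    proof -
      have "(\<integral>\<omega>. 1 * f3 (a \<omega>) \<partial>M) = (\<integral>\<omega>. 1 \<partial>M) * ?E f3"
        by (rule fac[OF m(4) c(4) b3 borel_measurable_const integrable_const])
      then show ?thesis by (simp add: prob_space)
    qed

    have bi: "integrable M (\<lambda>\<omega>. g \<omega> * f (a \<omega>))"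
      if "integrable M g" "f \<in> borel_measurable borel" "\<And>a. a > 0 \<Longrightarrow> \<bar>f a\<bar> \<le> L" for f L and g :: "'a \<Rightarrow> real"
    proof (rule Bochner_Integration.integrable_bound)
      show "integrable M (\<lambda>\<omega>. L * \<bar>g \<omega>\<bar>)" using that(1) by auto
      show "(\<lambda>\<omega>. g \<omega> * f (a \<omega>)) \<in> borel_measurable M"
        using that(1) measurable_compose[OF am that(2)] by auto
      show "AE \<omega> in M. norm (g \<omega> * f (a \<omega>)) \<le> norm (L * \<bar>g \<omega>\<bar>)"
      proof (rule AE_I2)
        fix \<omega> assume "\<omega> \<in> space M"
        then have "\<bar>f (a \<omega>)\<bar> \<le> \<bar>L\<bar>" using that(3)[OF a] by (meson abs_ge_self order_trans)
        then have "\<bar>g \<omega>\<bar> * \<bar>f (a \<omega>)\<bar> \<le> \<bar>g \<omega>\<bar> * \<bar>L\<bar>" by (intro mult_left_mono) auto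
        then show "norm (g \<omega> * f (a \<omega>)) \<le> norm (L * \<bar>g \<omega>\<bar>)" by (simp add: abs_mult mult.commute)
      qed
    qed
    have i0: "integrable M (\<lambda>\<omega>. f0 (a \<omega>))"
    proof -
      have "integrable M (\<lambda>\<omega>. 1 * f0 (a \<omega>))" by (rule bi[OF integrable_const m(1) b0])
      then show ?thesis by simp
    qed
    have i1: "integrable M (\<lambda>\<omega>. b \<omega> * f1 (a \<omega>))" by (rule bi[OF ib m(2) b1])
    have i2': "integrable M (\<lambda>\<omega>. (b \<omega>)\<^sup>2 * f2 (a \<omega>))"
      using i2 by (intro bi[OF _ m(3) b2]) (simp_all add: b_def)
    have i3: "integrable M (\<lambda>\<omega>. f3 (a \<omega>))"
    proof -
      have "integrable M (\<lambda>\<omega>. 1 * f3 (a \<omega>))" by (rule bi[OF integrable_const m(4) b3])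
      then show ?thesis by simp
    qed

    define T where "T \<omega> = f0 (a \<omega>) + b \<omega> * f1 (a \<omega>) + (b \<omega>)\<^sup>2 * f2 (a \<omega>) / 2 + h * f3 (a \<omega>)" for \<omega>
    have iT: "integrable M T"
      unfolding T_def using i0 i1 i2' i3 by auto
    have ET: "(\<integral>\<omega>. T \<omega> \<partial>M) = ?E f0 + \<mu> * h * ?E f1 + (h + \<mu>\<^sup>2 * h\<^sup>2) * ?E f2 / 2 + h * ?E f3"
      unfolding T_def e0[symmetric] e1[symmetric] e2[symmetric] e3[symmetric]
      using i0 i1 i2' i3 by simp
    have iF: "integrable M (\<lambda>\<omega>. exp (- x / A \<mu> t \<omega>))"
      using integrable_inv_moment[OF t x, of \<mu> 0] by simp
    define R where "R \<omega> = 2 / x * \<bar>A \<mu> h \<omega> - h\<bar> + 18 / x\<^sup>2 * h\<^sup>2 + 20 / x * (h * \<bar>b \<omega>\<bar>) + 18 * \<bar>b \<omega>\<bar> ^ 3" for \<omega>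
    have iR: "integrable M R"
      unfolding R_def b_def using C1[OF h(1) h1(1)] C2[OF h(1) h1(1)] C3[OF h(1) h1(1)]
      by (intro Bochner_Integration.integrable_add integrable_mult_right integrable_const) auto
    have ER: "(\<integral>\<omega>. R \<omega> \<partial>M) = 2 / x * (\<integral>\<omega>. \<bar>A \<mu> h \<omega> - h\<bar> \<partial>M) + 18 / x\<^sup>2 * h\<^sup>2 +
        20 / x * (h * (\<integral>\<omega>. \<bar>b \<omega>\<bar> \<partial>M)) + 18 * (\<integral>\<omega>. \<bar>b \<omega>\<bar> ^ 3 \<partial>M)"
      unfolding R_def b_def using C1[OF h(1) h1(1)] C2[OF h(1) h1(1)] C3[OF h(1) h1(1)]
      by (simp add: prob_space)
    \<comment> \<open>\<open>h \<le> 1\<close> lets terms of order \<open>h^2\<close> be absorbed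
      into \<open>h * sqrt h\<close>.\<close>
    have hs: "h \<le> sqrt h" "h\<^sup>2 \<le> h * sqrt h" "0 \<le> h * sqrt h"
    proof -
      show "h \<le> sqrt h" using h h1 real_le_rsqrt[of h h] by (simp add: power2_eq_square mult_left_le)
      then show "h\<^sup>2 \<le> h * sqrt h" using h by (simp add: power2_eq_square)
    qed (use h in auto)
    have ptw: "\<bar>exp (- x / A \<mu> t \<omega>) - T \<omega>\<bar> \<le> R \<omega>" if \<omega>: "\<omega> \<in> space M" for \<omega>
    proof -
      have "A \<mu> t \<omega> = A \<mu> h \<omega> + exp (2 * b \<omega>) * a \<omega>"
        using exp_functional_split[OF \<omega>, of h t \<mu>] h h1 by (simp add: a_def b_def B'_def)
      then show ?thesis
        using exp_neg_div_Taylor_bound[OF x a[OF \<omega>], of "A \<mu> h \<omega>" h "b \<omega>"]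
          exp_functional_nonneg[OF \<omega>, of h \<mu>] h
        by (simp add: T_def R_def f0_def f1_def f2_def f3_def)
    qed
    have 1: "\<bar>(\<integral>\<omega>. exp (- x / A \<mu> t \<omega>) \<partial>M) - (\<integral>\<omega>. T \<omega> \<partial>M)\<bar> \<le> (\<integral>\<omega>. R \<omega> \<partial>M)"
    proof -
      have "\<bar>(\<integral>\<omega>. exp (- x / A \<mu> t \<omega>) \<partial>M) - (\<integral>\<omega>. T \<omega> \<partial>M)\<bar> =
          \<bar>\<integral>\<omega>. exp (- x / A \<mu> t \<omega>) - T \<omega> \<partial>M\<bar>"
        using iF iT by simp
      also have "\<dots> \<le> (\<integral>\<omega>. \<bar>exp (- x / A \<mu> t \<omega>) - T \<omega>\<bar> \<partial>M)"
        by (rule integral_abs_bound)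
      also have "\<dots> \<le> (\<integral>\<omega>. R \<omega> \<partial>M)"
        using iF iT iR ptw by (intro integral_mono) auto
      finally show ?thesis .
    qed
    have 2: "(\<integral>\<omega>. R \<omega> \<partial>M) \<le> (2 / x * C + 18 / x\<^sup>2 + 20 / x * C + 18 * C) * (h * sqrt h)"
    proof -
      have "2 / x * (\<integral>\<omega>. \<bar>A \<mu> h \<omega> - h\<bar> \<partial>M) \<le> 2 / x * (C * (h * sqrt h))"
        using C3[OF h(1) h1(1)] x by (intro mult_left_mono) auto
      moreover have "18 / x\<^sup>2 * h\<^sup>2 \<le> 18 / x\<^sup>2 * (h * sqrt h)"
        using hs by (intro mult_left_mono) auto
      moreover have "20 / x * (h * (\<integral>\<omega>. \<bar>b \<omega>\<bar> \<partial>M)) \<le> 20 / x * (h * (C * sqrt h))"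
        using C1[OF h(1) h1(1)] x h unfolding b_def by (intro mult_left_mono) auto
      moreover have "18 * (\<integral>\<omega>. \<bar>b \<omega>\<bar> ^ 3 \<partial>M) \<le> 18 * (C * (h * sqrt h))"
        using C2[OF h(1) h1(1)] unfolding b_def by (intro mult_left_mono) auto
      ultimately have "(\<integral>\<omega>. R \<omega> \<partial>M) \<le> 2 / x * (C * (h * sqrt h)) + 18 / x\<^sup>2 * (h * sqrt h) + 20 / x * (h * (C * sqrt h)) + 18 * (C * (h * sqrt h))"
        unfolding ER by linarith
      also have "\<dots> = (2 / x * C + 18 / x\<^sup>2 + 20 / x * C + 18 * C) * (h * sqrt h)"
        by (simp add: algebra_simps)
      finally show ?thesis .
    qed
    have A: "A \<mu> (t - h) \<omega> > 0" if "\<omega> \<in> space M" for \<omega>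
      using exp_functional_pos[OF that h1(3)] .
    let ?A = "A \<mu> (t - h)"
    have im: "integrable M (\<lambda>\<omega>. (1 / ?A \<omega>) ^ k * exp (- (x / ?A \<omega>)))" for k
      using integrable_inv_moment[OF h1(3) x, of \<mu> k] by simp
    have m0: "?E f0 = inv_moment \<mu> 0 (t - h) x"
      by (simp add: inv_moment_def f0_def)
    have m1: "?E f1 = 2 * x * inv_moment \<mu> 1 (t - h) x"
      unfolding inv_moment_def Bochner_Integration.integral_mult_right_zero[symmetric]
      by (intro Bochner_Integration.integral_cong) (simp_all add: f1_def)
    have m2: "?E f2 = 4 * x\<^sup>2 * inv_moment \<mu> 2 (t - h) x - 4 * x * inv_moment \<mu> 1 (t - h) x"
    proof -
      have "f2 a = 4 * x\<^sup>2 * ((1 / a) ^ 2 * exp (- (x / a))) - 4 * x * ((1 / a) ^ 1 * exp (- (x / a)))" for a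
        by (simp add: f2_def power_divide algebra_simps)
      then have "?E f2 = (\<integral>\<omega>. 4 * x\<^sup>2 * ((1 / ?A \<omega>) ^ 2 * exp (- (x / ?A \<omega>))) - 4 * x * ((1 / ?A \<omega>) ^ 1 * exp (- (x / ?A \<omega>))) \<partial>M)"
        by (simp only:)
      also have "\<dots> = 4 * x\<^sup>2 * (\<integral>\<omega>. (1 / ?A \<omega>) ^ 2 * exp (- (x / ?A \<omega>)) \<partial>M) - 4 * x * (\<integral>\<omega>. (1 / ?A \<omega>) ^ 1 * exp (- (x / ?A \<omega>)) \<partial>M)"
        using integrable_mult_right[OF im[of 2]] integrable_mult_right[OF im[of 1]]
        by (subst Bochner_Integration.integral_diff) (simp_all only: Bochner_Integration.integral_mult_right_zero)
      finally show ?thesis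
        by (simp only: inv_moment_def minus_divide_left)
    qed
    have m3: "?E f3 = x * inv_moment \<mu> 2 (t - h) x"
      unfolding inv_moment_def Bochner_Integration.integral_mult_right_zero[symmetric]
      using x by (intro Bochner_Integration.integral_cong) (simp_all add: f3_def power2_eq_square)
    have bf2: "\<bar>?E f2\<bar> \<le> 12"
    proof -
      have "\<bar>?E f2\<bar> \<le> (\<integral>\<omega>. \<bar>f2 (?A \<omega>)\<bar> \<partial>M)" by (rule integral_abs_bound)
      also have "\<dots> \<le> (\<integral>\<omega>. 12 \<partial>M)"
      proof (rule integral_mono)
        have "integrable M (\<lambda>\<omega>. f2 (?A \<omega>))"
          by (rule integrable_const_bound[of _ 12])
             (use b2 A measurable_compose[OF measurable_exp_functional[OF h1(3)] m(3)] in auto)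
        then show "integrable M (\<lambda>\<omega>. \<bar>f2 (?A \<omega>)\<bar>)" by auto
      qed (use b2 A in auto)
      finally show ?thesis by (simp add: prob_space)
    qed
    have 3: "\<bar>\<mu>\<^sup>2 * h\<^sup>2 * ?E f2 / 2\<bar> \<le> 6 * \<mu>\<^sup>2 * (h * sqrt h)"
    proof -
      have "\<bar>\<mu>\<^sup>2 * h\<^sup>2 * ?E f2 / 2\<bar> = \<mu>\<^sup>2 * (h\<^sup>2 * \<bar>?E f2\<bar>) / 2" by (simp add: abs_mult)
      also have "\<dots> \<le> \<mu>\<^sup>2 * ((h * sqrt h) * 12) / 2"
        using hs bf2 by (intro divide_right_mono mult_left_mono mult_mono) auto
      finally show ?thesis by (simp add: mult_ac)
    qed
    let ?L = "(2 * x\<^sup>2 + x) * inv_moment \<mu> 2 (t - h) x - 2 * (1 - \<mu>) * x * inv_moment \<mu> 1 (t - h) x"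
    have 4: "(\<integral>\<omega>. T \<omega> \<partial>M) = inv_moment \<mu> 0 (t - h) x + h * ?L + \<mu>\<^sup>2 * h\<^sup>2 * ?E f2 / 2"
    proof -
      have "(\<integral>\<omega>. T \<omega> \<partial>M) = ?E f0 + h * (\<mu> * ?E f1 + ?E f2 / 2 + ?E f3) + \<mu>\<^sup>2 * h\<^sup>2 * ?E f2 / 2"
        unfolding ET by (simp add: algebra_simps)
      \<comment> \<open>The random rescaling, through \<open>f1\<close> and \<open>f2\<close>,
        contributes \<open>2x^2\<close> and \<open>-2 (1 - \<mu>) x\<close>; the added
        \<open>A_h\<close>, through \<open>f3\<close>, contributes the remaining
        \<open>x\<close>.\<close>
      also have "\<mu> * ?E f1 + ?E f2 / 2 + ?E f3 = ?L"
        unfolding m1 m2 m3 by (simp add: field_simps)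
      finally show ?thesis unfolding m0 .
    qed
    have 5: "(\<integral>\<omega>. exp (- x / A \<mu> t \<omega>) \<partial>M) = inv_moment \<mu> 0 t x"
      by (simp add: inv_moment_def)
    have "K * (h * sqrt h) = (2 / x * C + 18 / x\<^sup>2 + 20 / x * C + 18 * C) * (h * sqrt h) + 6 * \<mu>\<^sup>2 * (h * sqrt h)"
      by (simp add: K_def algebra_simps)
    moreover have "\<bar>p - q - r\<bar> \<le> e1 + e2" if "\<bar>p - (q + r + s)\<bar> \<le> e1" "\<bar>s\<bar> \<le> e2" for p q r s e1 e2 :: real
      using that by linarith
    from this[OF order_trans[OF 1[unfolded 4 5] 2] 3]
    have "\<bar>inv_moment \<mu> 0 t x - inv_moment \<mu> 0 (t - h) x - h * ?L\<bar>
      \<le> (2 / x * C + 18 / x\<^sup>2 + 20 / x * C + 18 * C) * (h * sqrt h) + 6 * \<mu>\<^sup>2 * (h * sqrt h)" .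
    ultimately show "\<bar>inv_moment \<mu> 0 t x - inv_moment \<mu> 0 (t - h) x - h * ?L\<bar> \<le> K * (h * sqrt h)"
      by simp
  qed
qed

text \<open>By the expansion, the backward difference quotient differs from the operator at time
  \<open>t - h\<close> by a multiple of \<open>sqrt h\<close>; continuity of the moments in time
  then moves the operator to \<open>t\<close>.\<close>

lemma inv_moment_left_time_derivative:
  assumes t: "t > 0" and x: "x > 0"
  shows "((\<lambda>t. inv_moment \<mu> 0 t x) has_real_derivative
    (2 * x\<^sup>2 + x) * inv_moment \<mu> 2 t x - 2 * (1 - \<mu>) * x * inv_moment \<mu> 1 t x) (at_left t)"
proof -
  define L where "L s = (2 * x\<^sup>2 + x) * inv_moment \<mu> 2 s x - 2 * (1 - \<mu>) * x * inv_moment \<mu> 1 s x" for s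
  obtain C h0 where h0: "h0 > 0" "h0 \<le> 1" "h0 < t"
    and C: "\<And>h. 0 < h \<Longrightarrow> h < h0 \<Longrightarrow> \<bar>inv_moment \<mu> 0 t x - inv_moment \<mu> 0 (t - h) x - h * L (t - h)\<bar> \<le> C * (h * sqrt h)"
    using inv_moment_short_time_expansion[OF t x, of \<mu>] unfolding L_def by metis
  have "((\<lambda>s. (inv_moment \<mu> 0 s x - inv_moment \<mu> 0 t x) / (s - t)) \<longlongrightarrow> L t) (at_left t)"
    unfolding tendsto_at_iff_sequentially comp_def
  proof (intro allI impI)
    fix X :: "nat \<Rightarrow> real" assume X: "\<forall>i. X i \<in> {..<t} - {t}" "X \<longlonglongrightarrow> t"
    \<comment> \<open>Clipping keeps every step below \<open>h0\<close> and changes only finitely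
      many terms.\<close>
    define X' where "X' i = max (X i) (t - h0 / 2)" for i
    have ev: "eventually (\<lambda>i. X' i = X i) sequentially"
      using order_tendstoD(1)[OF X(2), of "t - h0 / 2"] h0 by (auto elim!: eventually_mono simp: X'_def)
    have X'1: "0 < t - X' i" "t - X' i < h0" "X' i > 0" for i
      using X(1) h0 t by (auto simp: X'_def max_def field_simps not_le) 
    have X'2: "X' \<longlonglongrightarrow> t" using X(2) tendsto_cong[OF ev] by blast
    have LL: "(\<lambda>i. L (X' i)) \<longlonglongrightarrow> L t"
      unfolding L_def by (intro tendsto_intros tendsto_inv_moment X'2 t X'1(3) x)
    have "(\<lambda>i. (inv_moment \<mu> 0 (X' i) x - inv_moment \<mu> 0 t x) / (X' i - t) - L (X' i)) \<longlonglongrightarrow> 0"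
    proof (rule Lim_null_comparison)
      have "norm ((inv_moment \<mu> 0 (X' i) x - inv_moment \<mu> 0 t x) / (X' i - t) - L (X' i)) \<le> C * sqrt (t - X' i)" for i
      proof -
        let ?h = "t - X' i"
        have "(inv_moment \<mu> 0 (X' i) x - inv_moment \<mu> 0 t x) / (X' i - t) - L (X' i) =
            (inv_moment \<mu> 0 t x - inv_moment \<mu> 0 (t - ?h) x - ?h * L (t - ?h)) / ?h"
          using X'1(1)[of i] by (simp add: field_simps)
        moreover have "\<bar>inv_moment \<mu> 0 t x - inv_moment \<mu> 0 (t - ?h) x - ?h * L (t - ?h)\<bar> / ?h \<le> C * (?h * sqrt ?h) / ?h"
          using C[OF X'1(1,2)] X'1(1)[of i] by (intro divide_right_mono) auto
        ultimately show ?thesis using X'1(1)[of i] by simp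
      qed
      then show "\<forall>\<^sub>F i in sequentially. norm ((inv_moment \<mu> 0 (X' i) x - inv_moment \<mu> 0 t x) / (X' i - t) - L (X' i)) \<le> C * sqrt (t - X' i)"
        by simp
      have "(\<lambda>i. C * sqrt (t - X' i)) \<longlonglongrightarrow> C * sqrt (t - t)"
        by (intro tendsto_intros X'2)
      then show "(\<lambda>i. C * sqrt (t - X' i)) \<longlonglongrightarrow> 0" by simp
    qed
    from tendsto_add[OF this LL]
    have "(\<lambda>i. (inv_moment \<mu> 0 (X' i) x - inv_moment \<mu> 0 t x) / (X' i - t)) \<longlonglongrightarrow> L t" by simp
    moreover have "eventually (\<lambda>i. (inv_moment \<mu> 0 (X' i) x - inv_moment \<mu> 0 t x) / (X' i - t) =
        (inv_moment \<mu> 0 (X i) x - inv_moment \<mu> 0 t x) / (X i - t)) sequentially"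
      using ev by eventually_elim simp
    ultimately show "(\<lambda>i. (inv_moment \<mu> 0 (X i) x - inv_moment \<mu> 0 t x) / (X i - t)) \<longlonglongrightarrow> L t"
      by (rule Lim_transform_eventually)
  qed
  then show ?thesis
    by (simp add: has_field_derivative_iff L_def)
qed

lemma inv_moment_0_zero: "t > 0 \<Longrightarrow> inv_moment \<mu> 0 t 0 = 1"
  by (simp add: inv_moment_def prob_space)

lemma integrable_inv_moment_0:
  assumes "t > 0" "x \<ge> 0"
  shows "integrable M (\<lambda>\<omega>. exp (- x / A \<mu> t \<omega>))"
  by (rule integrable_const_bound[of _ 1])
     (use assms exp_functional_pos measurable_inv_moment[of t \<mu> 0 x] in \<open>auto simp: less_imp_le\<close>)

lemma inv_moment_0_nonneg: "inv_moment \<mu> 0 t x \<ge> 0"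
  unfolding inv_moment_def by (intro Bochner_Integration.integral_nonneg) simp

text \<open>\<open>A\<close> increases with time, so \<open>x / A\<close> is monotone in both
  variables. One value of the transform thereby controls a whole range of times and positions near
  each edge.\<close>

lemma inv_moment_0_mono:
  assumes "0 < s" "s \<le> t" "0 \<le> x" "x \<le> y"
  shows "inv_moment \<mu> 0 s y \<le> inv_moment \<mu> 0 t x"
  unfolding inv_moment_def power_0 mult_1
proof (rule integral_mono)
  fix \<omega> assume "\<omega> \<in> space M"
  then have "A \<mu> s \<omega> > 0" "A \<mu> s \<omega> \<le> A \<mu> t \<omega>"
    using exp_functional_pos exp_functional_mono assms by (auto simp: less_imp_le)
  then have "x / A \<mu> t \<omega> \<le> y / A \<mu> s \<omega>"
    using assms by (intro frac_le) auto
  then show "exp (- y / A \<mu> s \<omega>) \<le> exp (- x / A \<mu> t \<omega>)"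
    by simp
qed (use assms in \<open>auto intro!: integrable_inv_moment_0[simplified]\<close>)

lemma inv_moment_0_le_1:
  assumes "t > 0" "x \<ge> 0"
  shows "inv_moment \<mu> 0 t x \<le> 1"
  using inv_moment_0_mono[of t t 0 x \<mu>] assms by (simp add: inv_moment_0_zero)

text \<open>On each path \<open>A_t\<close> tends to 0 with \<open>t\<close>, so
  \<open>x / A_t\<close> explodes. One sequence of times is enough, since
  \<open>inv_moment_0_mono\<close> fills in the times between.\<close>

lemma inv_moment_0_initial:
  assumes x: "x > 0"
  shows "(\<lambda>n. inv_moment \<mu> 0 (1 / real (Suc n)) x) \<longlonglongrightarrow> 0"
proof -
  have "(\<lambda>n. inv_moment \<mu> 0 (1 / real (Suc n)) x) \<longlonglongrightarrow> (\<integral>\<omega>. 0 \<partial>M)"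
    unfolding inv_moment_def power_0 mult_1
  proof (rule integral_dominated_convergence[where w = "\<lambda>_. 1"])
    show "AE \<omega> in M. (\<lambda>n. exp (- x / A \<mu> (1 / real (Suc n)) \<omega>)) \<longlonglongrightarrow> 0"
    proof (rule AE_I2)
      fix \<omega> assume \<omega>: "\<omega> \<in> space M"
      have "(\<lambda>n. A \<mu> (1 / real (Suc n)) \<omega>) \<longlonglongrightarrow> A \<mu> 0 \<omega>"
        by (intro tendsto_exp_functional \<omega> LIMSEQ_Suc lim_1_over_n) auto
      then have "filterlim (\<lambda>n. A \<mu> (1 / real (Suc n)) \<omega>) (at_right 0) sequentially"
        using exp_functional_pos[OF \<omega>, of "1 / real (Suc _)" \<mu>]
        by (auto simp: filterlim_at exp_functional_0 intro!: always_eventually less_imp_neq[symmetric])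
      then have "filterlim (\<lambda>n. inverse (A \<mu> (1 / real (Suc n)) \<omega>)) at_top sequentially"
        by (rule filterlim_compose[OF filterlim_inverse_at_top_right])
      then have "filterlim (\<lambda>n. x * inverse (A \<mu> (1 / real (Suc n)) \<omega>)) at_top sequentially"
        by (rule filterlim_tendsto_pos_mult_at_top[OF tendsto_const x])
      then have "filterlim (\<lambda>n. - (x * inverse (A \<mu> (1 / real (Suc n)) \<omega>))) at_bot sequentially"
        by (simp add: filterlim_uminus_at_bot)
      from filterlim_compose[OF exp_at_bot this]
      show "(\<lambda>n. exp (- x / A \<mu> (1 / real (Suc n)) \<omega>)) \<longlonglongrightarrow> 0"
        by (simp add: divide_inverse)
    qed
    show "AE \<omega> in M. norm (exp (- x / A \<mu> (1 / real (Suc n)) \<omega>)) \<le> 1" for n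
      using x exp_functional_pos[of _ "1 / real (Suc n)" \<mu>] by (intro AE_I2) (simp add: less_imp_le)
    show "(\<lambda>\<omega>. exp (- x / A \<mu> (1 / real (Suc n)) \<omega>)) \<in> borel_measurable M" for n
      using measurable_inv_moment[of "1 / real (Suc n)" \<mu> 0 x] by simp
  qed simp_all
  then show ?thesis by simp
qed

end

section \<open>The kernel in the hyperbolic variable\<close>

lemma sinh_ge_self:
  assumes "x \<ge> (0::real)" shows "x \<le> sinh x"
proof -
  have "sinh 0 - 0 \<le> sinh x - x"
    by (rule DERIV_nonneg_imp_nondecreasing[OF assms, of "\<lambda>x. sinh x - x"])
       (auto intro!: exI derivative_eq_intros simp: cosh_real_ge_1)
  then show ?thesis by simp
qed

lemma sinh_arcosh: "c \<ge> 1 \<Longrightarrow> sinh (arcosh c) = sqrt (c\<^sup>2 - 1)" for c :: real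
proof -
  assume c: "c \<ge> 1"
  have "sinh (arcosh c) = sqrt ((sinh (arcosh c))\<^sup>2)" using c by simp
  also have "(sinh (arcosh c))\<^sup>2 = c\<^sup>2 - 1" using c by (simp add: sinh_square_eq)
  finally show ?thesis .
qed

lemma arcosh_le_sqrt: "c \<ge> 1 \<Longrightarrow> arcosh c \<le> sqrt (c\<^sup>2 - 1)" for c :: real
  using sinh_ge_self[of "arcosh c"] by (simp add: sinh_arcosh)

lemma arcosh_le_self: "c \<ge> 1 \<Longrightarrow> arcosh c \<le> c" for c :: real
  using sinh_ge_self[of "arcosh c"] sinh_le_cosh_real[of "arcosh c"] by simp

lemma arcosh_mono: "1 \<le> c \<Longrightarrow> c \<le> d \<Longrightarrow> arcosh c \<le> arcosh d" for c d :: real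
  using arcosh_real_strict_mono[of c d] by (auto simp: order_le_less)

definition cosh_phi :: "real \<Rightarrow> real \<Rightarrow> real" where
  "cosh_phi x y = x * exp (- y) + cosh y"

lemma cosh_phi_ge: "x \<ge> 0 \<Longrightarrow> cosh_phi x y \<ge> cosh y" "x \<ge> 0 \<Longrightarrow> cosh_phi x y \<ge> 1"
  using cosh_real_ge_1[of y] by (auto simp: cosh_phi_def add_increasing)

lemma cosh_phi_gt_1: "x > 0 \<Longrightarrow> cosh_phi x y > 1"
proof -
  assume "x > 0"
  then have "x * exp (- y) > 0" by simp
  then show ?thesis unfolding cosh_phi_def using cosh_real_ge_1[of y] by linarith
qed

lemma cosh_phi_square:
  "(cosh_phi x y)\<^sup>2 - 1 = x\<^sup>2 * exp (- 2 * y) + (sinh y)\<^sup>2 + 2 * x * exp (- y) * cosh y"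
proof -
  have "exp (- 2 * y) = (exp (- y))\<^sup>2"
    by (simp add: exp_double[symmetric])
  then show ?thesis
    by (simp add: cosh_phi_def sinh_square_eq power2_sum power_mult_distrib)
qed

lemma phi_fun_eq: "x \<ge> 0 \<Longrightarrow> phi_fun x y = arcosh (cosh_phi x y)"
  using cosh_phi_ge(2)[of x y] cosh_phi_square[of x y]
  by (simp add: phi_fun_def arcosh_real_def) (simp add: cosh_phi_def)

text \<open>Since \<open>cosh_phi x y \<ge> cosh y\<close>. Hence the part
  \<open>y^2 - phi^2\<close> of the exponent in \<open>G\<close> is nonpositive, and the kernel
  decays in \<open>y\<close> at least like a Gaussian.\<close>

lemma phi_ge_abs: "x \<ge> 0 \<Longrightarrow> \<bar>y\<bar> \<le> arcosh (cosh_phi x y)"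
proof -
  assume x: "x \<ge> 0"
  have "arcosh (cosh \<bar>y\<bar>) \<le> arcosh (cosh_phi x y)"
    using cosh_phi_ge(1)[OF x, of y] by (intro arcosh_mono) (auto simp: cosh_real_ge_1)
  moreover have "arcosh (cosh \<bar>y\<bar>) = \<bar>y\<bar>" by (rule arcosh_cosh_real) simp
  ultimately show ?thesis by (simp only:)
qed

lemma cosh_phi_le: "x \<ge> 0 \<Longrightarrow> cosh_phi x y \<le> (1 + x) * exp \<bar>y\<bar>"
proof -
  assume x: "x \<ge> 0"
  have "cosh y \<le> exp \<bar>y\<bar>"
  proof -
    have "exp y + exp (- y) \<le> exp \<bar>y\<bar> + exp \<bar>y\<bar>" by (intro add_mono) auto
    then show ?thesis by (simp add: cosh_field_def)
  qed
  moreover have "x * exp (- y) \<le> x * exp \<bar>y\<bar>" using x by (intro mult_left_mono) auto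
  ultimately show ?thesis by (simp add: cosh_phi_def algebra_simps)
qed

text \<open>The mixed term of the square equals \<open>x + x exp(-2y)\<close>. The bound is uniform
  in \<open>y\<close> and keeps the denominators \<open>c^2 - 1\<close> of \<open>heat2\<close> away
  from zero.\<close>

lemma cosh_phi_square_ge: "x \<ge> 0 \<Longrightarrow> (cosh_phi x y)\<^sup>2 - 1 \<ge> x"
proof -
  assume x: "x \<ge> 0"
  have "exp (- y) * exp y = 1" by (simp add: exp_minus)
  then have "2 * x * exp (- y) * cosh y = x + x * (exp (- y))\<^sup>2"
    by (simp add: cosh_def power2_eq_square algebra_simps)
  moreover have "x * (exp (- y))\<^sup>2 \<ge> 0" using x by simp
  moreover have "x\<^sup>2 * exp (- 2 * y) \<ge> 0" by simp
  ultimately show ?thesis unfolding cosh_phi_square using zero_le_power2[of "sinh y"] by linarith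
qed

text \<open>The heat kernel in \<open>\<phi>\<close>, without its factor \<open>(2\<pi>t)\<^sup>-\<^sup>1\<^sup>/\<^sup>2\<close>, as a function of \<open>c = cosh \<phi>\<close>.\<close>

definition heat0 :: "real \<Rightarrow> real \<Rightarrow> real" where
  "heat0 t c = exp (- (arcosh c)\<^sup>2 / (2 * t))"

definition heat1 :: "real \<Rightarrow> real \<Rightarrow> real" where
  "heat1 t c = - (arcosh c / (t * sqrt (c\<^sup>2 - 1))) * heat0 t c"

definition heat2 :: "real \<Rightarrow> real \<Rightarrow> real" where
  "heat2 t c = ((arcosh c)\<^sup>2 / (t\<^sup>2 * (c\<^sup>2 - 1)) -
     (1 - arcosh c * c / sqrt (c\<^sup>2 - 1)) / (t * (c\<^sup>2 - 1))) * heat0 t c"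

lemma heat0_derivative:
  assumes "t > 0" "c > 1"
  shows "(heat0 t has_real_derivative heat1 t c) (at c)"
proof -
  have "c\<^sup>2 - 1 > 0" using assms by (simp add: one_less_power)
  then show ?thesis
    unfolding heat0_def[abs_def] heat1_def using assms
    by (auto intro!: derivative_eq_intros simp: heat0_def field_simps)
qed

lemma heat1_derivative:
  assumes "t > 0" "c > 1"
  shows "(heat1 t has_real_derivative heat2 t c) (at c)"
proof -
  have c: "c\<^sup>2 - 1 > 0" using assms by (simp add: one_less_power)
  define s where "s = sqrt (c\<^sup>2 - 1)"
  have s: "s > 0" "s * s = c\<^sup>2 - 1" using c by (simp_all add: s_def)
  have ds: "((\<lambda>c. sqrt (c\<^sup>2 - 1)) has_real_derivative c / s) (at c)"
    using c by (auto intro!: derivative_eq_intros simp: s_def field_simps)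
  have da: "(arcosh has_real_derivative 1 / s) (at c)"
    using assms by (auto intro!: derivative_eq_intros simp: s_def)
  have "((\<lambda>c. arcosh c / (t * sqrt (c\<^sup>2 - 1))) has_real_derivative
      (1 / s * (t * s) - arcosh c * (t * (c / s))) / ((t * s) * (t * s))) (at c)"
    using DERIV_divide[OF da DERIV_cmult[OF ds, of t]] s assms by (simp add: s_def[symmetric])
  from DERIV_mult[OF DERIV_minus[OF this] heat0_derivative[OF assms]]
  have "(heat1 t has_real_derivative
      - ((1 / s * (t * s) - arcosh c * (t * (c / s))) / ((t * s) * (t * s))) * heat0 t c +
       heat1 t c * - (arcosh c / (t * s))) (at c)"
    by (simp add: heat1_def[abs_def] s_def[symmetric])
  moreover have "- ((1 / s * (t * s) - arcosh c * (t * (c / s))) / ((t * s) * (t * s))) * heat0 t c +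
       heat1 t c * - (arcosh c / (t * s)) = heat2 t c"
  proof -
    have "(1 / s * (t * s) - arcosh c * (t * (c / s))) / ((t * s) * (t * s)) =
       (1 - arcosh c * c / s) / (t * (s * s))"
      using s assms by (simp add: field_simps)
    moreover have "arcosh c / (t * s) * (arcosh c / (t * s)) = (arcosh c)\<^sup>2 / (t\<^sup>2 * (s * s))"
      by (simp add: power2_eq_square)
    moreover have "heat2 t c = ((arcosh c)\<^sup>2 / (t\<^sup>2 * (s * s)) - (1 - arcosh c * c / s) / (t * (s * s))) * heat0 t c"
      unfolding heat2_def s_def[symmetric] s(2) ..
    moreover have "heat1 t c = - (arcosh c / (t * s)) * heat0 t c"
      unfolding heat1_def s_def[symmetric] ..
    moreover have "- u * w + - v * w * - v = (v * v - u) * w" for u v w :: real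
      by (simp add: algebra_simps)
    ultimately show ?thesis by (simp only:)
  qed
  ultimately show ?thesis by simp
qed

text \<open>Under \<open>c = cosh phi\<close> the operator
  \<open>(c^2 - 1) d^2/dc^2 + c d/dc\<close> is the second derivative in \<open>phi\<close>. The
  factor on the right is twice the logarithmic time derivative of
  \<open>t^(-1/2) exp(-phi^2 / 2t)\<close>.\<close>

lemma heat_equation:
  assumes "t > 0" "c > 1"
  shows "(c\<^sup>2 - 1) * heat2 t c + c * heat1 t c = ((arcosh c)\<^sup>2 / t\<^sup>2 - 1 / t) * heat0 t c"
proof -
  have c: "c\<^sup>2 - 1 > 0" using assms by (simp add: one_less_power)
  have "(c\<^sup>2 - 1) * ((arcosh c)\<^sup>2 / (t\<^sup>2 * (c\<^sup>2 - 1)) - (1 - arcosh c * c / sqrt (c\<^sup>2 - 1)) / (t * (c\<^sup>2 - 1))) =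
      (arcosh c)\<^sup>2 / t\<^sup>2 - (1 - arcosh c * c / sqrt (c\<^sup>2 - 1)) / t"
  proof -
    have "d * (p / (q * d) - r / (u * d)) = p / q - r / u" if "d > 0" for d p q r u :: real
      using that by (simp add: right_diff_distrib)
    from this[OF c] show ?thesis .
  qed
  moreover have "(1 - arcosh c * c / sqrt (c\<^sup>2 - 1)) / t = 1 / t - c * (arcosh c / (t * sqrt (c\<^sup>2 - 1)))"
    by (simp add: diff_divide_distrib mult_ac)
  ultimately have "(c\<^sup>2 - 1) * ((arcosh c)\<^sup>2 / (t\<^sup>2 * (c\<^sup>2 - 1)) - (1 - arcosh c * c / sqrt (c\<^sup>2 - 1)) / (t * (c\<^sup>2 - 1)))
      + c * - (arcosh c / (t * sqrt (c\<^sup>2 - 1))) = (arcosh c)\<^sup>2 / t\<^sup>2 - 1 / t"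
    by simp
  from arg_cong[OF this, of "\<lambda>u. u * heat0 t c"]
  show ?thesis
    unfolding heat1_def heat2_def by (simp only: distrib_right mult.assoc)
qed

lemma heat0_pos: "heat0 t c > 0"
  by (simp add: heat0_def)

text \<open>The inequality \<open>phi \<le> sinh phi\<close>, in the form
  \<open>arcosh c \<le> sqrt (c^2 - 1)\<close>, cancels the singularity at
  \<open>c = 1\<close>.\<close>

lemma heat1_bound:
  assumes "t > 0" "c > 1"
  shows "\<bar>heat1 t c\<bar> \<le> heat0 t c / t"
proof -
  have c: "sqrt (c\<^sup>2 - 1) > 0" using assms by (simp add: one_less_power)
  have "arcosh c / (t * sqrt (c\<^sup>2 - 1)) \<le> 1 / t"
    using c arcosh_le_sqrt[of c] assms by (simp add: field_simps)
  then have "arcosh c / (t * sqrt (c\<^sup>2 - 1)) * heat0 t c \<le> 1 / t * heat0 t c"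
    using heat0_pos[of t c] by (intro mult_right_mono) auto
  then show ?thesis
    using assms c heat0_pos[of t c] by (simp add: heat1_def abs_mult)
qed

text \<open>In the first summand of \<open>heat2\<close> the singularity cancels as in
  \<open>heat1_bound\<close>. In the second the numerator is crudely at most \<open>1 + c\<close>,
  and the denominator \<open>c^2 - 1\<close> is bounded below by \<open>x\<close>.\<close>

lemma heat2_bound:
  assumes "t > 0" "c > 1" "c\<^sup>2 - 1 \<ge> x" "x > 0"
  shows "\<bar>heat2 t c\<bar> \<le> (1 / t\<^sup>2 + (1 + c) / (t * x)) * heat0 t c"
proof -
  define s where "s = sqrt (c\<^sup>2 - 1)"
  have s: "s > 0" "s\<^sup>2 = c\<^sup>2 - 1" using assms by (simp_all add: s_def)
  have a: "0 \<le> arcosh c" "arcosh c \<le> s"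
    using arcosh_le_sqrt[of c] assms by (auto simp: s_def)
  have "(arcosh c)\<^sup>2 \<le> s\<^sup>2" using a by (intro power_mono) auto
  then have "(arcosh c)\<^sup>2 / s\<^sup>2 / t\<^sup>2 \<le> 1 / t\<^sup>2"
    using s(1) by (intro divide_right_mono) auto
  then have 1: "0 \<le> (arcosh c)\<^sup>2 / (t\<^sup>2 * s\<^sup>2)" "(arcosh c)\<^sup>2 / (t\<^sup>2 * s\<^sup>2) \<le> 1 / t\<^sup>2"
    by (auto simp: mult.commute)
  have "0 \<le> arcosh c / s" "arcosh c / s \<le> 1" using a s by auto
  then have "0 \<le> arcosh c / s * c" "arcosh c / s * c \<le> 1 * c"
    using assms(2) mult_nonneg_nonneg[of "arcosh c / s" c] mult_right_mono[of "arcosh c / s" 1 c] by simp_all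
  then have "\<bar>1 - arcosh c * c / s\<bar> \<le> 1 + c" using assms by simp
  moreover have "t * x \<le> t * s\<^sup>2" using s assms by simp
  ultimately have "\<bar>1 - arcosh c * c / s\<bar> / (t * s\<^sup>2) \<le> (1 + c) / (t * x)"
    using assms by (intro frac_le) auto
  then have 2: "\<bar>(1 - arcosh c * c / s) / (t * s\<^sup>2)\<bar> \<le> (1 + c) / (t * x)"
    using assms by (simp add: abs_mult)
  have "\<bar>(arcosh c)\<^sup>2 / (t\<^sup>2 * s\<^sup>2) - (1 - arcosh c * c / s) / (t * s\<^sup>2)\<bar> \<le> 1 / t\<^sup>2 + (1 + c) / (t * x)"
    using order_trans[OF abs_triangle_ineq4 add_mono[OF eq_refl[OF abs_of_nonneg[OF 1(1)], THEN order_trans, OF 1(2)] 2]] .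
  then have "\<bar>(arcosh c)\<^sup>2 / (t\<^sup>2 * s\<^sup>2) - (1 - arcosh c * c / s) / (t * s\<^sup>2)\<bar> * heat0 t c \<le> (1 / t\<^sup>2 + (1 + c) / (t * x)) * heat0 t c"
    using heat0_pos[of t c] by (intro mult_right_mono) auto
  moreover have "heat2 t c = ((arcosh c)\<^sup>2 / (t\<^sup>2 * s\<^sup>2) - (1 - arcosh c * c / s) / (t * s\<^sup>2)) * heat0 t c"
    unfolding heat2_def s_def[symmetric] s(2) ..
  ultimately show ?thesis
    using heat0_pos[of t c] by (simp add: abs_mult)
qed

lemma heat0_time_derivative:
  assumes "t > 0"
  shows "((\<lambda>t. heat0 t c) has_real_derivative (arcosh c)\<^sup>2 / (2 * t\<^sup>2) * heat0 t c) (at t)"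
  unfolding heat0_def using assms
  by (auto intro!: derivative_eq_intros simp: power2_eq_square)

text \<open>From \<open>|y| \<le> phi\<close>. The separate \<open>s\<close> gives all times up to
  \<open>s\<close> one common Gaussian majorant.\<close>

lemma heat0_phi_le:
  assumes "t > 0" "t \<le> s" "x \<ge> 0"
  shows "heat0 t (cosh_phi x y) \<le> exp (- y\<^sup>2 / (2 * s))"
proof -
  have "y\<^sup>2 \<le> (arcosh (cosh_phi x y))\<^sup>2"
    using phi_ge_abs[OF assms(3), of y] power_mono[of "\<bar>y\<bar>" "arcosh (cosh_phi x y)" 2] by simp
  then have "y\<^sup>2 / (2 * s) \<le> (arcosh (cosh_phi x y))\<^sup>2 / (2 * t)"
    using assms by (intro frac_le) auto
  then show ?thesis by (simp add: heat0_def)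
qed

section \<open>The kernel, its derivatives and their Gaussian majorants\<close>

abbreviation gauss_tail :: "real \<Rightarrow> real \<Rightarrow> real \<Rightarrow> real" where
  "gauss_tail m s y \<equiv> exp (m * \<bar>y\<bar>) * exp (- y\<^sup>2 / (2 * s))"

text \<open>The Cameron-Martin factor for the drift, together with the normalisation that
  \<open>heat0\<close> omits.\<close>

abbreviation drift_weight :: "real \<Rightarrow> real \<Rightarrow> real \<Rightarrow> real" where
  "drift_weight \<mu> t y \<equiv> exp (\<mu> * y - \<mu>\<^sup>2 * t / 2) / sqrt (2 * pi * t)"

text \<open>In hindsight, \<open>hyp_kernel \<mu> t x\<close> is the density of \<open>E[exp(-x/A\<^sub>t); B\<^sub>t + \<mu>t \<in> dy]\<close>.\<close>

definition hyp_kernel :: "real \<Rightarrow> real \<Rightarrow> real \<Rightarrow> real \<Rightarrow> real" where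
  "hyp_kernel \<mu> t x y = drift_weight \<mu> t y * heat0 t (cosh_phi x y)"

definition hyp_transform :: "real \<Rightarrow> real \<Rightarrow> real \<Rightarrow> real" where
  "hyp_transform \<mu> t x = (\<integral>y. hyp_kernel \<mu> t x y \<partial>lborel)"

definition hyp_kernel_x :: "real \<Rightarrow> real \<Rightarrow> real \<Rightarrow> real \<Rightarrow> real" where
  "hyp_kernel_x \<mu> t x y = drift_weight \<mu> t y * (heat1 t (cosh_phi x y) * exp (- y))"

definition hyp_kernel_xx :: "real \<Rightarrow> real \<Rightarrow> real \<Rightarrow> real \<Rightarrow> real" where
  "hyp_kernel_xx \<mu> t x y = drift_weight \<mu> t y * (heat2 t (cosh_phi x y) * (exp (- y))\<^sup>2)"

definition hyp_kernel_t :: "real \<Rightarrow> real \<Rightarrow> real \<Rightarrow> real \<Rightarrow> real" where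
  "hyp_kernel_t \<mu> t x y = ((arcosh (cosh_phi x y))\<^sup>2 / (2 * t\<^sup>2) - 1 / (2 * t) - \<mu>\<^sup>2 / 2) * hyp_kernel \<mu> t x y"

lemma measurable_arcosh: "(arcosh :: real \<Rightarrow> real) \<in> borel_measurable borel"
  unfolding arcosh_def[abs_def] by measurable

lemma measurable_hyp [measurable]:
  "hyp_kernel \<mu> t x \<in> borel_measurable borel" "hyp_kernel_x \<mu> t x \<in> borel_measurable borel"
  "hyp_kernel_xx \<mu> t x \<in> borel_measurable borel" "hyp_kernel_t \<mu> t x \<in> borel_measurable borel"
proof -
  note measurable_arcosh[measurable]
  have cm[measurable]: "cosh_phi x \<in> borel_measurable borel"
    unfolding cosh_phi_def cosh_field_def by measurable
  show "hyp_kernel \<mu> t x \<in> borel_measurable borel" "hyp_kernel_x \<mu> t x \<in> borel_measurable borel"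
    "hyp_kernel_xx \<mu> t x \<in> borel_measurable borel" "hyp_kernel_t \<mu> t x \<in> borel_measurable borel"
    unfolding hyp_kernel_def hyp_kernel_x_def hyp_kernel_xx_def hyp_kernel_t_def heat0_def heat1_def heat2_def
    by measurable
qed

lemma weight_bound: "drift_weight \<mu> t y \<le> exp (\<bar>\<mu>\<bar> * \<bar>y\<bar>) / sqrt (2 * pi * t)"
  if "t > 0" for \<mu> t y :: real
proof -
  have "\<mu> * y \<le> \<bar>\<mu>\<bar> * \<bar>y\<bar>" unfolding abs_mult[symmetric] by (rule abs_ge_self)
  moreover have "\<mu>\<^sup>2 * t / 2 \<ge> 0" using that by simp
  ultimately have "\<mu> * y - \<mu>\<^sup>2 * t / 2 \<le> \<bar>\<mu>\<bar> * \<bar>y\<bar>" by linarith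
  then show ?thesis using that by (intro divide_right_mono) auto
qed

text \<open>The common shape of all bounds on the kernel and its derivatives: powers of
  \<open>exp |y|\<close> are harmless against the Gaussian decay of \<open>heat0\<close>.\<close>

lemma weighted_bound:
  assumes t: "t > 0" "t \<le> s" and x: "x \<ge> 0" and k: "\<bar>F\<bar> \<le> K * exp (k * \<bar>y\<bar>) * heat0 t (cosh_phi x y)" and K: "K \<ge> 0"
  shows "\<bar>drift_weight \<mu> t y * F\<bar> \<le>
     K / sqrt (2 * pi * t) * gauss_tail (\<bar>\<mu>\<bar> + k) s y"
proof -
  have "\<bar>drift_weight \<mu> t y * F\<bar> = drift_weight \<mu> t y * \<bar>F\<bar>"
    using t by (simp add: abs_mult)
  also have "\<dots> \<le> exp (\<bar>\<mu>\<bar> * \<bar>y\<bar>) / sqrt (2 * pi * t) * (K * exp (k * \<bar>y\<bar>) * exp (- y\<^sup>2 / (2 * s)))"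
  proof (intro mult_mono weight_bound t)
    have "K * exp (k * \<bar>y\<bar>) * heat0 t (cosh_phi x y) \<le> K * exp (k * \<bar>y\<bar>) * exp (- y\<^sup>2 / (2 * s))"
      using K heat0_phi_le[OF t x] by (intro mult_left_mono) auto
    with k show "\<bar>F\<bar> \<le> K * exp (k * \<bar>y\<bar>) * exp (- y\<^sup>2 / (2 * s))" by linarith
  qed (use t in auto)
  also have "\<dots> = K / sqrt (2 * pi * t) * (exp (\<bar>\<mu>\<bar> * \<bar>y\<bar>) * exp (k * \<bar>y\<bar>) * exp (- y\<^sup>2 / (2 * s)))"
    by simp
  also have "exp (\<bar>\<mu>\<bar> * \<bar>y\<bar>) * exp (k * \<bar>y\<bar>) = exp ((\<bar>\<mu>\<bar> + k) * \<bar>y\<bar>)"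
    by (simp add: exp_add[symmetric] distrib_right)
  finally show ?thesis .
qed

lemma hyp_kernel_bound:
  assumes "t > 0" "t \<le> s" "x \<ge> 0"
  shows "\<bar>hyp_kernel \<mu> t x y\<bar> \<le> 1 / sqrt (2 * pi * t) * gauss_tail (\<bar>\<mu>\<bar> + 0) s y"
  unfolding hyp_kernel_def by (rule weighted_bound) (use assms heat0_pos in \<open>auto simp: less_imp_le\<close>)

lemma hyp_kernel_x_bound:
  assumes "t > 0" "t \<le> s" "x > 0"
  shows "\<bar>hyp_kernel_x \<mu> t x y\<bar> \<le> (1 / t) / sqrt (2 * pi * t) * gauss_tail (\<bar>\<mu>\<bar> + 1) s y"
  unfolding hyp_kernel_x_def
proof (rule weighted_bound)
  have "\<bar>heat1 t (cosh_phi x y) * exp (- y)\<bar> = \<bar>heat1 t (cosh_phi x y)\<bar> * exp (- y)"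
    by (simp add: abs_mult)
  also have "\<dots> \<le> heat0 t (cosh_phi x y) / t * exp (1 * \<bar>y\<bar>)"
    using assms heat0_pos[of t "cosh_phi x y"] by (intro mult_mono heat1_bound cosh_phi_gt_1) auto
  finally show "\<bar>heat1 t (cosh_phi x y) * exp (- y)\<bar> \<le> (1 / t) * exp (1 * \<bar>y\<bar>) * heat0 t (cosh_phi x y)"
    by (simp add: mult_ac)
qed (use assms in auto)

lemma hyp_kernel_xx_bound:
  assumes "t > 0" "t \<le> s" "x > 0" "x0 > 0" "x0 \<le> x" "x \<le> x1"
  shows "\<bar>hyp_kernel_xx \<mu> t x y\<bar> \<le>
    (1 / t\<^sup>2 + (2 + x1) / (t * x0)) / sqrt (2 * pi * t) * gauss_tail (\<bar>\<mu>\<bar> + 3) s y"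
  unfolding hyp_kernel_xx_def
proof (rule weighted_bound)
  let ?c = "cosh_phi x y"
  have c: "?c > 1" "?c\<^sup>2 - 1 \<ge> x" using assms cosh_phi_gt_1 cosh_phi_square_ge[of x y] by auto
  have e: "(exp (- y))\<^sup>2 \<le> exp (2 * \<bar>y\<bar>)" "1 \<le> exp \<bar>y\<bar>"
    by (auto simp: exp_double[symmetric])
  \<comment> \<open>Here \<open>c\<close> costs one factor \<open>exp |y|\<close>, and the squared
    \<open>exp(-y)\<close> costs two more; hence the 3 in the tail.\<close>
  have "1 + ?c \<le> (2 + x1) * exp \<bar>y\<bar>"
  proof -
    have "(1 + x) * exp \<bar>y\<bar> \<le> (1 + x1) * exp \<bar>y\<bar>" using assms by (intro mult_right_mono) auto
    then have "1 + ?c \<le> 1 * exp \<bar>y\<bar> + (1 + x1) * exp \<bar>y\<bar>"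
      using cosh_phi_le[of x y] assms e(2) by linarith
    then show ?thesis by (simp add: algebra_simps)
  qed
  then have r: "(1 + ?c) / (t * x) \<le> (2 + x1) * exp \<bar>y\<bar> / (t * x0)"
    using assms c by (intro frac_le mult_left_mono) auto
  have "1 / t\<^sup>2 * 1 \<le> 1 / t\<^sup>2 * exp \<bar>y\<bar>" by (intro mult_left_mono e) simp
  with r have r2: "1 / t\<^sup>2 + (1 + ?c) / (t * x) \<le> (1 / t\<^sup>2 + (2 + x1) / (t * x0)) * exp \<bar>y\<bar>"
    by (simp add: distrib_right)
  have "\<bar>heat2 t ?c * (exp (- y))\<^sup>2\<bar> = \<bar>heat2 t ?c\<bar> * (exp (- y))\<^sup>2"
    by (simp add: abs_mult)
  also have "\<dots> \<le> ((1 / t\<^sup>2 + (1 + ?c) / (t * x)) * heat0 t ?c) * exp (2 * \<bar>y\<bar>)"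
    using assms c e heat0_pos[of t ?c]
    by (intro mult_mono heat2_bound) (auto intro!: mult_nonneg_nonneg add_nonneg_nonneg divide_nonneg_nonneg)
  also have "\<dots> \<le> (((1 / t\<^sup>2 + (2 + x1) / (t * x0)) * exp \<bar>y\<bar>) * heat0 t ?c) * exp (2 * \<bar>y\<bar>)"
    using r2 heat0_pos[of t ?c] by (intro mult_right_mono) auto
  also have "\<dots> = (1 / t\<^sup>2 + (2 + x1) / (t * x0)) * (exp \<bar>y\<bar> * exp (2 * \<bar>y\<bar>)) * heat0 t ?c"
    by (simp only: mult_ac)
  also have "exp \<bar>y\<bar> * exp (2 * \<bar>y\<bar>) = exp (3 * \<bar>y\<bar>)" by (simp add: exp_add[symmetric])
  finally show "\<bar>heat2 t ?c * (exp (- y))\<^sup>2\<bar> \<le> (1 / t\<^sup>2 + (2 + x1) / (t * x0)) * exp (3 * \<bar>y\<bar>) * heat0 t ?c" .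
qed (use assms in auto)

lemma hyp_kernel_t_bound:
  assumes "t > 0" "t \<le> s" "x \<ge> 0" "t0 > 0" "t0 \<le> t"
  shows "\<bar>hyp_kernel_t \<mu> t x y\<bar> \<le>
    ((1 + x)\<^sup>2 / (2 * t0\<^sup>2) + 1 / (2 * t0) + \<mu>\<^sup>2 / 2) / sqrt (2 * pi * t0) * gauss_tail (\<bar>\<mu>\<bar> + 2) s y"
proof -
  let ?c = "cosh_phi x y" and ?K = "(1 + x)\<^sup>2 / (2 * t0\<^sup>2) + 1 / (2 * t0) + \<mu>\<^sup>2 / 2"
  let ?e = "exp (2 * \<bar>y\<bar>)"
  have c: "?c \<ge> 1" using cosh_phi_ge(2)[of x y] assms by simp
  \<comment> \<open>Even the coarse \<open>phi \<le> cosh phi\<close> is enough: it costs a factor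
    \<open>exp (2 |y|)\<close>, which the Gaussian absorbs.\<close>
  have "(arcosh ?c)\<^sup>2 \<le> ((1 + x) * exp \<bar>y\<bar>)\<^sup>2"
    using arcosh_le_self[OF c] cosh_phi_le[of x y] assms c by (intro power_mono) auto
  also have "\<dots> = (1 + x)\<^sup>2 * ?e" by (simp add: power_mult_distrib exp_double[symmetric])
  finally have "(arcosh ?c)\<^sup>2 / (2 * t\<^sup>2) \<le> ((1 + x)\<^sup>2 * ?e) / (2 * t0\<^sup>2)"
    using assms by (intro frac_le mult_left_mono power_mono) auto
  then have 1: "(arcosh ?c)\<^sup>2 / (2 * t\<^sup>2) \<le> (1 + x)\<^sup>2 / (2 * t0\<^sup>2) * ?e" by simp
  have e: "?e \<ge> 1" by simp
  have "1 / (2 * t) \<le> 1 / (2 * t0)" using assms by (intro frac_le) auto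
  also have "\<dots> \<le> 1 / (2 * t0) * ?e" using e assms mult_left_mono[OF e, of "1 / (2 * t0)"] by simp
  finally have 2: "1 / (2 * t) \<le> 1 / (2 * t0) * ?e" .
  have 3: "\<mu>\<^sup>2 / 2 \<le> \<mu>\<^sup>2 / 2 * ?e" using mult_left_mono[OF e, of "\<mu>\<^sup>2 / 2"] by simp
  have "0 \<le> (arcosh ?c)\<^sup>2 / (2 * t\<^sup>2)" "0 \<le> 1 / (2 * t)" "0 \<le> \<mu>\<^sup>2 / 2" using assms by auto
  then have "\<bar>(arcosh ?c)\<^sup>2 / (2 * t\<^sup>2) - 1 / (2 * t) - \<mu>\<^sup>2 / 2\<bar> \<le> (arcosh ?c)\<^sup>2 / (2 * t\<^sup>2) + 1 / (2 * t) + \<mu>\<^sup>2 / 2"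
    by linarith
  also have "\<dots> \<le> (1 + x)\<^sup>2 / (2 * t0\<^sup>2) * ?e + 1 / (2 * t0) * ?e + \<mu>\<^sup>2 / 2 * ?e"
    by (intro add_mono 1 2 3)
  also have "\<dots> = ?K * ?e" by (simp only: distrib_right)
  finally have "\<bar>(arcosh ?c)\<^sup>2 / (2 * t\<^sup>2) - 1 / (2 * t) - \<mu>\<^sup>2 / 2\<bar> * heat0 t ?c \<le> ?K * ?e * heat0 t ?c"
    using heat0_pos[of t ?c] by (intro mult_right_mono) auto
  then have F: "\<bar>((arcosh ?c)\<^sup>2 / (2 * t\<^sup>2) - 1 / (2 * t) - \<mu>\<^sup>2 / 2) * heat0 t ?c\<bar> \<le> ?K * ?e * heat0 t ?c"
    using heat0_pos[of t ?c] by (simp add: abs_mult)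
  have eq: "hyp_kernel_t \<mu> t x y = drift_weight \<mu> t y *
      (((arcosh ?c)\<^sup>2 / (2 * t\<^sup>2) - 1 / (2 * t) - \<mu>\<^sup>2 / 2) * heat0 t ?c)"
    by (simp add: hyp_kernel_t_def hyp_kernel_def mult_ac)
  have "\<bar>hyp_kernel_t \<mu> t x y\<bar> \<le> ?K / sqrt (2 * pi * t) * gauss_tail (\<bar>\<mu>\<bar> + 2) s y"
    unfolding eq by (rule weighted_bound[OF assms(1-3) F]) (use assms in auto)
  also have "\<dots> \<le> ?K / sqrt (2 * pi * t0) * gauss_tail (\<bar>\<mu>\<bar> + 2) s y"
    using assms by (intro mult_right_mono divide_left_mono) (auto intro!: add_nonneg_nonneg)
  finally show ?thesis .
qed

lemma integrable_hyp:
  assumes "t > 0" "x > 0"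
  shows "integrable lborel (hyp_kernel \<mu> t x)" "integrable lborel (hyp_kernel_x \<mu> t x)"
    "integrable lborel (hyp_kernel_xx \<mu> t x)" "integrable lborel (hyp_kernel_t \<mu> t x)"
proof -
  have g: "integrable lborel (\<lambda>y. K * gauss_tail m t y)" for K m
    by (intro integrable_mult_right integrable_exp_abs_gaussian assms)
  have b: "integrable lborel f" if "f \<in> borel_measurable borel" "\<And>y. \<bar>f y\<bar> \<le> K * gauss_tail m t y"
    for f :: "real \<Rightarrow> real" and K m
    by (rule Bochner_Integration.integrable_bound[OF g[of K m]])
       (use that in \<open>auto intro!: AE_I2 intro: order_trans[OF _ abs_ge_self] simp del: abs_mult\<close>)
  show "integrable lborel (hyp_kernel \<mu> t x)"
    by (rule b[OF _ hyp_kernel_bound]) (use assms in auto)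
  show "integrable lborel (hyp_kernel_x \<mu> t x)"
    by (rule b[OF _ hyp_kernel_x_bound]) (use assms in auto)
  show "integrable lborel (hyp_kernel_xx \<mu> t x)"
    by (rule b[OF _ hyp_kernel_xx_bound[of t t x x x]]) (use assms in auto)
  show "integrable lborel (hyp_kernel_t \<mu> t x)"
    by (rule b[OF _ hyp_kernel_t_bound[of t t x t]]) (use assms in auto)
qed

lemma cosh_phi_deriv_x: "((\<lambda>x. cosh_phi x y) has_real_derivative exp (- y)) (at x)"
  unfolding cosh_phi_def by (auto intro!: derivative_eq_intros)

lemma hyp_transform_x_derivative:
  assumes "t > 0" "x > 0"
  shows "((\<lambda>x. hyp_transform \<mu> t x) has_real_derivative (\<integral>y. hyp_kernel_x \<mu> t x y \<partial>lborel)) (at x)"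
  unfolding hyp_transform_def
proof (rule has_real_derivative_lebesgue_integral[where a = "x / 2" and b = "2 * x"
      and w = "\<lambda>y. (1 / t) / sqrt (2 * pi * t) * gauss_tail (\<bar>\<mu>\<bar> + 1) t y"])
  fix u y :: real assume u: "x / 2 < u" "u < 2 * x"
  then have u0: "u > 0" using assms by simp
  show "integrable lborel (hyp_kernel \<mu> t u)" by (rule integrable_hyp[OF assms(1) u0])
  show "((\<lambda>x. hyp_kernel \<mu> t x y) has_real_derivative hyp_kernel_x \<mu> t u y) (at u)"
    unfolding hyp_kernel_def hyp_kernel_x_def
    by (intro DERIV_cmult DERIV_chain2[OF heat0_derivative cosh_phi_deriv_x] assms cosh_phi_gt_1 u0)
  show "\<bar>hyp_kernel_x \<mu> t u y\<bar> \<le> (1 / t) / sqrt (2 * pi * t) * gauss_tail (\<bar>\<mu>\<bar> + 1) t y"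
    by (rule hyp_kernel_x_bound) (use assms u0 in auto)
next
  show "integrable lborel (\<lambda>y. (1 / t) / sqrt (2 * pi * t) * gauss_tail (\<bar>\<mu>\<bar> + 1) t y)"
    by (intro integrable_mult_right integrable_exp_abs_gaussian assms)
qed (use assms in auto)

lemma hyp_transform_xx_derivative:
  assumes "t > 0" "x > 0"
  shows "((\<lambda>x. \<integral>y. hyp_kernel_x \<mu> t x y \<partial>lborel) has_real_derivative (\<integral>y. hyp_kernel_xx \<mu> t x y \<partial>lborel)) (at x)"
proof (rule has_real_derivative_lebesgue_integral[where a = "x / 2" and b = "2 * x"
      and w = "\<lambda>y. (1 / t\<^sup>2 + (2 + 2 * x) / (t * (x / 2))) / sqrt (2 * pi * t) * gauss_tail (\<bar>\<mu>\<bar> + 3) t y"])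
  fix u y :: real assume u: "x / 2 < u" "u < 2 * x"
  then have u0: "u > 0" using assms by simp
  show "integrable lborel (hyp_kernel_x \<mu> t u)" by (rule integrable_hyp[OF assms(1) u0])
  have "((\<lambda>x. heat1 t (cosh_phi x y) * exp (- y)) has_real_derivative
      heat2 t (cosh_phi u y) * exp (- y) * exp (- y)) (at u)"
    by (intro DERIV_cmult_right DERIV_chain2[OF heat1_derivative cosh_phi_deriv_x] assms cosh_phi_gt_1 u0)
  then show "((\<lambda>x. hyp_kernel_x \<mu> t x y) has_real_derivative hyp_kernel_xx \<mu> t u y) (at u)"
    unfolding hyp_kernel_x_def hyp_kernel_xx_def power2_eq_square mult.assoc
    by (intro DERIV_cmult) (simp add: mult.assoc)
  show "\<bar>hyp_kernel_xx \<mu> t u y\<bar> \<le> (1 / t\<^sup>2 + (2 + 2 * x) / (t * (x / 2))) / sqrt (2 * pi * t) * gauss_tail (\<bar>\<mu>\<bar> + 3) t y"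
    by (rule hyp_kernel_xx_bound) (use assms u u0 in auto)
next
  show "integrable lborel (\<lambda>y. (1 / t\<^sup>2 + (2 + 2 * x) / (t * (x / 2))) / sqrt (2 * pi * t) * gauss_tail (\<bar>\<mu>\<bar> + 3) t y)"
    by (intro integrable_mult_right integrable_exp_abs_gaussian assms)
qed (use assms in auto)

lemma hyp_kernel_time_derivative:
  assumes "t > 0"
  shows "((\<lambda>t. hyp_kernel \<mu> t x y) has_real_derivative hyp_kernel_t \<mu> t x y) (at t)"
proof -
  let ?w = "\<lambda>t. drift_weight \<mu> t y"
  have s: "((\<lambda>t. sqrt (2 * pi * t)) has_real_derivative sqrt (2 * pi * t) / (2 * t)) (at t)"
  proof -
    have p: "2 * pi * t > 0" using assms by simp
    have "((\<lambda>t. 2 * pi * t) has_real_derivative 2 * pi) (at t)"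
      by (auto intro!: derivative_eq_intros)
    from DERIV_chain2[OF DERIV_real_sqrt[OF p] this]
    have "((\<lambda>t. sqrt (2 * pi * t)) has_real_derivative (inverse (sqrt (2 * pi * t)) / 2) * (2 * pi)) (at t)" .
    moreover have "(inverse (sqrt (2 * pi * t)) / 2) * (2 * pi) = sqrt (2 * pi * t) / (2 * t)"
    proof -
      have "sqrt (2 * pi * t) * sqrt (2 * pi * t) = 2 * pi * t" using assms by simp
      moreover have "sqrt (2 * pi * t) > 0" using assms by simp
      ultimately show ?thesis using assms by (simp add: field_simps)
    qed
    ultimately show ?thesis by (simp only:)
  qed
  have e: "((\<lambda>t. exp (\<mu> * y - \<mu>\<^sup>2 * t / 2)) has_real_derivative - (\<mu>\<^sup>2 / 2) * exp (\<mu> * y - \<mu>\<^sup>2 * t / 2)) (at t)"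
    by (auto intro!: derivative_eq_intros)
  have s0: "sqrt (2 * pi * t) \<noteq> 0" using assms by simp
  have "(- (\<mu>\<^sup>2 / 2) * E * S - E * (S / (2 * t))) / (S * S) = (- (\<mu>\<^sup>2 / 2) - 1 / (2 * t)) * (E / S)" if "S \<noteq> 0" for E S :: real
    using that assms by (simp add: field_simps)
  from this[OF s0] DERIV_divide[OF e s s0]
  have w: "(?w has_real_derivative (- (\<mu>\<^sup>2 / 2) - 1 / (2 * t)) * ?w t) (at t)" by simp
  have "(- (\<mu>\<^sup>2 / 2) - 1 / (2 * t)) * ?w t * heat0 t (cosh_phi x y) +
      (arcosh (cosh_phi x y))\<^sup>2 / (2 * t\<^sup>2) * heat0 t (cosh_phi x y) * ?w t = hyp_kernel_t \<mu> t x y"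
  proof -
    have "(- m - p) * w * h + a * h * w = (a - p - m) * (w * h)" for m p w h a :: real
      by (simp add: algebra_simps)
    then show ?thesis unfolding hyp_kernel_t_def hyp_kernel_def .
  qed
  with DERIV_mult[OF w heat0_time_derivative[OF assms, of "cosh_phi x y"]]
  show ?thesis unfolding hyp_kernel_def by simp
qed

lemma hyp_transform_time_derivative:
  assumes "t > 0" "x > 0"
  shows "((\<lambda>t. hyp_transform \<mu> t x) has_real_derivative (\<integral>y. hyp_kernel_t \<mu> t x y \<partial>lborel)) (at t)"
  unfolding hyp_transform_def
\<comment> \<open>On \<open>(t/2, 2t)\<close> the prefactor is largest at the left end and the tail
  decays most slowly at the right end, so the majorant combines \<open>t/2\<close> with
  \<open>2t\<close>.\<close>
proof (rule has_real_derivative_lebesgue_integral[where a = "t / 2" and b = "2 * t"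
      and w = "\<lambda>y. ((1 + x)\<^sup>2 / (2 * (t / 2)\<^sup>2) + 1 / (2 * (t / 2)) + \<mu>\<^sup>2 / 2) / sqrt (2 * pi * (t / 2)) *
         gauss_tail (\<bar>\<mu>\<bar> + 2) (2 * t) y"])
  fix u y :: real assume u: "t / 2 < u" "u < 2 * t"
  then have u0: "u > 0" using assms by simp
  show "integrable lborel (hyp_kernel \<mu> u x)" by (rule integrable_hyp[OF u0 assms(2)])
  show "((\<lambda>t. hyp_kernel \<mu> t x y) has_real_derivative hyp_kernel_t \<mu> u x y) (at u)"
    by (rule hyp_kernel_time_derivative[OF u0])
  show "\<bar>hyp_kernel_t \<mu> u x y\<bar> \<le> ((1 + x)\<^sup>2 / (2 * (t / 2)\<^sup>2) + 1 / (2 * (t / 2)) + \<mu>\<^sup>2 / 2) / sqrt (2 * pi * (t / 2)) *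
         gauss_tail (\<bar>\<mu>\<bar> + 2) (2 * t) y"
    by (rule hyp_kernel_t_bound) (use assms u u0 in auto)
next
  show "integrable lborel (\<lambda>y. ((1 + x)\<^sup>2 / (2 * (t / 2)\<^sup>2) + 1 / (2 * (t / 2)) + \<mu>\<^sup>2 / 2) / sqrt (2 * pi * (t / 2)) *
         gauss_tail (\<bar>\<mu>\<bar> + 2) (2 * t) y)"
    using assms by (intro integrable_mult_right integrable_exp_abs_gaussian) simp
qed (use assms in auto)

section \<open>The parabolic equation for the kernel transform\<close>

lemma exp_abs_gaussian_tendsto_0:
  fixes m s :: real
  assumes s: "s > 0" and F: "filterlim (\<lambda>y. \<bar>y\<bar>) at_top F"
  shows "(gauss_tail m s \<longlongrightarrow> 0) F"
proof -
  have "filterlim (\<lambda>y::real. \<bar>y\<bar> * (\<bar>y\<bar> / (2 * s) - m)) at_top F"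
  proof (rule filterlim_at_top_mult_at_top[OF F])
    have "filterlim (\<lambda>y::real. 1 / (2 * s) * \<bar>y\<bar>) at_top F"
      by (rule filterlim_tendsto_pos_mult_at_top[OF tendsto_const _ F]) (use s in simp)
    then have "filterlim (\<lambda>y::real. - m + 1 / (2 * s) * \<bar>y\<bar>) at_top F"
      by (rule filterlim_tendsto_add_at_top[OF tendsto_const])
    then show "filterlim (\<lambda>y::real. \<bar>y\<bar> / (2 * s) - m) at_top F" by simp
  qed
  then have "filterlim (\<lambda>y::real. - (\<bar>y\<bar> * (\<bar>y\<bar> / (2 * s) - m))) at_bot F"
    by (simp add: filterlim_uminus_at_bot)
  from filterlim_compose[OF exp_at_bot this]
  have "((\<lambda>y. exp (- (\<bar>y\<bar> * (\<bar>y\<bar> / (2 * s) - m)))) \<longlongrightarrow> 0) F" .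
  moreover have "exp (- (\<bar>y\<bar> * (\<bar>y\<bar> / (2 * s) - m))) = exp (m * \<bar>y\<bar>) * exp (- y\<^sup>2 / (2 * s))" for y
  proof -
    have "- (\<bar>y\<bar> * (\<bar>y\<bar> / (2 * s) - m)) = m * \<bar>y\<bar> + - (\<bar>y\<bar> * \<bar>y\<bar>) / (2 * s)"
      by (simp add: right_diff_distrib mult.commute)
    also have "\<bar>y\<bar> * \<bar>y\<bar> = y\<^sup>2" by (simp add: power2_eq_square)
    finally show ?thesis by (simp add: exp_add[symmetric])
  qed
  ultimately show ?thesis by simp
qed

text \<open>The part of the kernel's evolution that is not \<open>(2x\<^sup>2 + x) \<partial>\<^sub>x\<^sup>2 + 2(1 - \<mu>) x \<partial>\<^sub>x\<close> is an
  exact \<open>y\<close>-derivative, so it integrates to zero.\<close>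

lemma hyp_transform_pde:
  assumes t: "t > 0" and x: "x > 0"
  shows "(\<integral>y. hyp_kernel_t \<mu> t x y \<partial>lborel) =
    (2 * x\<^sup>2 + x) * (\<integral>y. hyp_kernel_xx \<mu> t x y \<partial>lborel) + 2 * (1 - \<mu>) * x * (\<integral>y. hyp_kernel_x \<mu> t x y \<partial>lborel)"
proof -
  define w where "w y = drift_weight \<mu> t y" for y
  define c where "c y = cosh_phi x y" for y
  \<comment> \<open>\<open>b\<close> is the \<open>y\<close>-derivative of \<open>c\<close>, and
    differentiating once more returns \<open>c\<close>. So, with \<open>h0\<close>,
    \<open>h1\<close>, \<open>h2\<close> for the three heat functions at \<open>c y\<close>, the sum
    \<open>b^2 h2 + c h1\<close> is the second \<open>y\<close>-derivative of
    \<open>h0\<close>.\<close>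
  define b where "b y = sinh y - x * exp (- y)" for y
  \<comment> \<open>The flux \<open>w V\<close> has two parts. The derivative of
    \<open>w (h0_y - \<mu> h0) / 2\<close> is \<open>w (h0_yy - \<mu>^2 h0) / 2\<close>. The
    derivative of \<open>2 x w exp(-y) h1\<close> is the mixed term
    \<open>2 x w exp(-y) b h2\<close> minus \<open>2 (1 - \<mu>) x\<close> times
    \<open>hyp_kernel_x\<close>, which is where the drift coefficient of the equation comes
    from.\<close>
  define V where "V y = b y / 2 * heat1 t (c y) - \<mu> / 2 * heat0 t (c y) + 2 * x * exp (- y) * heat1 t (c y)" for y
  define f where "f y = hyp_kernel_t \<mu> t x y - (2 * x\<^sup>2 + x) * hyp_kernel_xx \<mu> t x y - 2 * (1 - \<mu>) * x * hyp_kernel_x \<mu> t x y" for y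
  have c1: "c y > 1" for y using cosh_phi_gt_1[OF x] by (simp add: c_def)
  have dc: "(c has_real_derivative b y) (at y)" for y
    unfolding c_def b_def cosh_phi_def by (auto intro!: derivative_eq_intros)
  have db: "(b has_real_derivative c y) (at y)" for y
    unfolding c_def b_def cosh_phi_def by (auto intro!: derivative_eq_intros)
  have dw: "(w has_real_derivative \<mu> * w y) (at y)" for y
  proof -
    have "((\<lambda>y. exp (\<mu> * y - \<mu>\<^sup>2 * t / 2)) has_real_derivative \<mu> * exp (\<mu> * y - \<mu>\<^sup>2 * t / 2)) (at y)"
      by (auto intro!: derivative_eq_intros)
    from DERIV_cdivide[OF this, of "sqrt (2 * pi * t)"] show ?thesis
      by (simp add: w_def[abs_def])
  qed
  have d0: "((\<lambda>y. heat0 t (c y)) has_real_derivative heat1 t (c y) * b y) (at y)" for y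
    by (rule DERIV_chain2[OF heat0_derivative[OF t c1] dc])
  have d1: "((\<lambda>y. heat1 t (c y)) has_real_derivative heat2 t (c y) * b y) (at y)" for y
    by (rule DERIV_chain2[OF heat1_derivative[OF t c1] dc])
  have dV: "(V has_real_derivative
      c y / 2 * heat1 t (c y) + b y / 2 * (heat2 t (c y) * b y) - \<mu> / 2 * (heat1 t (c y) * b y)
      - 2 * x * exp (- y) * heat1 t (c y) + 2 * x * exp (- y) * (heat2 t (c y) * b y)) (at y)" for y
    unfolding V_def by (auto intro!: derivative_eq_intros db d0 d1 simp: field_simps)
  have dW: "((\<lambda>y. w y * V y) has_real_derivative f y) (at y)" for y
  proof -
    let ?h0 = "heat0 t (c y)" and ?h1 = "heat1 t (c y)" and ?h2 = "heat2 t (c y)" and ?E = "exp (- y)"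
    let ?a = "(arcosh (c y))\<^sup>2"
    have he: "((c y)\<^sup>2 - 1) * ?h2 + c y * ?h1 = (?a / t\<^sup>2 - 1 / t) * ?h0"
      by (rule heat_equation[OF t c1])
    \<comment> \<open>\<open>cosh y = sinh y + exp(-y)\<close> regroups \<open>c^2 - 1\<close>
      around the square of \<open>b\<close>. Besides the mixed term there remains
      \<open>exp(-2y)\<close> times twice the coefficient \<open>2x^2 + x\<close> of the
      equation.\<close>
    have cc: "(c y)\<^sup>2 - 1 = 2 * ((2 * x\<^sup>2 + x) * ?E\<^sup>2) + (b y)\<^sup>2 + 4 * x * ?E * b y"
    proof -
      have cs: "cosh y = sinh y + ?E" by (simp add: sinh_field_def cosh_field_def field_simps)
      have s1: "(cosh y)\<^sup>2 = 1 + (sinh y)\<^sup>2" by (simp add: cosh_square_eq)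
      have "(c y)\<^sup>2 - 1 = x\<^sup>2 * ?E\<^sup>2 + 2 * x * ?E * cosh y + (sinh y)\<^sup>2"
        unfolding c_def cosh_phi_def using s1 by (simp add: power2_sum power_mult_distrib)
      also have "\<dots> = 2 * ((2 * x\<^sup>2 + x) * ?E\<^sup>2) + (b y)\<^sup>2 + 4 * x * ?E * b y"
        unfolding cs b_def by (simp add: power2_eq_square algebra_simps)
      finally show ?thesis .
    qed
    have "\<mu> * w y * V y + (c y / 2 * ?h1 + b y / 2 * (?h2 * b y) - \<mu> / 2 * (?h1 * b y)
      - 2 * x * ?E * ?h1 + 2 * x * ?E * (?h2 * b y)) * w y =
      w y * (((2 * ((2 * x\<^sup>2 + x) * ?E\<^sup>2) + (b y)\<^sup>2 + 4 * x * ?E * b y) * ?h2 + c y * ?h1) / 2 - \<mu>\<^sup>2 / 2 * ?h0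
         - (2 * x\<^sup>2 + x) * (?h2 * ?E\<^sup>2) - 2 * (1 - \<mu>) * x * (?h1 * ?E))"
      unfolding V_def by (simp add: field_simps power2_eq_square)
    also have "\<dots> = w y * ((?a / t\<^sup>2 - 1 / t) * ?h0 / 2 - \<mu>\<^sup>2 / 2 * ?h0
         - (2 * x\<^sup>2 + x) * (?h2 * ?E\<^sup>2) - 2 * (1 - \<mu>) * x * (?h1 * ?E))"
      unfolding cc[symmetric] he ..
    also have "\<dots> = f y"
      unfolding f_def hyp_kernel_t_def hyp_kernel_def hyp_kernel_x_def hyp_kernel_xx_def
        w_def[symmetric] c_def[symmetric] by (simp add: algebra_simps add_divide_distrib diff_divide_distrib)
    finally show ?thesis by (rule DERIV_cong[OF DERIV_mult[OF dw dV]])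
  qed
  have K: "\<bar>w y * V y\<bar> \<le> ((1 + x) / (2 * t) + \<bar>\<mu>\<bar> / 2 + 2 * x / t) / sqrt (2 * pi * t) * gauss_tail (\<bar>\<mu>\<bar> + 1) t y" for y
    unfolding w_def
  proof (rule weighted_bound)
    let ?h0 = "heat0 t (c y)" and ?e = "exp (1 * \<bar>y\<bar>)"
    have h0: "?h0 > 0" by (rule heat0_pos)
    have h1: "\<bar>heat1 t (c y)\<bar> \<le> ?h0 / t" by (rule heat1_bound[OF t c1])
    have bb: "\<bar>b y\<bar> \<le> (1 + x) * ?e"
    proof -
      have "\<bar>sinh y\<bar> \<le> cosh y"
        using sinh_le_cosh_real[of y] sinh_le_cosh_real[of "- y"] by (simp add: abs_le_iff)
      moreover have "\<bar>x * exp (- y)\<bar> = x * exp (- y)" using x by simp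
      ultimately have "\<bar>b y\<bar> \<le> cosh y + x * exp (- y)"
        unfolding b_def using abs_triangle_ineq4[of "sinh y" "x * exp (- y)"] by linarith
      also have "\<dots> = cosh_phi x y" by (simp add: cosh_phi_def)
      also have "\<dots> \<le> (1 + x) * ?e" using cosh_phi_le[of x y] x by simp
      finally show ?thesis .
    qed
    have 1: "\<bar>b y / 2 * heat1 t (c y)\<bar> \<le> ((1 + x) * ?e) / 2 * (?h0 / t)"
      unfolding abs_mult abs_divide abs_numeral
      using bb h1 x by (intro mult_mono divide_right_mono) auto
    have e: "1 \<le> ?e" by simp
    have 2: "\<bar>\<mu> / 2 * ?h0\<bar> \<le> (\<bar>\<mu>\<bar> / 2 * ?e) * ?h0"
    proof -
      have "\<bar>\<mu>\<bar> / 2 * 1 \<le> \<bar>\<mu>\<bar> / 2 * ?e" by (intro mult_left_mono e) simp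
      then have "\<bar>\<mu>\<bar> / 2 * ?h0 \<le> (\<bar>\<mu>\<bar> / 2 * ?e) * ?h0" using h0 by (intro mult_right_mono) auto
      then show ?thesis using h0 by (simp add: abs_mult)
    qed
    have 3: "\<bar>2 * x * exp (- y) * heat1 t (c y)\<bar> \<le> (2 * x * ?e) * (?h0 / t)"
    proof -
      have "2 * x * exp (- y) \<le> 2 * x * ?e" using x by (intro mult_left_mono) auto
      then have "2 * x * exp (- y) * \<bar>heat1 t (c y)\<bar> \<le> (2 * x * ?e) * (?h0 / t)"
        using h1 x by (intro mult_mono) auto
      then show ?thesis using x by (simp add: abs_mult)
    qed
    have tri: "\<bar>p - q + r\<bar> \<le> \<bar>p\<bar> + \<bar>q\<bar> + \<bar>r\<bar>" for p q r :: real by linarith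
    have "\<bar>V y\<bar> \<le> ((1 + x) * ?e) / 2 * (?h0 / t) + (\<bar>\<mu>\<bar> / 2 * ?e) * ?h0 + (2 * x * ?e) * (?h0 / t)"
      unfolding V_def by (rule order_trans[OF tri]) (intro add_mono 1 2 3)
    also have "\<dots> = ((1 + x) / (2 * t) + \<bar>\<mu>\<bar> / 2 + 2 * x / t) * ?e * heat0 t (cosh_phi x y)"
      unfolding c_def by (simp add: field_simps)
    finally show "\<bar>V y\<bar> \<le> ((1 + x) / (2 * t) + \<bar>\<mu>\<bar> / 2 + 2 * x / t) * ?e * heat0 t (cosh_phi x y)" .
  qed (use t x in auto)
  have lim: "((\<lambda>y. w y * V y) \<longlongrightarrow> 0) F" if F: "filterlim (\<lambda>y::real. \<bar>y\<bar>) at_top F" for F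
  proof (rule Lim_null_comparison)
    show "\<forall>\<^sub>F y in F. norm (w y * V y) \<le> ((1 + x) / (2 * t) + \<bar>\<mu>\<bar> / 2 + 2 * x / t) / sqrt (2 * pi * t) * gauss_tail (\<bar>\<mu>\<bar> + 1) t y"
      unfolding real_norm_def by (intro always_eventually allI K)
    show "((\<lambda>y. ((1 + x) / (2 * t) + \<bar>\<mu>\<bar> / 2 + 2 * x / t) / sqrt (2 * pi * t) * gauss_tail (\<bar>\<mu>\<bar> + 1) t y) \<longlongrightarrow> 0) F"
      by (intro tendsto_mult_right_zero exp_abs_gaussian_tendsto_0 t F)
  qed
  have cf: "isCont f y" for y
  proof -
    have cc: "isCont c y" by (rule DERIV_isCont[OF dc])
    have ca: "isCont (\<lambda>y. arcosh (c y)) y"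
      by (rule isCont_o2[OF cc DERIV_isCont[OF arcosh_real_has_field_derivative[OF c1]]])
    have h0: "isCont (\<lambda>y. heat0 t (c y)) y" by (rule DERIV_isCont[OF d0])
    have h1: "isCont (\<lambda>y. heat1 t (c y)) y" by (rule DERIV_isCont[OF d1])
    have nz: "(c y)\<^sup>2 - 1 \<noteq> 0" "sqrt ((c y)\<^sup>2 - 1) \<noteq> 0"
      using one_less_power[OF c1[of y], of 2] by auto
    have h2: "isCont (\<lambda>y. heat2 t (c y)) y"
      unfolding heat2_def using nz t by (intro continuous_intros cc ca h0) auto
    have cw: "isCont w y" by (rule DERIV_isCont[OF dw])
    show ?thesis
      unfolding f_def hyp_kernel_t_def hyp_kernel_def hyp_kernel_x_def hyp_kernel_xx_def
        w_def[symmetric] c_def[symmetric]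
      using t by (intro continuous_intros cw ca h0 h1 h2) auto
  qed
  have fi: "integrable lborel f"
    unfolding f_def using integrable_hyp[OF t x, of \<mu>] by auto
  \<comment> \<open>The fundamental theorem on the whole line; the flux vanishes at both ends by its
    Gaussian bound.\<close>
  have "(LBINT y=-\<infinity>..\<infinity>. f y) = 0 - 0"
  proof (rule interval_integral_FTC_integrable[where F = "\<lambda>y. w y * V y"])
    show "((\<lambda>y. w y * V y) has_vector_derivative f y) (at y)" for y
      using dW[of y] by (simp add: has_real_derivative_iff_has_vector_derivative)
    show "set_integrable lborel (einterval (- \<infinity>) \<infinity>) f"
      using fi by (simp add: set_integrable_def einterval_def)
    show "(((\<lambda>y. w y * V y) \<circ> real_of_ereal) \<longlongrightarrow> 0) (at_right (- \<infinity>))"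
      unfolding ereal_tendsto_simps1 by (rule lim[OF filterlim_abs_real[THEN filterlim_compose, OF filterlim_uminus_at_top_at_bot, simplified]])
    show "(((\<lambda>y. w y * V y) \<circ> real_of_ereal) \<longlongrightarrow> 0) (at_left \<infinity>)"
      unfolding ereal_tendsto_simps1 by (rule lim[OF filterlim_abs_real])
  qed (use cf in auto)
  then have "(\<integral>y. f y \<partial>lborel) = 0"
    by (simp add: interval_lebesgue_integral_def einterval_def set_lebesgue_integral_def)
  moreover have "(\<integral>y. f y \<partial>lborel) = (\<integral>y. hyp_kernel_t \<mu> t x y \<partial>lborel) -
    (2 * x\<^sup>2 + x) * (\<integral>y. hyp_kernel_xx \<mu> t x y \<partial>lborel) - 2 * (1 - \<mu>) * x * (\<integral>y. hyp_kernel_x \<mu> t x y \<partial>lborel)"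
    unfolding f_def using integrable_hyp[OF t x, of \<mu>] by simp
  ultimately show ?thesis by simp
qed

text \<open>The exponent that remains in \<open>G\<close> once the drift is absorbed into the mean
  and \<open>y = \<mu> t + sqrt t z\<close> is substituted; the Gaussian factor is then free of
  \<open>t\<close>. For \<open>x \<ge> 0\<close> and \<open>t > 0\<close> this exponent is
  nonpositive, so the standard normal density is one majorant for all such \<open>t\<close> and
  \<open>x\<close>, also in the limit \<open>t\<close> to 0.\<close>

definition gauss_exponent :: "real \<Rightarrow> real \<Rightarrow> real \<Rightarrow> real \<Rightarrow> real" where
  "gauss_exponent \<mu> t x z =
     ((\<mu> * t + sqrt t * z)\<^sup>2 - (arcosh (cosh_phi x (\<mu> * t + sqrt t * z)))\<^sup>2) / (2 * t)"

lemma hyp_kernel_eq_normal_density: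
  assumes "t > 0"
  shows "hyp_kernel \<mu> t x y =
    normal_density (\<mu> * t) (sqrt t) y * exp ((y\<^sup>2 - (arcosh (cosh_phi x y))\<^sup>2) / (2 * t))"
proof -
  have "(\<mu> * y - \<mu>\<^sup>2 * t / 2) + - a / (2 * t) = - (y - \<mu> * t)\<^sup>2 / (2 * t) + (y\<^sup>2 - a) / (2 * t)" for a
    using assms by (simp add: field_simps power2_eq_square)
  then have "exp (\<mu> * y - \<mu>\<^sup>2 * t / 2) * heat0 t (cosh_phi x y) =
      exp (- (y - \<mu> * t)\<^sup>2 / (2 * t)) * exp ((y\<^sup>2 - (arcosh (cosh_phi x y))\<^sup>2) / (2 * t))"
    by (simp only: heat0_def exp_add[symmetric])
  then show ?thesis
    using assms by (simp add: hyp_kernel_def normal_density_def)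
qed

lemma hyp_transform_gauss:
  assumes "t > 0"
  shows "hyp_transform \<mu> t x = (\<integral>z. std_normal_density z * exp (gauss_exponent \<mu> t x z) \<partial>lborel)"
  unfolding hyp_transform_def hyp_kernel_eq_normal_density[OF assms] gauss_exponent_def
  by (rule integral_normal_density_affine(1)) (use assms in simp)

lemma G_fun_eq_hyp_transform:
  assumes "std_brownian_motion M B" "t > 0" "x \<ge> 0"
  shows "G_fun M B \<mu> t x = hyp_transform \<mu> t x"
proof -
  interpret brownian M B using assms by (simp add: brownian_def)
  have m: "phi_fun x \<in> borel_measurable borel"
    unfolding phi_fun_def cosh_field_def sinh_field_def by measurable
  have "(\<integral>\<omega>. exp (\<mu> * B t \<omega> + ((B t \<omega>)\<^sup>2 - (phi_fun x (B t \<omega>))\<^sup>2) / (2 * t)) \<partial>M) =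
      (\<integral>y. normal_density 0 (sqrt t) y * exp (\<mu> * y + (y\<^sup>2 - (phi_fun x y)\<^sup>2) / (2 * t)) \<partial>lborel)"
    using m assms(2) by (intro expectation_B_density[where g = "\<lambda>y. exp (\<mu> * y + (y\<^sup>2 - (phi_fun x y)\<^sup>2) / (2 * t))"]) auto
  then have "G_fun M B \<mu> t x =
      (\<integral>y. exp (- t * \<mu>\<^sup>2 / 2) * (normal_density 0 (sqrt t) y * exp (\<mu> * y + (y\<^sup>2 - (phi_fun x y)\<^sup>2) / (2 * t))) \<partial>lborel)"
    by (simp add: G_fun_def)
  also have "\<dots> = hyp_transform \<mu> t x"
    unfolding hyp_transform_def
  proof (intro Bochner_Integration.integral_cong refl)
    fix y
    have "- t * \<mu>\<^sup>2 / 2 + (- y\<^sup>2 / (2 * t) + (\<mu> * y + (y\<^sup>2 - a) / (2 * t))) = \<mu> * y - \<mu>\<^sup>2 * t / 2 + - a / (2 * t)" for a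
      using assms(2) by (simp add: diff_divide_distrib)
    then have "exp (- t * \<mu>\<^sup>2 / 2) * (exp (- y\<^sup>2 / (2 * t)) * exp (\<mu> * y + (y\<^sup>2 - (phi_fun x y)\<^sup>2) / (2 * t))) =
        exp (\<mu> * y - \<mu>\<^sup>2 * t / 2) * heat0 t (cosh_phi x y)"
      by (simp only: heat0_def exp_add[symmetric] phi_fun_eq[OF assms(3)])
    then show "exp (- t * \<mu>\<^sup>2 / 2) * (normal_density 0 (sqrt t) y * exp (\<mu> * y + (y\<^sup>2 - (phi_fun x y)\<^sup>2) / (2 * t))) = hyp_kernel \<mu> t x y"
      using assms(2) by (simp add: hyp_kernel_def normal_density_def)
  qed
  finally show ?thesis .
qed

lemma gauss_exponent_nonpos:
  assumes "t > 0" "x \<ge> 0"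
  shows "gauss_exponent \<mu> t x z \<le> 0"
proof -
  let ?y = "\<mu> * t + sqrt t * z"
  have "?y\<^sup>2 \<le> (arcosh (cosh_phi x ?y))\<^sup>2"
    using power_mono[OF phi_ge_abs[OF assms(2), of ?y], of 2] by simp
  then show ?thesis using assms(1) by (simp add: gauss_exponent_def divide_nonpos_pos)
qed

lemma gauss_exponent_antimono:
  assumes "t > 0" "0 \<le> x" "x \<le> x'"
  shows "gauss_exponent \<mu> t x' z \<le> gauss_exponent \<mu> t x z"
proof -
  let ?y = "\<mu> * t + sqrt t * z"
  have "cosh_phi x ?y \<le> cosh_phi x' ?y" using assms by (simp add: cosh_phi_def)
  then have "arcosh (cosh_phi x ?y) \<le> arcosh (cosh_phi x' ?y)"
    using cosh_phi_ge(2)[OF assms(2)] by (intro arcosh_mono)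
  then have "(arcosh (cosh_phi x ?y))\<^sup>2 \<le> (arcosh (cosh_phi x' ?y))\<^sup>2"
    using cosh_phi_ge(2)[OF assms(2)] by (intro power_mono) auto
  then show ?thesis using assms(1) by (simp add: gauss_exponent_def divide_right_mono)
qed

lemma measurable_gauss_exponent: "gauss_exponent \<mu> t x \<in> borel_measurable borel"
proof -
  note measurable_arcosh[measurable]
  show ?thesis
    unfolding gauss_exponent_def cosh_phi_def cosh_field_def by measurable
qed

lemma integrable_gauss_exponent:
  assumes "t > 0" "x \<ge> 0"
  shows "integrable lborel (\<lambda>z. std_normal_density z * exp (gauss_exponent \<mu> t x z))"
proof (rule Bochner_Integration.integrable_bound)
  show "integrable lborel std_normal_density" by simp
  show "(\<lambda>z. std_normal_density z * exp (gauss_exponent \<mu> t x z)) \<in> borel_measurable lborel"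
    using measurable_gauss_exponent[of \<mu> t x] by simp
  show "AE z in lborel. norm (std_normal_density z * exp (gauss_exponent \<mu> t x z)) \<le> norm (std_normal_density z)"
    using gauss_exponent_nonpos[OF assms] by (intro AE_I2) (simp add: mult_left_le)
qed

lemma hyp_transform_antimono:
  assumes "t > 0" "0 \<le> x" "x \<le> x'"
  shows "hyp_transform \<mu> t x' \<le> hyp_transform \<mu> t x"
  unfolding hyp_transform_gauss[OF assms(1)]
  by (intro integral_mono integrable_gauss_exponent mult_left_mono)
     (use assms gauss_exponent_antimono in auto)

lemma hyp_transform_zero:
  assumes "t > 0" shows "hyp_transform \<mu> t 0 = 1"
proof -
  have "gauss_exponent \<mu> t 0 z = 0" for z
  proof -
    have "arcosh (cosh y) = \<bar>y\<bar>" for y :: real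
      using arcosh_cosh_real[of "\<bar>y\<bar>"] by simp
    then show ?thesis by (simp add: gauss_exponent_def cosh_phi_def)
  qed
  then show ?thesis
    unfolding hyp_transform_gauss[OF assms] using integral_std_normal_moment_even[of 0] by simp
qed

lemma hyp_transform_nonneg: "hyp_transform \<mu> t x \<ge> 0" if "t > 0"
  unfolding hyp_transform_gauss[OF that] by (intro Bochner_Integration.integral_nonneg) simp

lemma hyp_transform_le_1: "t > 0 \<Longrightarrow> x \<ge> 0 \<Longrightarrow> hyp_transform \<mu> t x \<le> 1"
  using hyp_transform_antimono[of t 0 x \<mu>] by (simp add: hyp_transform_zero)

lemma tendsto_hyp_transform:
  assumes X: "X \<longlonglongrightarrow> t" "t > 0" "\<And>n. X n > 0" and Y: "Y \<longlonglongrightarrow> x" "\<And>n. Y n \<ge> 0"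
  shows "(\<lambda>n. hyp_transform \<mu> (X n) (Y n)) \<longlonglongrightarrow> hyp_transform \<mu> t x"
  unfolding hyp_transform_gauss[OF X(2)] hyp_transform_gauss[OF X(3)]
proof (rule integral_dominated_convergence[where w = std_normal_density])
  have x: "x \<ge> 0" using LIMSEQ_le_const[OF Y(1)] Y(2) by blast
  show "AE z in lborel. (\<lambda>n. std_normal_density z * exp (gauss_exponent \<mu> (X n) (Y n) z))
      \<longlonglongrightarrow> std_normal_density z * exp (gauss_exponent \<mu> t x z)"
  proof (rule AE_I2)
    fix z
    have y: "(\<lambda>n. \<mu> * X n + sqrt (X n) * z) \<longlonglongrightarrow> \<mu> * t + sqrt t * z"
      by (intro tendsto_intros X)
    have "(\<lambda>n. cosh_phi (Y n) (\<mu> * X n + sqrt (X n) * z)) \<longlonglongrightarrow> cosh_phi x (\<mu> * t + sqrt t * z)"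
      unfolding cosh_phi_def by (intro tendsto_intros X Y)
    then have a: "(\<lambda>n. arcosh (cosh_phi (Y n) (\<mu> * X n + sqrt (X n) * z))) \<longlonglongrightarrow> arcosh (cosh_phi x (\<mu> * t + sqrt t * z))"
      by (rule tendsto_arcosh_strong) (use x Y cosh_phi_ge(2) in auto)
    have "(\<lambda>n. gauss_exponent \<mu> (X n) (Y n) z) \<longlonglongrightarrow> gauss_exponent \<mu> t x z"
      unfolding gauss_exponent_def
      by (rule tendsto_divide[OF tendsto_diff[OF tendsto_power[OF y] tendsto_power[OF a]]])
         (use X(2) in \<open>auto intro!: tendsto_intros X\<close>)
    then show "(\<lambda>n. std_normal_density z * exp (gauss_exponent \<mu> (X n) (Y n) z))
      \<longlonglongrightarrow> std_normal_density z * exp (gauss_exponent \<mu> t x z)"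
      by (intro tendsto_intros)
  qed
  show "AE z in lborel. norm (std_normal_density z * exp (gauss_exponent \<mu> (X n) (Y n) z)) \<le> std_normal_density z" for n
    using gauss_exponent_nonpos[OF X(3) Y(2)] by (intro AE_I2) (simp add: mult_left_le)
qed (use measurable_gauss_exponent in \<open>auto intro: borel_measurable_times\<close>)

text \<open>As \<open>t\<close> tends to 0 the point \<open>y\<close> tends to 0, while
  \<open>phi\<close> tends to \<open>arcosh (1 + x) > 0\<close>; the exponent therefore behaves like
  \<open>-(arcosh (1 + x))^2 / (2t)\<close>.\<close>

lemma hyp_transform_initial:
  assumes x: "x > 0"
  shows "((\<lambda>t. hyp_transform \<mu> t x) \<longlongrightarrow> 0) (at_right 0)"
  unfolding tendsto_at_iff_sequentially comp_def
proof (intro allI impI)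
  fix X :: "nat \<Rightarrow> real" assume "\<forall>i. X i \<in> {0<..} - {0}" and X0: "X \<longlonglongrightarrow> 0"
  then have X: "X n > 0" for n by auto
  have "(\<lambda>n. hyp_transform \<mu> (X n) x) \<longlonglongrightarrow> (\<integral>z. 0 \<partial>(lborel :: real measure))"
    unfolding hyp_transform_gauss[OF X]
  proof (rule integral_dominated_convergence[where w = std_normal_density])
    show "AE z in lborel. (\<lambda>n. std_normal_density z * exp (gauss_exponent \<mu> (X n) x z)) \<longlonglongrightarrow> 0"
    proof (intro AE_I2 tendsto_mult_right_zero)
      fix z
      define y where "y n = \<mu> * X n + sqrt (X n) * z" for n
      have y: "y \<longlonglongrightarrow> \<mu> * 0 + sqrt 0 * z" unfolding y_def by (intro tendsto_intros X0)
      have "(\<lambda>n. cosh_phi x (y n)) \<longlonglongrightarrow> cosh_phi x (\<mu> * 0 + sqrt 0 * z)"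
        unfolding cosh_phi_def by (intro tendsto_intros y)
      then have a: "(\<lambda>n. arcosh (cosh_phi x (y n))) \<longlonglongrightarrow> arcosh (cosh_phi x (\<mu> * 0 + sqrt 0 * z))"
        by (rule tendsto_arcosh_strong) (use x cosh_phi_ge(2)[of x] in auto)
      have "(\<lambda>n. (arcosh (cosh_phi x (y n)))\<^sup>2 - (y n)\<^sup>2) \<longlonglongrightarrow>
          (arcosh (cosh_phi x (\<mu> * 0 + sqrt 0 * z)))\<^sup>2 - (\<mu> * 0 + sqrt 0 * z)\<^sup>2"
        by (intro tendsto_intros a y)
      then have l: "(\<lambda>n. (arcosh (cosh_phi x (y n)))\<^sup>2 - (y n)\<^sup>2) \<longlonglongrightarrow> (arcosh (1 + x))\<^sup>2"
        by (simp add: cosh_phi_def add.commute)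
      have pos: "(arcosh (1 + x))\<^sup>2 > 0"
        using x by simp
      have inv: "filterlim (\<lambda>n. inverse (2 * X n)) at_top sequentially"
      proof (rule filterlim_compose[OF filterlim_inverse_at_top_right])
        have "(\<lambda>n. 2 * X n) \<longlonglongrightarrow> 2 * 0" by (intro tendsto_intros X0)
        then show "filterlim (\<lambda>n. 2 * X n) (at_right 0) sequentially"
          using X by (auto simp: filterlim_at intro!: always_eventually) (metis less_irrefl)
      qed
      have "filterlim (\<lambda>n. ((arcosh (cosh_phi x (y n)))\<^sup>2 - (y n)\<^sup>2) * inverse (2 * X n)) at_top sequentially"
        by (rule filterlim_tendsto_pos_mult_at_top[OF l pos inv])
      then have "filterlim (\<lambda>n. - (((arcosh (cosh_phi x (y n)))\<^sup>2 - (y n)\<^sup>2) * inverse (2 * X n))) at_bot sequentially"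
        by (simp add: filterlim_uminus_at_bot)
      moreover have "- (((arcosh (cosh_phi x (y n)))\<^sup>2 - (y n)\<^sup>2) * inverse (2 * X n)) = gauss_exponent \<mu> (X n) x z" for n
        unfolding gauss_exponent_def y_def[symmetric] divide_inverse by (simp add: algebra_simps)
      ultimately show "(\<lambda>n. exp (gauss_exponent \<mu> (X n) x z)) \<longlonglongrightarrow> 0"
        by (intro filterlim_compose[OF exp_at_bot]) simp
    qed
    show "AE z in lborel. norm (std_normal_density z * exp (gauss_exponent \<mu> (X n) x z)) \<le> std_normal_density z" for n
      using gauss_exponent_nonpos[OF X, of x] x by (intro AE_I2) (simp add: mult_left_le)
  qed (use measurable_gauss_exponent in \<open>auto intro: borel_measurable_times\<close>)
  then show "(\<lambda>n. hyp_transform \<mu> (X n) x) \<longlonglongrightarrow> 0" by simp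
qed

section \<open>Comparison\<close>

text \<open>The edge \<open>x = 0\<close> belongs to the domain of continuity and the initial time
  does not, because of the corner. The time derivative is one-sided since that is what is
  established for \<open>inv_moment\<close>.\<close>

definition parabolic_solution :: "real \<Rightarrow> (real \<Rightarrow> real \<Rightarrow> real) \<Rightarrow> bool" where
  "parabolic_solution \<mu> u \<longleftrightarrow>
     continuous_on ({0<..} \<times> {0..}) (\<lambda>(t, x). u t x) \<and>
     (\<exists>ux uxx. \<forall>t>0. \<forall>x>0.
        (u t has_real_derivative ux t x) (at x) \<and> (ux t has_real_derivative uxx t x) (at x) \<and>
        ((\<lambda>t. u t x) has_real_derivative ((2 * x\<^sup>2 + x) * uxx t x + 2 * (1 - \<mu>) * x * ux t x)) (at_left t))"

text \<open>The boundary information is split: \<open>u\<close> alone must be near 1 close to the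
  edge, uniformly in time, and \<open>v\<close> alone near 0 at early times, uniformly away from the
  edge. Together with \<open>u \<ge> 0\<close> and \<open>v \<le> 1\<close> this bounds
  \<open>u - v\<close> from below at the initial time and on both lateral sides.\<close>

lemma parabolic_comparison:
  fixes u v :: "real \<Rightarrow> real \<Rightarrow> real" and \<mu> t x :: real
  assumes u: "parabolic_solution \<mu> u" and v: "parabolic_solution \<mu> v"
    and u0: "\<And>t x. t > 0 \<Longrightarrow> x > 0 \<Longrightarrow> u t x \<ge> 0" and v1: "\<And>t x. t > 0 \<Longrightarrow> x > 0 \<Longrightarrow> v t x \<le> 1"
    and ubd: "\<And>\<delta> T. \<delta> > 0 \<Longrightarrow> T > 0 \<Longrightarrow> \<exists>x1>0. \<forall>t x. 0 < t \<longrightarrow> t \<le> T \<longrightarrow> 0 < x \<longrightarrow> x \<le> x1 \<longrightarrow> u t x \<ge> 1 - \<delta>"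
    and vbd: "\<And>\<delta> x1. \<delta> > 0 \<Longrightarrow> x1 > 0 \<Longrightarrow> \<exists>t1>0. \<forall>t x. 0 < t \<longrightarrow> t \<le> t1 \<longrightarrow> x1 \<le> x \<longrightarrow> v t x \<le> \<delta>"
    and t: "t > 0" and x: "x > 0"
  shows "v t x \<le> u t x"
proof -
  obtain ux uxx where cu: "continuous_on ({0<..} \<times> {0..}) (\<lambda>(t, x). u t x)"
    and du: "\<And>t x. t > 0 \<Longrightarrow> x > 0 \<Longrightarrow> (u t has_real_derivative ux t x) (at x) \<and>
        (ux t has_real_derivative uxx t x) (at x) \<and>
        ((\<lambda>t. u t x) has_real_derivative ((2 * x\<^sup>2 + x) * uxx t x + 2 * (1 - \<mu>) * x * ux t x)) (at_left t)"
    using u unfolding parabolic_solution_def by blast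
  obtain vx vxx where cv: "continuous_on ({0<..} \<times> {0..}) (\<lambda>(t, x). v t x)"
    and dv: "\<And>t x. t > 0 \<Longrightarrow> x > 0 \<Longrightarrow> (v t has_real_derivative vx t x) (at x) \<and>
        (vx t has_real_derivative vxx t x) (at x) \<and>
        ((\<lambda>t. v t x) has_real_derivative ((2 * x\<^sup>2 + x) * vxx t x + 2 * (1 - \<mu>) * x * vx t x)) (at_left t)"
    using v unfolding parabolic_solution_def by blast
  define C where "C = 2 * \<bar>1 - \<mu>\<bar> + 1"
  define K where "K = exp (C * t) * (1 + x)"
  have K: "K > 0" using x by (simp add: K_def)
  have C: "C > 0" unfolding C_def by (rule add_nonneg_pos) auto
  have main: "v t x \<le> u t x + \<delta> * K" if \<delta>: "\<delta> > 0" for \<delta>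
  proof -
    obtain x1' where x1': "x1' > 0" "\<And>t' x. 0 < t' \<Longrightarrow> t' \<le> t \<Longrightarrow> 0 < x \<Longrightarrow> x \<le> x1' \<Longrightarrow> u t' x \<ge> 1 - \<delta>"
      using ubd[OF \<delta> t] by blast
    define x1 where "x1 = min x1' x"
    have x1: "0 < x1" "x1 \<le> x" "x1 \<le> x1'" using x1' x by (auto simp: x1_def)
    \<comment> \<open>The order of choice matters: the early smallness of \<open>v\<close> is
      available only away from the edge, so \<open>t1\<close> may depend on
      \<open>x1\<close>.\<close>
    obtain t1' where t1': "t1' > 0" "\<And>t x. 0 < t \<Longrightarrow> t \<le> t1' \<Longrightarrow> x1 \<le> x \<Longrightarrow> v t x \<le> \<delta>"
      using vbd[OF \<delta> x1(1)] by blast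
    define t1 where "t1 = min t1' (t / 2)"
    have t1: "0 < t1" "t1 < t" "t1 \<le> t1'" using t1' t by (auto simp: t1_def)
    \<comment> \<open>Far enough out that \<open>\<delta> (1 + X)\<close> reaches 1, the trivial
      bound for \<open>v - u\<close>.\<close>
    define X where "X = x + 1 / \<delta>"
    have X: "x < X" "1 \<le> \<delta> * (1 + X)" "x1 < X"
      using \<delta> x x1 by (auto simp: X_def field_simps add_pos_pos add_strict_increasing)
    have "u t x - v t x \<ge> - \<delta> * exp ((2 * \<bar>1 - \<mu>\<bar> + 1) * (t - t1)) * (1 + x)"
    proof (rule parabolic_maximum_principle[where wx = "\<lambda>t x. ux t x - vx t x" and wxx = "\<lambda>t x. uxx t x - vxx t x"
          and X = X and ?x1.0 = x1 and T = t])
      have sub: "{t1..t} \<times> {x1..X} \<subseteq> {0<..} \<times> {0..}" using t1 x1 by auto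
      show "continuous_on ({t1..t} \<times> {x1..X}) (\<lambda>(t, x). u t x - v t x)"
        using continuous_on_diff[OF continuous_on_subset[OF cu sub] continuous_on_subset[OF cv sub]]
        by (simp add: case_prod_beta)
    next
      fix s y assume "t1 < s" "s \<le> t" "x1 < y" "y < X"
      then have sy: "s > 0" "y > 0" using t1 x1 by auto
      show "((\<lambda>x. u s x - v s x) has_real_derivative ux s y - vx s y) (at y)"
        using du[OF sy] dv[OF sy] by (intro DERIV_diff) auto
      show "((\<lambda>x. ux s x - vx s x) has_real_derivative uxx s y - vxx s y) (at y)"
        using du[OF sy] dv[OF sy] by (intro DERIV_diff) auto
      show "((\<lambda>t. u t y - v t y) has_real_derivative
          (2 * y\<^sup>2 + y) * (uxx s y - vxx s y) + 2 * (1 - \<mu>) * y * (ux s y - vx s y)) (at_left s)"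
        using DERIV_diff[OF du[OF sy, THEN conjunct2, THEN conjunct2] dv[OF sy, THEN conjunct2, THEN conjunct2]]
        by (rule DERIV_cong) (simp add: algebra_simps)
    next
      fix y assume "x1 \<le> y" "y \<le> X"
      then show "- \<delta> \<le> u t1 y - v t1 y"
        using u0[of t1 y] t1'(2)[of t1 y] t1 x1 by auto
    next
      fix s assume "t1 \<le> s" "s \<le> t"
      then have s: "0 < s" "s \<le> t" using t1 by auto
      show "- \<delta> \<le> u s x1 - v s x1"
        using x1'(2)[OF s x1(1,3)] v1[OF s(1) x1(1)] by linarith
      have "u s X \<ge> 0" "v s X \<le> 1" using u0 v1 s X x by auto
      then show "- \<delta> * (1 + X) \<le> u s X - v s X" using X(2) by auto
    qed (use t1 x1 X \<delta> in auto)
    moreover have "\<delta> * exp (C * (t - t1)) * (1 + x) \<le> \<delta> * K"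
      unfolding K_def mult.assoc using \<delta> x C t1 by (intro mult_left_mono mult_right_mono) auto
    ultimately show ?thesis by (simp add: C_def)
  qed
  show ?thesis
  proof (rule field_le_epsilon)
    fix e :: real assume "e > 0"
    then show "v t x \<le> u t x + e" using main[of "e / K"] K by simp
  qed
qed

lemma continuous_on_timespaceI:
  fixes u :: "real \<Rightarrow> real \<Rightarrow> real"
  assumes "\<And>X t Y x. X \<longlonglongrightarrow> t \<Longrightarrow> t > 0 \<Longrightarrow> (\<And>n. X n > 0) \<Longrightarrow> Y \<longlonglongrightarrow> x \<Longrightarrow> (\<And>n. Y n \<ge> 0) \<Longrightarrow>
     (\<lambda>n. u (X n) (Y n)) \<longlonglongrightarrow> u t x"
  shows "continuous_on ({0<..} \<times> {0..}) (\<lambda>(t, x). u t x)"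
  unfolding continuous_on_sequentially
proof (intro allI ballI impI)
  fix p :: "nat \<Rightarrow> real \<times> real" and q assume q: "q \<in> {0<..} \<times> {0..}" and p: "(\<forall>n::nat. p n \<in> {0<..} \<times> {0..}) \<and> p \<longlonglongrightarrow> q"
  have "(\<lambda>n. u (fst (p n)) (snd (p n))) \<longlonglongrightarrow> u (fst q) (snd q)"
    using p q by (intro assms tendsto_fst tendsto_snd) (auto simp: mem_Times_iff)
  then show "((\<lambda>(t, x). u t x) \<circ> p) \<longlonglongrightarrow> (case q of (t, x) \<Rightarrow> u t x)"
    by (simp add: comp_def case_prod_beta)
qed

lemma has_real_derivative_at_left_shift:
  fixes f :: "real \<Rightarrow> real"
  assumes "(f has_real_derivative D) (at_left (t + \<epsilon>))"
  shows "((\<lambda>t. f (t + \<epsilon>)) has_real_derivative D) (at_left t)"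
proof -
  have "(\<lambda>t. t + \<epsilon>) ` {..<t} = {..<t + \<epsilon>}"
    by (auto simp: image_iff intro!: bexI[of _ "_ - \<epsilon>"])
  with assms have "(f has_real_derivative D) (at (t + \<epsilon>) within (\<lambda>t. t + \<epsilon>) ` {..<t})" by simp
  moreover have "((\<lambda>t. t + \<epsilon>) has_real_derivative 1) (at_left t)"
    by (auto intro!: derivative_eq_intros)
  ultimately have "(f \<circ> (\<lambda>t. t + \<epsilon>) has_real_derivative D * 1) (at_left t)"
    by (rule DERIV_image_chain)
  then show ?thesis by (simp add: comp_def)
qed

text \<open>The coefficients do not depend on time, so translates in time solve the same
  equation.\<close>

lemma parabolic_solution_shift:
  assumes u: "parabolic_solution \<mu> u" and \<epsilon>: "\<epsilon> > 0"
  shows "parabolic_solution \<mu> (\<lambda>t. u (t + \<epsilon>))"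
proof -
  obtain ux uxx where c: "continuous_on ({0<..} \<times> {0..}) (\<lambda>(t, x). u t x)"
    and d: "\<And>t x. t > 0 \<Longrightarrow> x > 0 \<Longrightarrow> (u t has_real_derivative ux t x) (at x) \<and>
        (ux t has_real_derivative uxx t x) (at x) \<and>
        ((\<lambda>t. u t x) has_real_derivative ((2 * x\<^sup>2 + x) * uxx t x + 2 * (1 - \<mu>) * x * ux t x)) (at_left t)"
    using u unfolding parabolic_solution_def by blast
  have "continuous_on ({0<..} \<times> {0..}) (\<lambda>p. (\<lambda>(t, x). u t x) (fst p + \<epsilon>, snd p))"
    by (rule continuous_on_compose2[OF c]) (use \<epsilon> in \<open>auto intro!: continuous_intros\<close>)
  then have c': "continuous_on ({0<..} \<times> {0..}) (\<lambda>(t, x). u (t + \<epsilon>) x)"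
    by (simp add: case_prod_beta)
  show ?thesis
    unfolding parabolic_solution_def
  proof (rule conjI[OF c'], rule exI[of _ "\<lambda>t. ux (t + \<epsilon>)"], rule exI[of _ "\<lambda>t. uxx (t + \<epsilon>)"], intro allI impI conjI)
    fix t x :: real assume tx: "t > 0" "x > 0"
    then have te: "t + \<epsilon> > 0" using \<epsilon> by simp
    show "(u (t + \<epsilon>) has_real_derivative ux (t + \<epsilon>) x) (at x)"
      "(ux (t + \<epsilon>) has_real_derivative uxx (t + \<epsilon>) x) (at x)"
      using d[OF te tx(2)] by auto
    show "((\<lambda>t. u (t + \<epsilon>) x) has_real_derivative
        (2 * x\<^sup>2 + x) * uxx (t + \<epsilon>) x + 2 * (1 - \<mu>) * x * ux (t + \<epsilon>) x) (at_left t)"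
      using d[OF te tx(2)] by (intro has_real_derivative_at_left_shift) blast
  qed
qed

section \<open>The two transforms as solutions, and their equality\<close>

lemma parabolic_solution_hyp_transform: "parabolic_solution \<mu> (hyp_transform \<mu>)"
proof -
  have c: "continuous_on ({0<..} \<times> {0..}) (\<lambda>(t, x). hyp_transform \<mu> t x)"
    by (rule continuous_on_timespaceI) (rule tendsto_hyp_transform)
  show ?thesis
    unfolding parabolic_solution_def
  proof (rule conjI[OF c],
      rule exI[of _ "\<lambda>t x. \<integral>y. hyp_kernel_x \<mu> t x y \<partial>lborel"],
      rule exI[of _ "\<lambda>t x. \<integral>y. hyp_kernel_xx \<mu> t x y \<partial>lborel"], intro allI impI conjI)
    fix t x :: real assume tx: "t > 0" "x > 0"
    show "((\<lambda>t. hyp_transform \<mu> t x) has_real_derivative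
        (2 * x\<^sup>2 + x) * (\<integral>y. hyp_kernel_xx \<mu> t x y \<partial>lborel) + 2 * (1 - \<mu>) * x * (\<integral>y. hyp_kernel_x \<mu> t x y \<partial>lborel)) (at_left t)"
      using hyp_transform_time_derivative[OF tx, of \<mu>]
      unfolding hyp_transform_pde[OF tx] by (rule has_field_derivative_at_within)
  qed (auto intro: hyp_transform_x_derivative hyp_transform_xx_derivative)
qed

context brownian
begin

lemma parabolic_solution_inv_moment: "parabolic_solution \<mu> (inv_moment \<mu> 0)"
proof -
  have c: "continuous_on ({0<..} \<times> {0..}) (\<lambda>(t, x). inv_moment \<mu> 0 t x)"
    by (rule continuous_on_timespaceI) (rule tendsto_inv_moment_0)
  show ?thesis
    unfolding parabolic_solution_def
  proof (rule conjI[OF c],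
      rule exI[of _ "\<lambda>t x. - inv_moment \<mu> 1 t x"], rule exI[of _ "inv_moment \<mu> 2"], intro allI impI conjI)
    fix t x :: real assume tx: "t > 0" "x > 0"
    show "(inv_moment \<mu> 0 t has_real_derivative - inv_moment \<mu> 1 t x) (at x)"
      using inv_moment_derivative[OF tx, of \<mu> 0] by simp
    show "((\<lambda>x. - inv_moment \<mu> 1 t x) has_real_derivative inv_moment \<mu> 2 t x) (at x)"
      using DERIV_minus[OF inv_moment_derivative[OF tx, of \<mu> 1]] by (simp add: numeral_2_eq_2)
    show "((\<lambda>t. inv_moment \<mu> 0 t x) has_real_derivative
        (2 * x\<^sup>2 + x) * inv_moment \<mu> 2 t x + 2 * (1 - \<mu>) * x * - inv_moment \<mu> 1 t x) (at_left t)"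
      using inv_moment_left_time_derivative[OF tx, of \<mu>] by simp
  qed
qed

lemma inv_moment_le_hyp_transform:
  assumes t: "t > 0" and x: "x > 0"
  shows "inv_moment \<mu> 0 t x \<le> hyp_transform \<mu> t x"
proof -
  have le: "inv_moment \<mu> 0 t x \<le> hyp_transform \<mu> (t + \<epsilon>) x" if \<epsilon>: "\<epsilon> > 0" for \<epsilon>
  proof (rule parabolic_comparison[where u = "\<lambda>t. hyp_transform \<mu> (t + \<epsilon>)" and v = "inv_moment \<mu> 0" and \<mu> = \<mu>])
    show "parabolic_solution \<mu> (\<lambda>t. hyp_transform \<mu> (t + \<epsilon>))" "parabolic_solution \<mu> (inv_moment \<mu> 0)"
      using \<epsilon> by (auto intro: parabolic_solution_shift parabolic_solution_hyp_transform parabolic_solution_inv_moment)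
  next
    fix t x :: real assume "t > 0" "x > 0"
    then show "hyp_transform \<mu> (t + \<epsilon>) x \<ge> 0" "inv_moment \<mu> 0 t x \<le> 1"
      using \<epsilon> by (auto intro!: hyp_transform_nonneg inv_moment_0_le_1)
  next
    fix \<delta> T :: real assume \<delta>: "\<delta> > 0" and T: "T > 0"
    \<comment> \<open>The shift keeps the time in the compact interval
      \<open>[\<epsilon>, T + \<epsilon>]\<close>. Uniform continuity there stands in for
      monotonicity in time, which is at hand only for \<open>inv_moment\<close>.\<close>
    have "continuous_on ({\<epsilon>..T + \<epsilon>} \<times> {0..1}) (\<lambda>(t, x). hyp_transform \<mu> t x)"
      by (rule continuous_on_subset[OF continuous_on_timespaceI[OF tendsto_hyp_transform]]) (use \<epsilon> in auto)
    then have "uniformly_continuous_on ({\<epsilon>..T + \<epsilon>} \<times> {0..1}) (\<lambda>(t, x). hyp_transform \<mu> t x)"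
      by (rule compact_uniformly_continuous) (simp add: compact_Times)
    then obtain d where d: "d > 0" "\<And>p q. p \<in> {\<epsilon>..T + \<epsilon>} \<times> {0..1} \<Longrightarrow> q \<in> {\<epsilon>..T + \<epsilon>} \<times> {0..1} \<Longrightarrow>
        dist q p < d \<Longrightarrow> dist (case q of (t, x) \<Rightarrow> hyp_transform \<mu> t x) (case p of (t, x) \<Rightarrow> hyp_transform \<mu> t x) < \<delta>"
      using \<delta> unfolding uniformly_continuous_on_def by meson
    show "\<exists>x1>0. \<forall>t x. 0 < t \<longrightarrow> t \<le> T \<longrightarrow> 0 < x \<longrightarrow> x \<le> x1 \<longrightarrow> 1 - \<delta> \<le> hyp_transform \<mu> (t + \<epsilon>) x"
    proof (intro exI[of _ "min 1 (d / 2)"] conjI allI impI)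
      fix t x :: real assume a: "0 < t" "t \<le> T" "0 < x" "x \<le> min 1 (d / 2)"
      have "dist (hyp_transform \<mu> (t + \<epsilon>) x) (hyp_transform \<mu> (t + \<epsilon>) 0) < \<delta>"
        using d(2)[of "(t + \<epsilon>, 0)" "(t + \<epsilon>, x)"] a d(1) \<epsilon> by (simp add: dist_Pair_Pair)
      then show "1 - \<delta> \<le> hyp_transform \<mu> (t + \<epsilon>) x"
        using a \<epsilon> by (simp add: hyp_transform_zero dist_real_def abs_less_iff)
    qed (use d in auto)
  next
    fix \<delta> x1 :: real assume \<delta>: "\<delta> > 0" and x1: "x1 > 0"
    obtain n where n: "inv_moment \<mu> 0 (1 / real (Suc n)) x1 < \<delta>"
      using order_tendstoD(2)[OF inv_moment_0_initial[OF x1, of \<mu>] \<delta>] by (auto simp: eventually_sequentially)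
    show "\<exists>t1>0. \<forall>t x. 0 < t \<longrightarrow> t \<le> t1 \<longrightarrow> x1 \<le> x \<longrightarrow> inv_moment \<mu> 0 t x \<le> \<delta>"
    proof (intro exI[of _ "1 / real (Suc n)"] conjI allI impI)
      fix t x :: real assume a: "0 < t" "t \<le> 1 / real (Suc n)" "x1 \<le> x"
      have "inv_moment \<mu> 0 t x \<le> inv_moment \<mu> 0 (1 / real (Suc n)) x1"
        by (rule inv_moment_0_mono) (use a x1 in auto)
      then show "inv_moment \<mu> 0 t x \<le> \<delta>" using n by simp
    qed simp
  qed (use t x in auto)
  \<comment> \<open>The time shift is removed by continuity at the positive time
    \<open>t\<close>.\<close>
  have "(\<lambda>n. hyp_transform \<mu> (t + 1 / real (Suc n)) x) \<longlonglongrightarrow> hyp_transform \<mu> t x"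
  proof (rule tendsto_hyp_transform)
    have "(\<lambda>n. t + 1 / real (Suc n)) \<longlonglongrightarrow> t + 0" by (intro tendsto_intros LIMSEQ_Suc lim_1_over_n)
    then show "(\<lambda>n. t + 1 / real (Suc n)) \<longlonglongrightarrow> t" by simp
  qed (use t x in \<open>auto intro: add_pos_pos\<close>)
  then show ?thesis
    by (rule LIMSEQ_le_const) (use le in auto)
qed

text \<open>The roles are exchanged: closeness to 1 near the edge now comes from monotonicity of
  \<open>inv_moment\<close> in time and space, smallness at early times from monotonicity of
  \<open>hyp_transform\<close> in \<open>x\<close>.\<close>

lemma hyp_transform_le_inv_moment:
  assumes t: "t > 0" and x: "x > 0"
  shows "hyp_transform \<mu> t x \<le> inv_moment \<mu> 0 t x"
proof -
  have le: "hyp_transform \<mu> t x \<le> inv_moment \<mu> 0 (t + \<epsilon>) x" if \<epsilon>: "\<epsilon> > 0" for \<epsilon>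
  proof (rule parabolic_comparison[where u = "\<lambda>t. inv_moment \<mu> 0 (t + \<epsilon>)" and v = "hyp_transform \<mu>" and \<mu> = \<mu>])
    show "parabolic_solution \<mu> (\<lambda>t. inv_moment \<mu> 0 (t + \<epsilon>))" "parabolic_solution \<mu> (hyp_transform \<mu>)"
      using \<epsilon> by (auto intro: parabolic_solution_shift parabolic_solution_hyp_transform parabolic_solution_inv_moment)
  next
    fix t x :: real assume "t > 0" "x > 0"
    then show "inv_moment \<mu> 0 (t + \<epsilon>) x \<ge> 0" "hyp_transform \<mu> t x \<le> 1"
      using \<epsilon> by (auto intro!: inv_moment_0_nonneg hyp_transform_le_1)
  next
    fix \<delta> T :: real assume \<delta>: "\<delta> > 0" and T: "T > 0"
    have "(\<lambda>n. inv_moment \<mu> 0 \<epsilon> (1 / real (Suc n))) \<longlonglongrightarrow> inv_moment \<mu> 0 \<epsilon> 0"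
      by (rule tendsto_inv_moment_0[OF tendsto_const \<epsilon> \<epsilon> LIMSEQ_Suc[OF lim_1_over_n]]) simp
    then have "(\<lambda>n. inv_moment \<mu> 0 \<epsilon> (1 / real (Suc n))) \<longlonglongrightarrow> 1" by (simp add: inv_moment_0_zero[OF \<epsilon>])
    from order_tendstoD(1)[OF this, of "1 - \<delta>"] \<delta>
    obtain n where n: "inv_moment \<mu> 0 \<epsilon> (1 / real (Suc n)) > 1 - \<delta>" by (auto simp: eventually_sequentially)
    show "\<exists>x1>0. \<forall>t x. 0 < t \<longrightarrow> t \<le> T \<longrightarrow> 0 < x \<longrightarrow> x \<le> x1 \<longrightarrow> 1 - \<delta> \<le> inv_moment \<mu> 0 (t + \<epsilon>) x"
    proof (intro exI[of _ "1 / real (Suc n)"] conjI allI impI)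
      fix t x :: real assume a: "0 < t" "t \<le> T" "0 < x" "x \<le> 1 / real (Suc n)"
      have "inv_moment \<mu> 0 \<epsilon> (1 / real (Suc n)) \<le> inv_moment \<mu> 0 (t + \<epsilon>) x"
        by (rule inv_moment_0_mono) (use a \<epsilon> in auto)
      then show "1 - \<delta> \<le> inv_moment \<mu> 0 (t + \<epsilon>) x" using n by simp
    qed simp
  next
    fix \<delta> x1 :: real assume \<delta>: "\<delta> > 0" and x1: "x1 > 0"
    obtain b where b: "b > 0" "\<And>t. 0 < t \<Longrightarrow> t < b \<Longrightarrow> hyp_transform \<mu> t x1 < \<delta>"
      using order_tendstoD(2)[OF hyp_transform_initial[OF x1, of \<mu>] \<delta>] by (auto simp: eventually_at_right_field)
    show "\<exists>t1>0. \<forall>t x. 0 < t \<longrightarrow> t \<le> t1 \<longrightarrow> x1 \<le> x \<longrightarrow> hyp_transform \<mu> t x \<le> \<delta>"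
    proof (intro exI[of _ "b / 2"] conjI allI impI)
      fix t x :: real assume a: "0 < t" "t \<le> b / 2" "x1 \<le> x"
      have "hyp_transform \<mu> t x \<le> hyp_transform \<mu> t x1"
        by (rule hyp_transform_antimono) (use a x1 in auto)
      moreover have "hyp_transform \<mu> t x1 < \<delta>" using b a by auto
      ultimately show "hyp_transform \<mu> t x \<le> \<delta>" by simp
    qed (use b in simp)
  qed (use t x in auto)
  have "(\<lambda>n. inv_moment \<mu> 0 (t + 1 / real (Suc n)) x) \<longlonglongrightarrow> inv_moment \<mu> 0 t x"
  proof (rule tendsto_inv_moment)
    have "(\<lambda>n. t + 1 / real (Suc n)) \<longlonglongrightarrow> t + 0" by (intro tendsto_intros LIMSEQ_Suc lim_1_over_n)
    then show "(\<lambda>n. t + 1 / real (Suc n)) \<longlonglongrightarrow> t" by simp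
  qed (use t x in \<open>auto intro: add_pos_pos\<close>)
  then show ?thesis
    by (rule LIMSEQ_le_const) (use le in auto)
qed

lemma G_fun_eq_laplace_inverse:
  assumes "t > 0" "x > 0"
  shows "G_fun M B \<mu> t x = (\<integral>\<omega>. exp (- x / exp_functional B \<mu> t \<omega>) \<partial>M)"
proof -
  have "G_fun M B \<mu> t x = hyp_transform \<mu> t x"
    using assms BM by (intro G_fun_eq_hyp_transform) auto
  also have "\<dots> = inv_moment \<mu> 0 t x"
    using hyp_transform_le_inv_moment[OF assms] inv_moment_le_hyp_transform[OF assms] by (rule antisym)
  finally show ?thesis by (simp add: inv_moment_def)
qed

end

section \<open>Mixtures and the theorem\<close>

lemma nn_integral_exp_minus_pos:
  fixes c :: real
  assumes "c > 0"
  shows "(\<integral>\<^sup>+y. ennreal (exp (- c * y)) * indicator {0<..} y \<partial>lborel) = ennreal (1 / c)"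
proof -
  have "(\<integral>\<^sup>+y. ennreal (exp (- c * y)) * indicator {0<..} y \<partial>lborel) =
      (\<integral>\<^sup>+y. ennreal (exp (- c * y)) * indicator {0..} y \<partial>lborel)"
    by (intro nn_integral_cong_AE eventually_mono[OF AE_lborel_singleton[of 0]])
       (auto simp: indicator_def)
  also have "\<dots> = ennreal (0 - - exp (- c * 0) / c)"
  proof (rule nn_integral_FTC_atLeast)
    show "((\<lambda>y. - exp (- c * y) / c) has_real_derivative exp (- c * y)) (at y)" for y
      using assms by (auto intro!: derivative_eq_intros)
    have "filterlim (\<lambda>y. c * y) at_top at_top"
      by (rule filterlim_tendsto_pos_mult_at_top[OF tendsto_const assms filterlim_ident])
    then have "filterlim (\<lambda>y. - c * y) at_bot at_top"
      by (simp add: filterlim_uminus_at_bot)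
    from filterlim_compose[OF exp_at_bot this]
    have "((\<lambda>y. - exp (- c * y) / c) \<longlongrightarrow> - 0 / c) at_top"
      using assms by (intro tendsto_intros) auto
    then show "((\<lambda>y. - exp (- c * y) / c) \<longlongrightarrow> 0) at_top" by simp
  qed auto
  finally show ?thesis by simp
qed

text \<open>Write \<open>(1 - exp(-\<beta> y)) / y\<close> as the integral of
  \<open>exp(-s y)\<close> over \<open>s\<close> in \<open>[0, \<beta>]\<close> and exchange the
  integrals; the inner one becomes \<open>1 / (1/a + s)\<close>, whose primitive is a
  logarithm.\<close>

lemma frullani_log:
  fixes a \<beta> :: real
  assumes a: "a > 0" and \<beta>: "\<beta> > 0"
  shows "(\<integral>\<^sup>+y. ennreal (exp (- y / a) * ((1 - exp (- y * \<beta>)) / y)) * indicator {0<..} y \<partial>lborel) = ennreal (ln (1 + \<beta> * a))"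
proof -
  let ?f = "\<lambda>y s. ennreal (exp (- y * (1 / a + s))) * indicator {0<..} y * indicator {0..\<beta>} s"
  have 1: "ennreal (exp (- y / a) * ((1 - exp (- y * \<beta>)) / y)) * indicator {0<..} y = (\<integral>\<^sup>+s. ?f y s \<partial>lborel)" for y :: real
  proof (cases "y > 0")
    case True
    have "(\<integral>\<^sup>+s. ?f y s \<partial>lborel) = (\<integral>\<^sup>+s. ennreal (exp (- y * (1 / a + s))) * indicator {0..\<beta>} s \<partial>lborel)"
      using True by simp
    also have "\<dots> = ennreal (- exp (- y * (1 / a + \<beta>)) / y - - exp (- y * (1 / a + 0)) / y)"
    proof (rule nn_integral_FTC_Icc)
      show "((\<lambda>s. - exp (- y * (1 / a + s)) / y) has_real_derivative exp (- y * (1 / a + s))) (at s)" for s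
        using True by (auto intro!: derivative_eq_intros)
    qed (use \<beta> in auto)
    also have "- exp (- y * (1 / a + \<beta>)) / y - - exp (- y * (1 / a + 0)) / y = exp (- y / a) * ((1 - exp (- y * \<beta>)) / y)"
    proof -
      have "exp (- y * (1 / a + \<beta>)) = exp (- y / a) * exp (- y * \<beta>)"
        by (simp add: exp_add[symmetric] algebra_simps)
      then show ?thesis by (simp add: diff_divide_distrib right_diff_distrib)
    qed
    finally show ?thesis using True by simp
  qed simp
  have 2: "(\<integral>\<^sup>+y. ?f y s \<partial>lborel) = ennreal (1 / (1 / a + s)) * indicator {0..\<beta>} s" for s :: real
  proof (cases "s \<in> {0..\<beta>}")
    case True
    then have "1 / a + s > 0" using a by (auto intro: add_pos_nonneg)
    from nn_integral_exp_minus_pos[OF this]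
    have "(\<integral>\<^sup>+y. ennreal (exp (- y * (1 / a + s))) * indicator {0<..} y \<partial>lborel) = ennreal (1 / (1 / a + s))"
      by (simp only: minus_mult_commute mult.commute)
    then show ?thesis using True by simp
  qed simp
  have "(\<integral>\<^sup>+y. ennreal (exp (- y / a) * ((1 - exp (- y * \<beta>)) / y)) * indicator {0<..} y \<partial>lborel) =
      (\<integral>\<^sup>+y. \<integral>\<^sup>+s. ?f y s \<partial>lborel \<partial>lborel)"
    unfolding 1 ..
  also have "\<dots> = (\<integral>\<^sup>+s. \<integral>\<^sup>+y. ?f y s \<partial>lborel \<partial>lborel)"
    by (rule lborel_pair.Fubini') measurable
  also have "\<dots> = (\<integral>\<^sup>+s. ennreal (1 / (1 / a + s)) * indicator {0..\<beta>} s \<partial>lborel)"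
    unfolding 2 ..
  also have "\<dots> = ennreal (ln (1 / a + \<beta>) - ln (1 / a + 0))"
  proof (rule nn_integral_FTC_Icc)
    fix s :: real assume "s \<in> {0..\<beta>}"
    then have s: "1 / a + s > 0" using a by (auto intro: add_pos_nonneg)
    show "((\<lambda>s. ln (1 / a + s)) has_real_derivative 1 / (1 / a + s)) (at s)"
      using s by (auto intro!: derivative_eq_intros)
    show "0 \<le> 1 / (1 / a + s)" using s by simp
  qed (use \<beta> in auto)
  also have "ln (1 / a + \<beta>) - ln (1 / a + 0) = ln ((1 / a + \<beta>) / (1 / a))"
  proof -
    have "1 / a + \<beta> > 0" using a \<beta> by (intro add_pos_pos) auto
    then show ?thesis using a by (subst ln_div) simp_all
  qed
  also have "(1 / a + \<beta>) / (1 / a) = 1 + \<beta> * a" using a by (simp add: field_simps)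
  finally show ?thesis .
qed

context brownian
begin

text \<open>Tonelli for \<open>G\<close> as a mixture of the functions \<open>exp(-y/A)\<close>:
  nonnegativity of \<open>k\<close> makes the exchange unconditional, and finiteness comes from
  \<open>r\<close>. Both formulas of the theorem are instances.\<close>

lemma G_fun_mixture_has_integral:
  assumes t: "t > 0" and k: "k \<in> borel_measurable borel" "\<And>y. y > 0 \<Longrightarrow> k y \<ge> 0"
    and r: "integrable M r" "\<And>\<omega>. \<omega> \<in> space M \<Longrightarrow> r \<omega> \<ge> 0"
    and kr: "\<And>\<omega>. \<omega> \<in> space M \<Longrightarrow>
      (\<integral>\<^sup>+y. ennreal (exp (- y / A \<mu> t \<omega>) * k y) * indicator {0<..} y \<partial>lborel) = ennreal (r \<omega>)"
  shows "((\<lambda>y. G_fun M B \<mu> t y * k y) has_integral (\<integral>\<omega>. r \<omega> \<partial>M)) {0<..}"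
proof -
  let ?A = "A \<mu> t"
  note k(1)[measurable] measurable_exp_functional[OF t, measurable]
  interpret P: pair_sigma_finite lborel M by unfold_locales
  let ?f = "\<lambda>y \<omega>. ennreal (exp (- y / ?A \<omega>) * k y) * indicator {0<..} y"
  define g where "g y = (if y > 0 then G_fun M B \<mu> t y * k y else 0)" for y
  have g: "ennreal (g y) = (\<integral>\<^sup>+\<omega>. ?f y \<omega> \<partial>M)" and g0: "g y \<ge> 0" for y
  proof -
    have "ennreal (g y) = (\<integral>\<^sup>+\<omega>. ?f y \<omega> \<partial>M) \<and> g y \<ge> 0"
    proof (cases "y > 0")
      case True
      have i: "integrable M (\<lambda>\<omega>. exp (- y / ?A \<omega>) * k y)"
        using integrable_inv_moment_0[OF t, of y \<mu>] True by auto
      have nn: "0 \<le> exp (- y / ?A \<omega>) * k y" for \<omega> using k(2)[OF True] by simp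
      have "(\<integral>\<^sup>+\<omega>. ?f y \<omega> \<partial>M) = ennreal (\<integral>\<omega>. exp (- y / ?A \<omega>) * k y \<partial>M)"
        using i nn True by (simp add: nn_integral_eq_integral)
      moreover have "(\<integral>\<omega>. exp (- y / ?A \<omega>) * k y \<partial>M) = g y"
        using True by (simp add: g_def G_fun_eq_laplace_inverse[OF t True])
      moreover have "(\<integral>\<omega>. exp (- y / ?A \<omega>) * k y \<partial>M) \<ge> 0"
        using nn by (intro Bochner_Integration.integral_nonneg) simp
      ultimately show ?thesis by simp
    qed (simp add: g_def)
    then show "ennreal (g y) = (\<integral>\<^sup>+\<omega>. ?f y \<omega> \<partial>M)" "g y \<ge> 0" by auto
  qed
  \<comment> \<open>Measurability of \<open>G\<close> in \<open>y\<close> is read off from the inner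
    integral of a jointly measurable function.\<close>
  have gm: "g \<in> borel_measurable borel"
  proof -
    have "(\<lambda>y. \<integral>\<^sup>+\<omega>. ?f y \<omega> \<partial>M) \<in> borel_measurable borel" by measurable
    then have "(\<lambda>y. enn2real (\<integral>\<^sup>+\<omega>. ?f y \<omega> \<partial>M)) \<in> borel_measurable borel" by measurable
    moreover have "enn2real (\<integral>\<^sup>+\<omega>. ?f y \<omega> \<partial>M) = g y" for y
      unfolding g[symmetric] using g0[of y] by simp
    ultimately show ?thesis by (simp only:)
  qed
  have r0: "(\<integral>\<omega>. r \<omega> \<partial>M) \<ge> 0" using r(2) by (intro integral_nonneg_AE AE_I2)
  have "(\<integral>\<^sup>+y. ennreal (g y) \<partial>lborel) = (\<integral>\<^sup>+y. \<integral>\<^sup>+\<omega>. ?f y \<omega> \<partial>M \<partial>lborel)"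
    unfolding g ..
  also have "\<dots> = (\<integral>\<^sup>+\<omega>. \<integral>\<^sup>+y. ?f y \<omega> \<partial>lborel \<partial>M)"
    by (rule P.Fubini'[symmetric]) measurable
  also have "\<dots> = (\<integral>\<^sup>+\<omega>. ennreal (r \<omega>) \<partial>M)"
    by (intro nn_integral_cong kr)
  also have "\<dots> = ennreal (\<integral>\<omega>. r \<omega> \<partial>M)"
    using r by (intro nn_integral_eq_integral AE_I2)
  finally have "(g has_integral (\<integral>\<omega>. r \<omega> \<partial>M)) UNIV"
    using gm g0 r0 by (intro nn_integral_has_integral) auto
  then have "((\<lambda>y. if y \<in> {0<..} then G_fun M B \<mu> t y * k y else 0) has_integral (\<integral>\<omega>. r \<omega> \<partial>M)) UNIV"
    by (simp add: g_def[abs_def])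
  then show ?thesis
    by (simp only: has_integral_restrict_UNIV)
qed

end

text \<open>\<open>has_integral\<close> includes convergence of the integrals over the half line.
  Integrability of the expectations is stated separately because the Bochner integral of a
  non-integrable function is 0 by convention.\<close>

theorem theorem2p8:
  fixes M :: "'a measure" and B :: "real \<Rightarrow> 'a \<Rightarrow> real" and \<mu> \<beta> t :: real
  assumes "std_brownian_motion M B" and "\<beta> > 0" and "t > 0"
  shows "integrable M (\<lambda>\<omega>. ln (1 + \<beta> * exp_functional B \<mu> t \<omega>)) \<and>
         ((\<lambda>y. G_fun M B \<mu> t y / y * (1 - exp (- y * \<beta>))) has_integral
            (\<integral>\<omega>. ln (1 + \<beta> * exp_functional B \<mu> t \<omega>) \<partial>M)) {0<..} \<and>
         (\<exists>I. ((\<lambda>y. G_fun M B \<mu> t y * exp (- y * \<beta>)) has_integral I) {0<..} \<and>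
         integrable M (\<lambda>\<omega>. 1 / (1 + \<beta> * exp_functional B \<mu> t \<omega>)) \<and>
         (\<integral>\<omega>. 1 / (1 + \<beta> * exp_functional B \<mu> t \<omega>) \<partial>M) = 1 - \<beta> * I)"
proof -
  interpret brownian M B using assms(1) by (simp add: brownian_def)
  let ?A = "exp_functional B \<mu> t"
  note measurable_exp_functional[OF assms(3), measurable]
  have A: "?A \<omega> > 0" if "\<omega> \<in> space M" for \<omega> using exp_functional_pos[OF that assms(3)] .
  have bA: "\<beta> * ?A \<omega> > 0" if "\<omega> \<in> space M" for \<omega> using A[OF that] assms(2) by simp
  have i1: "integrable M (\<lambda>\<omega>. ln (1 + \<beta> * ?A \<omega>))"
  proof (rule Bochner_Integration.integrable_bound)
    show "integrable M (\<lambda>\<omega>. \<beta> * ?A \<omega>)" using integrable_exp_functional[OF assms(3)] by simp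
    show "AE \<omega> in M. norm (ln (1 + \<beta> * ?A \<omega>)) \<le> norm (\<beta> * ?A \<omega>)"
    proof (rule AE_I2)
      fix \<omega> assume "\<omega> \<in> space M"
      then have "\<beta> * ?A \<omega> > 0" by (rule bA)
      then show "norm (ln (1 + \<beta> * ?A \<omega>)) \<le> norm (\<beta> * ?A \<omega>)"
        using ln_add_one_self_le_self[of "\<beta> * ?A \<omega>"] by simp
    qed
  qed measurable
  have h1: "((\<lambda>y. G_fun M B \<mu> t y * ((1 - exp (- y * \<beta>)) / y)) has_integral
      (\<integral>\<omega>. ln (1 + \<beta> * ?A \<omega>) \<partial>M)) {0<..}"
  proof (rule G_fun_mixture_has_integral[OF assms(3) _ _ i1])
    show "0 \<le> (1 - exp (- y * \<beta>)) / y" if "y > 0" for y using that assms(2) by simp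
    show "0 \<le> ln (1 + \<beta> * ?A \<omega>)" if "\<omega> \<in> space M" for \<omega> using bA[OF that] by simp
  qed (use frullani_log A assms(2) in auto)
  have b2: "0 \<le> 1 / (1 + \<beta> * ?A \<omega>)" "1 / (1 + \<beta> * ?A \<omega>) \<le> 1" if "\<omega> \<in> space M" for \<omega>
    using bA[OF that] by (auto simp: field_simps)
  have i2: "integrable M (\<lambda>\<omega>. 1 / (1 + \<beta> * ?A \<omega>))"
  proof (rule integrable_const_bound[of _ 1])
    show "AE \<omega> in M. norm (1 / (1 + \<beta> * ?A \<omega>)) \<le> 1"
      using b2 by (intro AE_I2) (simp only: real_norm_def abs_of_nonneg)
  qed measurable
  \<comment> \<open>This equals \<open>1 / (1/A + \<beta>)\<close>, the Laplace transform of
    \<open>exp(-y/A)\<close> at \<open>\<beta>\<close>; solving its expectation for that of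
    \<open>1 / (1 + \<beta> A)\<close> gives the second formula.\<close>
  let ?r = "\<lambda>\<omega>. (1 - 1 / (1 + \<beta> * ?A \<omega>)) / \<beta>"
  have i3: "integrable M ?r" using i2 by simp
  have h2: "((\<lambda>y. G_fun M B \<mu> t y * exp (- y * \<beta>)) has_integral (\<integral>\<omega>. ?r \<omega> \<partial>M)) {0<..}"
  proof (rule G_fun_mixture_has_integral[OF assms(3) _ _ i3])
    fix \<omega> assume \<omega>: "\<omega> \<in> space M"
    show "0 \<le> ?r \<omega>" using b2[OF \<omega>] assms(2) by simp
    have c: "1 / ?A \<omega> + \<beta> > 0" using A[OF \<omega>] assms(2) by (intro add_pos_pos) auto
    have "exp (- y / ?A \<omega>) * exp (- y * \<beta>) = exp (- (1 / ?A \<omega> + \<beta>) * y)" for y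
      by (simp add: exp_add[symmetric] algebra_simps)
    moreover have "1 / (1 / ?A \<omega> + \<beta>) = ?r \<omega>"
    proof -
      have "1 / (1 / a + \<beta>) = (1 - 1 / (1 + \<beta> * a)) / \<beta>" if "a > 0" for a
      proof -
        have "1 + \<beta> * a > 0" using that assms(2) by (simp add: add_pos_pos)
        then have "(1 - 1 / (1 + \<beta> * a)) / \<beta> = a / (1 + \<beta> * a)"
          using assms(2) by (simp add: divide_simps)
        moreover have "1 / (1 / a + \<beta>) = a / (1 + \<beta> * a)"
          using that by (simp add: field_simps)
        ultimately show ?thesis by simp
      qed
      then show ?thesis using A[OF \<omega>] .
    qed
    ultimately show "(\<integral>\<^sup>+y. ennreal (exp (- y / ?A \<omega>) * exp (- y * \<beta>)) * indicator {0<..} y \<partial>lborel) = ennreal (?r \<omega>)"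
      using nn_integral_exp_minus_pos[OF c] by (simp only:)
  qed auto
  have "(\<integral>\<omega>. 1 / (1 + \<beta> * ?A \<omega>) \<partial>M) = 1 - \<beta> * (\<integral>\<omega>. ?r \<omega> \<partial>M)"
    using i2 assms(2) by (simp add: prob_space)
  moreover have "((\<lambda>y. G_fun M B \<mu> t y / y * (1 - exp (- y * \<beta>))) has_integral
      (\<integral>\<omega>. ln (1 + \<beta> * ?A \<omega>) \<partial>M)) {0<..}"
    using h1 by simp
  ultimately show ?thesis
    using h2 i1 i2 by blast
qed

end
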